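(* Let $\lambda>0$. Consider the data, for $0\le c\le\lambda-1$, $$u'_c=\epsilon'_\lambda\circ(\xi^c1_{\mathcal F}),\qquad v'_c=\sum_{a+b=\lambda-1-c}(\xi^a1_{\mathcal F})\circ\eta'_\lambda\circ b^-_{b,\lambda},\qquad u'_\lambda=\sigma_\lambda,\qquad v'_\lambda=-\sigma'_\lambda,$$ (with $a,b\ge0$), where the $u'_i$ are projections from and the $v'_i$ inclusions into $\mathcal{EF}\mathbf 1_\lambda$, which factor the decomposition of $1_{\mathcal{EF}\mathbf 1_\lambda}$ in relation (v) of the context as $1_{\mathcal{EF}\mathbf 1_\lambda}=\sum_{i=0}^\lambda v'_iu'_i$. For the differential $\partial_{-1}$, these data yield a fantastic filtration on $\mathcal{EF}\mathbf 1_\lambda$ corresponding to this decomposition. Moreover, $\partial_{-1}$ is the only specialization of the parameters (in the family of $p$-differentials on $\mathcal U$ described in the context) for which these data yield a fantastic filtration.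
   Context: $\Bbbk$ is a field of characteristic $p>0$. **The $2$-category $\mathcal U$.** Objects: $\lambda\in\mathbb Z$. $1$-morphisms: direct sums of grading shifts of composites of $\mathbf 1_\lambda$, $\mathcal E\mathbf 1_\lambda:\lambda\to\lambda+2$, $\mathcal F\mathbf 1_\lambda:\lambda\to\lambda-2$. Vertical composition is $\circ$ (or omitted), horizontal composition is juxtaposition. Generating $2$-morphisms, for all $\lambda$ (subscripts are omitted when clear; $1_X$ is the identity $2$-morphism of $X$): $\xi:\mathcal E\mathbf 1_\lambda\to\mathcal E\mathbf 1_\lambda$ and $\xi':\mathcal F\mathbf 1_\lambda\to\mathcal F\mathbf 1_\lambda$ of degree $2$; $\tau_\lambda:\mathcal{EE}\mathbf 1_\lambda\to\mathcal{EE}\mathbf 1_\lambda$ and $\tau'_\lambda:\mathcal{FF}\mathbf 1_\lambda\to\mathcal{FF}\mathbf 1_\lambda$ of degree $-2$; $\eta_\lambda:\mathbf 1_\lambda\to\mathcal{FE}\mathbf 1_\lambda$ and $\epsilon_\lambda:\mathcal{FE}\mathbf 1_\lambda\to\mathbf 1_\lambda$ of degree $1+\lambda$; $\eta'_\lambda:\mathbf 1_\lambda\to\mathcal{EF}\mathbf 1_\lambda$ and $\epsilon'_\lambda:\mathcal{EF}\mathbf 1_\lambda\to\mathbf 1_\lambda$ of degree $1-\lambda$. Bubbles $b^{\pm}_{k,\lambda}\in\mathrm{END}(\mathbf 1_\lambda)$, $k\in\mathbb Z$, of degree $2k$ (clockwise $+$, counter-clockwise $-$): real bubbles are $b^+_{k,\lambda}=\epsilon'_\lambda\circ(\xi^{k+\lambda-1}1_{\mathcal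 F})\circ\eta'_\lambda$ for $k\ge1-\lambda$ and $b^-_{k,\lambda}=\epsilon_\lambda\circ(1_{\mathcal F}\xi^{k-\lambda-1})\circ\eta_\lambda$ for $k\ge1+\lambda$; for other $k$ (fake bubbles) they are determined by relation (ii). Sideways crossings: $\sigma_\lambda:=(1_{\mathcal{FE}}\,\epsilon'_\lambda)\circ(1_{\mathcal F}\tau1_{\mathcal F})\circ(\eta_\lambda1_{\mathcal{EF}}):\mathcal{EF}\mathbf 1_\lambda\to\mathcal{FE}\mathbf 1_\lambda$ and $\sigma'_\lambda:=(\epsilon_\lambda1_{\mathcal{EF}})\circ(1_{\mathcal F}\tau1_{\mathcal F})\circ(1_{\mathcal{FE}}\eta'_\lambda):\mathcal{FE}\mathbf 1_\lambda\to\mathcal{EF}\mathbf 1_\lambda$. Relations (for all $\lambda$): (i) $(\epsilon'1_{\mathcal E})(1_{\mathcal E}\eta)=1_{\mathcal E}=(1_{\mathcal E}\epsilon)(\eta'1_{\mathcal E})$; $(\epsilon1_{\mathcal F})(1_{\mathcal F}\eta')=1_{\mathcal F}=(1_{\mathcal F}\epsilon')(\eta1_{\mathcal F})$; $\epsilon'(\xi1_{\mathcal F})=\epsilon'(1_{\mathcal E}\xi')$; $\epsilon(\xi'1_{\mathcal E})=\epsilon(1_{\mathcal F}\xi)$; with $\epsilon'_{(2)}=\epsilon'(1_{\mathcal E}\epsilon'1_{\mathcal F}):\mathcal{EEFF}\mathbf 1_\lambda\to\mathbf 1_\lambda$ and $\epsilon_{(2)}=\epsilon(1_{\mathcal F}\epsilon1_{\mathcal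 E}):\mathcal{FFEE}\mathbf 1_\lambda\to\mathbf 1_\lambda$: $\epsilon'_{(2)}(\tau1_{\mathcal{FF}})=\epsilon'_{(2)}(1_{\mathcal{EE}}\tau')$ and $\epsilon_{(2)}(\tau'1_{\mathcal{EE}})=\epsilon_{(2)}(1_{\mathcal{FF}}\tau)$. (ii) $b^\pm_{k,\lambda}=0$ for $k<0$; $b^\pm_{0,\lambda}=1$; $\sum_{a+b=m}b^+_{a,\lambda}b^-_{b,\lambda}=\delta_{m,0}$ for all $m$. (iii) $\tau^2=0$; $(\tau1_{\mathcal E})(1_{\mathcal E}\tau)(\tau1_{\mathcal E})=(1_{\mathcal E}\tau)(\tau1_{\mathcal E})(1_{\mathcal E}\tau)$; $\tau(\xi1_{\mathcal E})-(1_{\mathcal E}\xi)\tau=1_{\mathcal{EE}}=(\xi1_{\mathcal E})\tau-\tau(1_{\mathcal E}\xi)$. (iv) On $\mathcal E\mathbf 1_\lambda$: $(1_{\mathcal E}\epsilon'_\lambda)(\tau1_{\mathcal F})(1_{\mathcal E}\eta'_\lambda)=-\sum_{a+b=-\lambda}\xi^b\,b^+_{a,\lambda}$ (bubble to the right). On $\mathbf 1_\lambda\mathcal E$: $(\epsilon_\lambda1_{\mathcal E})(1_{\mathcal F}\tau)(\eta_\lambda1_{\mathcal E})=\sum_{a+b=\lambda}b^-_{a,\lambda}\,\xi^b$ (bubble to the left). Here $a,b\ge0$. (v) $1_{\mathcal{EF}\mathbf 1_\lambda}=-\sigma'_\lambda\sigma_\lambda+\sum_{a+b+c=\lambda-1}(\xi^c1_{\mathcal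 F})\circ\eta'_\lambda\circ b^-_{b,\lambda}\circ\epsilon'_\lambda\circ(\xi^a1_{\mathcal F})$ and $1_{\mathcal{FE}\mathbf 1_\lambda}=-\sigma_\lambda\sigma'_\lambda+\sum_{a+b+c=-\lambda-1}(1_{\mathcal F}\xi^c)\circ\eta_\lambda\circ b^+_{b,\lambda}\circ\epsilon_\lambda\circ(1_{\mathcal F}\xi^a)$, with $a,b,c\ge0$. **Family of $p$-differentials.** For parameters $x_\lambda,\bar x_\lambda,y_\lambda,\bar y_\lambda,a_\lambda,\bar a_\lambda\in\mathbb F_p$ ($\lambda\in\mathbb Z$) with $a_\lambda-\bar a_\lambda=x_{\lambda+2}-x_\lambda-2y_\lambda$, $x_\lambda+\bar x_\lambda=-\lambda$, $y_\lambda+\bar y_\lambda=-1$, there is a degree $2$, $p$-nilpotent operator $\partial$ on $2$-morphisms of $\mathcal U$, satisfying the Leibniz rule for vertical and horizontal composition, with $\partial\xi=\xi^2$; $\partial\xi'=(\xi')^2$; $\partial\tau_\lambda=a_\lambda1_{\mathcal{EE}}-(1+a_\lambda)(\xi1_{\mathcal E})\tau_\lambda+(a_\lambda-1)(1_{\mathcal E}\xi)\tau_\lambda$; $\partial\tau'_{\lambda+4}=\bar a_\lambda1_{\mathcal{FF}}-(1+\bar a_\lambda)\tau'_{\lambda+4}(1_{\mathcal F}\xi')+(\bar a_\lambda-1)\tau'_{\lambda+4}(\xi'1_{\mathcal F})$; $\partial\epsilon'_\lambda=x_{\lambda-2}\epsilon'_\lambda(\xi1_{\mathcal F})+y_{\lambda-2}b^+_{1,\lambda}\epsilon'_\lambda$;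 $\partial\eta'_\lambda=\bar x_{\lambda-2}(\xi1_{\mathcal F})\eta'_\lambda+\bar y_{\lambda-2}\eta'_\lambda b^+_{1,\lambda}$; $\partial\epsilon_\lambda=-(\bar x_\lambda+2\bar y_\lambda)\epsilon_\lambda(1_{\mathcal F}\xi)-\bar y_\lambda b^+_{1,\lambda}\epsilon_\lambda$; $\partial\eta_\lambda=-(x_\lambda+2y_\lambda)(1_{\mathcal F}\xi)\eta_\lambda-y_\lambda\eta_\lambda b^+_{1,\lambda}$. The differential $\partial_{-1}$ is the member with $a_m=-1$, $\bar a_m=1$, $x_m=-1-m$, $\bar x_m=1$, $y_m=0$, $\bar y_m=-1$ for all $m\in\mathbb Z$. **Fantastic filtrations.** Let $R$ be a $p$-DG algebra (graded $\Bbbk$-algebra with a degree $2$ operator $\partial$, $\partial^p=0$, satisfying the Leibniz rule), $I$ a finite set, and $u_i,v_i\in R$ ($i\in I$) with $u_iv_iu_i=u_i$, $v_iu_iv_i=v_i$, $v_iu_j=0$ for $i\ne j$; put $\epsilon=\sum_iu_iv_i$. The data yield a fantastic filtration (Fc-filtration) on $R\epsilon$ if $\partial(\epsilon)=0$, $\partial(v_iu_i)=0$ for all $i$, and there is a total order on $I$ such that, with $F^{<i}=\sum_{k<i}Ru_kv_k$, one has $v_i\partial(u_i)=0$ and $u_i\partial(v_i)\in F^{<i}$ for all $i\in I$. (The last two conditions are equivalent to: $F^{\le i}=\sum_{k\le i}Ru_kv_k$ is a filtration of $R\epsilon$ by $p$-DG modules, each $Rv_iu_i$ is a $p$-DG module,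 and the isomorphisms $F^{\le i}/F^{<i}\cong Rv_iu_i$ given by right multiplication by $u_i$ and $v_i$ are isomorphisms of $p$-DG modules.) Here $R$ is the endomorphism algebra in $\mathcal U$ of the direct sum of $\mathcal{EF}\mathbf 1_\lambda$, $\mathcal{FE}\mathbf 1_\lambda$ and $\lambda$ copies of $\mathbf 1_\lambda$, with grading shifts $1-\lambda,3-\lambda,\dots,\lambda-1$; $I=\{0,\dots,\lambda\}$; the definition is applied with $u_i:=v'_i$ (inclusions) and $v_i:=u'_i$ (projections), and $\epsilon=1_{\mathcal{EF}\mathbf 1_\lambda}$.
   Formalization: Uniqueness is claimed only for parameters that enter: at all indices m ≥ -1 if the data yield a filtration for every λ>0, and at λ-2, λ (a, ā at λ-2) for a single λ ≥ 2; parameters at m < -1 are free, and for λ=1 alone x=1, y=-1, a=1 also works. *)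

theory Defs
  imports "HOL-Algebra.Ring"
begin

section \<open>The \<open>2\<close>-category \<open>\<U>\<close>\<close>

text \<open>
  A \<open>1\<close>-morphism \<open>X\<^sub>1 \<cdots> X\<^sub>r 1\<^sub>l\<close> is given by the word \<open>[X\<^sub>1, \<dots>, X\<^sub>r]\<close> and the weight \<open>l\<close> of its source;
  as in the usual notation, the rightmost letter is applied first.  Grading shifts are not recorded
  in the \<open>1\<close>-morphisms: \<open>2\<close>-morphisms of all degrees are considered, so that a shift only affects
  the grading.  Direct sums enter through matrices of \<open>2\<close>-morphisms (\<open>End_ring\<close> below).
\<close>

datatype letter = \<E> | \<F>

fun letter_wt :: "letter \<Rightarrow> int" where
  "letter_wt \<E> = 2"
| "letter_wt \<F> = -2"

definition tgt :: "letter list \<Rightarrow> int \<Rightarrow> int" where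
  "tgt w l = l + sum_list (map letter_wt w)"

datatype gen = gXi | gXi' | gTau | gTau' | gEta | gEps | gEta' | gEps'

fun gdom :: "gen \<Rightarrow> letter list" where
  "gdom gXi = [\<E>]"
| "gdom gXi' = [\<F>]"
| "gdom gTau = [\<E>, \<E>]"
| "gdom gTau' = [\<F>, \<F>]"
| "gdom gEta = []"
| "gdom gEps = [\<F>, \<E>]"
| "gdom gEta' = []"
| "gdom gEps' = [\<E>, \<F>]"

fun gcod :: "gen \<Rightarrow> letter list" where
  "gcod gXi = [\<E>]"
| "gcod gXi' = [\<F>]"
| "gcod gTau = [\<E>, \<E>]"
| "gcod gTau' = [\<F>, \<F>]"
| "gcod gEta = [\<F>, \<E>]"
| "gcod gEps = []"
| "gcod gEta' = [\<E>, \<F>]"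
| "gcod gEps' = []"

fun gdeg :: "gen \<Rightarrow> int \<Rightarrow> int" where
  "gdeg gXi l = 2"
| "gdeg gXi' l = 2"
| "gdeg gTau l = -2"
| "gdeg gTau' l = -2"
| "gdeg gEta l = 1 + l"
| "gdeg gEps l = 1 + l"
| "gdeg gEta' l = 1 - l"
| "gdeg gEps' l = 1 - l"

text \<open>
  The \<open>2\<close>-category is presented by generators and relations.  All \<open>2\<close>-morphism spaces are collected
  in one vector space, their direct sum over all pairs of words and all weights; on it both
  compositions are everywhere defined and are \<open>0\<close> where the sources and targets do not match.  The
  individual spaces are recovered by cutting with the identity \<open>2\<close>-morphisms (\<open>HOM\<close> below).
  \<open>Ident w l\<close> is the identity \<open>2\<close>-morphism of \<open>w 1\<^sub>l\<close>, and the weight in \<open>Gen g l\<close> is the subscript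
  of the generator, i.e. the rightmost weight.
\<close>

datatype 'k diag =
    Zero
  | Add "'k diag" "'k diag"
  | Scale 'k "'k diag"
  | Ident "letter list" int
  | Gen gen int
  | Vert "'k diag" "'k diag"
  | Horiz "'k diag" "'k diag"  (infixr "\<star>" 75)

instantiation diag :: (field) "{zero, plus, uminus, minus, times}"
begin
definition zero_diag :: "'a diag" where "0 = Zero"
definition plus_diag :: "'a diag \<Rightarrow> 'a diag \<Rightarrow> 'a diag" where "f + g = Add f g"
definition uminus_diag :: "'a diag \<Rightarrow> 'a diag" where "- f = Scale (-1) f"
definition minus_diag :: "'a diag \<Rightarrow> 'a diag \<Rightarrow> 'a diag" where "f - g = Add f (Scale (-1) g)"
definition times_diag :: "'a diag \<Rightarrow> 'a diag \<Rightarrow> 'a diag" where "f * g = Vert f g"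
instance ..
end

abbreviation \<xi> :: "int \<Rightarrow> 'k diag" where "\<xi> l \<equiv> Gen gXi l"
abbreviation \<xi>' :: "int \<Rightarrow> 'k diag" where "\<xi>' l \<equiv> Gen gXi' l"
abbreviation \<tau> :: "int \<Rightarrow> 'k diag" where "\<tau> l \<equiv> Gen gTau l"
abbreviation \<tau>' :: "int \<Rightarrow> 'k diag" where "\<tau>' l \<equiv> Gen gTau' l"
abbreviation \<eta> :: "int \<Rightarrow> 'k diag" where "\<eta> l \<equiv> Gen gEta l"
abbreviation \<epsilon> :: "int \<Rightarrow> 'k diag" where "\<epsilon> l \<equiv> Gen gEps l"
abbreviation \<eta>' :: "int \<Rightarrow> 'k diag" where "\<eta>' l \<equiv> Gen gEta' l"
abbreviation \<epsilon>' :: "int \<Rightarrow> 'k diag" where "\<epsilon>' l \<equiv> Gen gEps' l"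

definition dsum :: "('a \<Rightarrow> 'k::field diag) \<Rightarrow> 'a list \<Rightarrow> 'k diag" where
  "dsum f as = foldr (\<lambda>a s. f a + s) as 0"

lemma dsum_cong [fundef_cong]:
  assumes "as = bs" "\<And>a. a \<in> set bs \<Longrightarrow> f a = g a"
  shows "dsum f as = dsum g bs"
  unfolding dsum_def by (rule foldr_cong) (simp_all add: assms)

text \<open>Sums over \<open>a + b = n\<close>, resp. \<open>a + b + c = n\<close>, with \<open>a, b, c \<ge> 0\<close>; empty for \<open>n < 0\<close>.\<close>

definition dsum2 :: "int \<Rightarrow> (nat \<Rightarrow> nat \<Rightarrow> 'k::field diag) \<Rightarrow> 'k diag" where
  "dsum2 n f = dsum (\<lambda>a. f (nat a) (nat (n - a))) [0..n]"

definition dsum3 :: "int \<Rightarrow> (nat \<Rightarrow> nat \<Rightarrow> nat \<Rightarrow> 'k::field diag) \<Rightarrow> 'k diag" where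
  "dsum3 n f = dsum2 n (\<lambda>a d. dsum2 (int d) (\<lambda>b c. f a b c))"

text \<open>\<open>\<xi>pow l n\<close> is \<open>\<xi>\<^sup>n\<close> on \<open>\<E>1\<^sub>l\<close>.\<close>

primrec \<xi>pow :: "int \<Rightarrow> nat \<Rightarrow> 'k::field diag" where
  "\<xi>pow l 0 = Ident [\<E>] l"
| "\<xi>pow l (Suc n) = \<xi> l * \<xi>pow l n"

definition real_bub_plus :: "int \<Rightarrow> int \<Rightarrow> 'k::field diag" where
  "real_bub_plus k l = \<epsilon>' l * (\<xi>pow (l - 2) (nat (k + l - 1)) \<star> Ident [\<F>] l) * \<eta>' l"

definition real_bub_minus :: "int \<Rightarrow> int \<Rightarrow> 'k::field diag" where
  "real_bub_minus k l = \<epsilon> l * (Ident [\<F>] (l + 2) \<star> \<xi>pow l (nat (k - l - 1))) * \<eta> l"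

text \<open>
  Fake bubbles, obtained by solving \<open>\<Sum>\<^bsub>a+b=m\<^esub> b\<^sup>+\<^sub>a b\<^sup>-\<^sub>b = 0\<close> for the term with the highest fake index.
  They are used only for \<open>m < 1 - l\<close> resp. \<open>m < 1 + l\<close>; then all the bubbles of opposite
  orientation and index \<open>\<ge> 1\<close> are real.
\<close>

fun fake_bub_plus :: "nat \<Rightarrow> int \<Rightarrow> 'k::field diag" where
  "fake_bub_plus m l =
     (if m = 0 then Ident [] l
      else - dsum (\<lambda>a. fake_bub_plus a l * real_bub_minus (int m - int a) l) [0..<m])"

fun fake_bub_minus :: "nat \<Rightarrow> int \<Rightarrow> 'k::field diag" where
  "fake_bub_minus m l =
     (if m = 0 then Ident [] l
      else - dsum (\<lambda>b. real_bub_plus (int m - int b) l * fake_bub_minus b l) [0..<m])"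

declare fake_bub_plus.simps [simp del] fake_bub_minus.simps [simp del]

definition bub_plus :: "int \<Rightarrow> int \<Rightarrow> 'k::field diag" where
  "bub_plus k l = (if k \<ge> 1 - l then real_bub_plus k l
                   else if k < 0 then 0 else fake_bub_plus (nat k) l)"

definition bub_minus :: "int \<Rightarrow> int \<Rightarrow> 'k::field diag" where
  "bub_minus k l = (if k \<ge> 1 + l then real_bub_minus k l
                    else if k < 0 then 0 else fake_bub_minus (nat k) l)"

definition \<sigma> :: "int \<Rightarrow> 'k::field diag" where
  "\<sigma> l = (Ident [\<F>, \<E>] l \<star> \<epsilon>' l)
         * (Ident [\<F>] (l + 2) \<star> \<tau> (l - 2) \<star> Ident [\<F>] l)
         * (\<eta> l \<star> Ident [\<E>, \<F>] l)"

definition \<sigma>' :: "int \<Rightarrow> 'k::field diag" where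
  "\<sigma>' l = (\<epsilon> l \<star> Ident [\<E>, \<F>] l)
         * (Ident [\<F>] (l + 2) \<star> \<tau> (l - 2) \<star> Ident [\<F>] l)
         * (Ident [\<F>, \<E>] l \<star> \<eta>' l)"

definition \<epsilon>'\<^sub>2 :: "int \<Rightarrow> 'k::field diag" where
  "\<epsilon>'\<^sub>2 l = \<epsilon>' l * (Ident [\<E>] (l - 2) \<star> \<epsilon>' (l - 2) \<star> Ident [\<F>] l)"

definition \<epsilon>\<^sub>2 :: "int \<Rightarrow> 'k::field diag" where
  "\<epsilon>\<^sub>2 l = \<epsilon> l * (Ident [\<F>] (l + 2) \<star> \<epsilon> (l + 2) \<star> Ident [\<E>] l)"

text \<open>Vector space structure, and bilinearity of both compositions.\<close>

inductive linear_rel :: "'k::field diag \<Rightarrow> 'k diag \<Rightarrow> bool"  (infix "\<approx>\<^sub>l" 50) where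
  add_assoc: "(f + g) + h \<approx>\<^sub>l f + (g + h)"
| add_comm: "f + g \<approx>\<^sub>l g + f"
| add_zero: "0 + f \<approx>\<^sub>l f"
| add_neg: "- f + f \<approx>\<^sub>l 0"
| scale_add: "Scale c (f + g) \<approx>\<^sub>l Scale c f + Scale c g"
| add_scale: "Scale (c + d) f \<approx>\<^sub>l Scale c f + Scale d f"
| scale_scale: "Scale c (Scale d f) \<approx>\<^sub>l Scale (c * d) f"
| scale_one: "Scale 1 f \<approx>\<^sub>l f"
| vert_add_left: "(f + g) * h \<approx>\<^sub>l f * h + g * h"
| vert_add_right: "f * (g + h) \<approx>\<^sub>l f * g + f * h"
| vert_scale_left: "Scale c f * g \<approx>\<^sub>l Scale c (f * g)"
| vert_scale_right: "f * Scale c g \<approx>\<^sub>l Scale c (f * g)"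
| horiz_add_left: "(f + g) \<star> h \<approx>\<^sub>l f \<star> h + g \<star> h"
| horiz_add_right: "f \<star> (g + h) \<approx>\<^sub>l f \<star> g + f \<star> h"
| horiz_scale_left: "Scale c f \<star> g \<approx>\<^sub>l Scale c (f \<star> g)"
| horiz_scale_right: "f \<star> Scale c g \<approx>\<^sub>l Scale c (f \<star> g)"

text \<open>
  Axioms of a strict \<open>2\<close>-category; \<open>f * Ident w l\<close> is the part of \<open>f\<close> with domain \<open>w 1\<^sub>l\<close>.  The
  interchange law holds only if \<open>f, f'\<close> and \<open>g, g'\<close> meet in fixed \<open>1\<close>-morphisms: words
  that differ may have equal concatenations.
\<close>

inductive cat_rel :: "'k::field diag \<Rightarrow> 'k diag \<Rightarrow> bool"  (infix "\<approx>\<^sub>c" 50) where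
  vert_assoc: "(f * g) * h \<approx>\<^sub>c f * (g * h)"
| vert_ident: "Ident w m * Ident v l \<approx>\<^sub>c (if w = v \<and> m = l then Ident w m else 0)"
| gen_dom: "Gen g l * Ident (gdom g) l \<approx>\<^sub>c Gen g l"
| gen_cod: "Ident (gcod g) l * Gen g l \<approx>\<^sub>c Gen g l"
| horiz_assoc: "(f \<star> g) \<star> h \<approx>\<^sub>c f \<star> (g \<star> h)"
| horiz_ident: "Ident w m \<star> Ident v l \<approx>\<^sub>c (if m = tgt v l then Ident (w @ v) l else 0)"
| horiz_unit_left: "Ident [] (tgt w l) \<star> (f * Ident w l) \<approx>\<^sub>c f * Ident w l"
| horiz_unit_right: "(f * Ident w l) \<star> Ident [] l \<approx>\<^sub>c f * Ident w l"
| interchange: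
    "((f * Ident w m) * (Ident w m * f')) \<star> ((g * Ident v l) * (Ident v l * g'))
     \<approx>\<^sub>c ((f * Ident w m) \<star> (g * Ident v l)) * ((Ident w m * f') \<star> (Ident v l * g'))"

text \<open>Biadjunction and cyclicity.\<close>

inductive adj_rel :: "'k::field diag \<Rightarrow> 'k diag \<Rightarrow> bool"  (infix "\<approx>\<^sub>a" 50) where
  zigzag_E1: "(\<epsilon>' (l + 2) \<star> Ident [\<E>] l) * (Ident [\<E>] l \<star> \<eta> l) \<approx>\<^sub>a Ident [\<E>] l"
| zigzag_E2: "(Ident [\<E>] l \<star> \<epsilon> l) * (\<eta>' (l + 2) \<star> Ident [\<E>] l) \<approx>\<^sub>a Ident [\<E>] l"
| zigzag_F1: "(\<epsilon> (l - 2) \<star> Ident [\<F>] l) * (Ident [\<F>] l \<star> \<eta>' l) \<approx>\<^sub>a Ident [\<F>] l"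
| zigzag_F2: "(Ident [\<F>] l \<star> \<epsilon>' l) * (\<eta> (l - 2) \<star> Ident [\<F>] l) \<approx>\<^sub>a Ident [\<F>] l"
| cyc_dot1: "\<epsilon>' l * (\<xi> (l - 2) \<star> Ident [\<F>] l) \<approx>\<^sub>a \<epsilon>' l * (Ident [\<E>] (l - 2) \<star> \<xi>' l)"
| cyc_dot2: "\<epsilon> l * (\<xi>' (l + 2) \<star> Ident [\<E>] l) \<approx>\<^sub>a \<epsilon> l * (Ident [\<F>] (l + 2) \<star> \<xi> l)"
| cyc_cross1: "\<epsilon>'\<^sub>2 l * (\<tau> (l - 4) \<star> Ident [\<F>, \<F>] l) \<approx>\<^sub>a \<epsilon>'\<^sub>2 l * (Ident [\<E>, \<E>] (l - 4) \<star> \<tau>' l)"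
| cyc_cross2: "\<epsilon>\<^sub>2 l * (\<tau>' (l + 4) \<star> Ident [\<E>, \<E>] l) \<approx>\<^sub>a \<epsilon>\<^sub>2 l * (Ident [\<F>, \<F>] (l + 4) \<star> \<tau> l)"

text \<open>Bubbles.\<close>

inductive bub_rel :: "'k::field diag \<Rightarrow> 'k diag \<Rightarrow> bool"  (infix "\<approx>\<^sub>b" 50) where
  bub_plus_neg: "k < 0 \<Longrightarrow> bub_plus k l \<approx>\<^sub>b 0"
| bub_minus_neg: "k < 0 \<Longrightarrow> bub_minus k l \<approx>\<^sub>b 0"
| bub_plus_0: "bub_plus 0 l \<approx>\<^sub>b Ident [] l"
| bub_minus_0: "bub_minus 0 l \<approx>\<^sub>b Ident [] l"
| inf_grass: "dsum2 m (\<lambda>a b. bub_plus (int a) l * bub_minus (int b) l)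
              \<approx>\<^sub>b (if m = 0 then Ident [] l else 0)"

text \<open>NilHecke relations.\<close>

inductive nil_rel :: "'k::field diag \<Rightarrow> 'k diag \<Rightarrow> bool"  (infix "\<approx>\<^sub>n" 50) where
  tau_sq: "\<tau> l * \<tau> l \<approx>\<^sub>n 0"
| braid: "(\<tau> (l + 2) \<star> Ident [\<E>] l) * (Ident [\<E>] (l + 4) \<star> \<tau> l) * (\<tau> (l + 2) \<star> Ident [\<E>] l)
          \<approx>\<^sub>n (Ident [\<E>] (l + 4) \<star> \<tau> l) * (\<tau> (l + 2) \<star> Ident [\<E>] l) * (Ident [\<E>] (l + 4) \<star> \<tau> l)"
| dot_cross1: "\<tau> l * (\<xi> (l + 2) \<star> Ident [\<E>] l) - (Ident [\<E>] (l + 2) \<star> \<xi> l) * \<tau> l \<approx>\<^sub>n Ident [\<E>, \<E>] l"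
| dot_cross2: "(\<xi> (l + 2) \<star> Ident [\<E>] l) * \<tau> l - \<tau> l * (Ident [\<E>] (l + 2) \<star> \<xi> l) \<approx>\<^sub>n Ident [\<E>, \<E>] l"

text \<open>Curls and decompositions of \<open>\<E>\<F>1\<^sub>l\<close> and \<open>\<F>\<E>1\<^sub>l\<close>.\<close>

inductive dec_rel :: "'k::field diag \<Rightarrow> 'k diag \<Rightarrow> bool"  (infix "\<approx>\<^sub>d" 50) where
  curl_right: "(Ident [\<E>] l \<star> \<epsilon>' l) * (\<tau> (l - 2) \<star> Ident [\<F>] l) * (Ident [\<E>] l \<star> \<eta>' l)
               \<approx>\<^sub>d - dsum2 (- l) (\<lambda>a b. \<xi>pow l b \<star> bub_plus (int a) l)"
| curl_left: "(\<epsilon> l \<star> Ident [\<E>] (l - 2)) * (Ident [\<F>] (l + 2) \<star> \<tau> (l - 2)) * (\<eta> l \<star> Ident [\<E>] (l - 2))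
              \<approx>\<^sub>d dsum2 l (\<lambda>a b. bub_minus (int a) l \<star> \<xi>pow (l - 2) b)"
| decomp_EF: "Ident [\<E>, \<F>] l
    \<approx>\<^sub>d - (\<sigma>' l * \<sigma> l)
      + dsum3 (l - 1) (\<lambda>a b c. (\<xi>pow (l - 2) c \<star> Ident [\<F>] l) * \<eta>' l * bub_minus (int b) l
                               * \<epsilon>' l * (\<xi>pow (l - 2) a \<star> Ident [\<F>] l))"
| decomp_FE: "Ident [\<F>, \<E>] l
    \<approx>\<^sub>d - (\<sigma> l * \<sigma>' l)
      + dsum3 (- l - 1) (\<lambda>a b c. (Ident [\<F>] (l + 2) \<star> \<xi>pow l c) * \<eta> l * bub_plus (int b) l
                                 * \<epsilon> l * (Ident [\<F>] (l + 2) \<star> \<xi>pow l a))"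

text \<open>The congruence generated by these relations.\<close>

inductive eqU :: "'k::field diag \<Rightarrow> 'k diag \<Rightarrow> bool"  (infix "\<approx>" 50) where
  linear_rel: "f \<approx>\<^sub>l g \<Longrightarrow> f \<approx> g"
| cat_rel: "f \<approx>\<^sub>c g \<Longrightarrow> f \<approx> g"
| adj_rel: "f \<approx>\<^sub>a g \<Longrightarrow> f \<approx> g"
| bub_rel: "f \<approx>\<^sub>b g \<Longrightarrow> f \<approx> g"
| nil_rel: "f \<approx>\<^sub>n g \<Longrightarrow> f \<approx> g"
| dec_rel: "f \<approx>\<^sub>d g \<Longrightarrow> f \<approx> g"
| refl: "f \<approx> f"
| sym: "f \<approx> g \<Longrightarrow> g \<approx> f"
| trans: "f \<approx> g \<Longrightarrow> g \<approx> h \<Longrightarrow> f \<approx> h"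
| add_cong: "f \<approx> f' \<Longrightarrow> g \<approx> g' \<Longrightarrow> f + g \<approx> f' + g'"
| scale_cong: "f \<approx> f' \<Longrightarrow> Scale c f \<approx> Scale c f'"
| vert_cong: "f \<approx> f' \<Longrightarrow> g \<approx> g' \<Longrightarrow> f * g \<approx> f' * g'"
| horiz_cong: "f \<approx> f' \<Longrightarrow> g \<approx> g' \<Longrightarrow> f \<star> g \<approx> f' \<star> g'"

quotient_type (overloaded) 'k mor = "'k::field diag" / eqU
  morphisms rep_mor cls
proof (rule equivpI)
  show "reflp (eqU :: 'k diag \<Rightarrow> _)" by (rule reflpI) (rule eqU.refl)
  show "symp (eqU :: 'k diag \<Rightarrow> _)" by (rule sympI) (rule eqU.sym)
  show "transp (eqU :: 'k diag \<Rightarrow> _)" by (rule transpI) (rule eqU.trans)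
qed

text \<open>\<open>cls f\<close> is the \<open>2\<close>-morphism of \<open>\<U>\<close> represented by the formal expression \<open>f\<close>.
  Multiplication on \<open>'k mor\<close> is vertical composition.\<close>

instantiation mor :: (field) ring
begin
lift_definition zero_mor :: "'a mor" is "0 :: 'a diag" .
lift_definition plus_mor :: "'a mor \<Rightarrow> 'a mor \<Rightarrow> 'a mor" is "(+)" by (rule eqU.add_cong)
lift_definition uminus_mor :: "'a mor \<Rightarrow> 'a mor" is "uminus"
  unfolding uminus_diag_def by (rule eqU.scale_cong)
lift_definition minus_mor :: "'a mor \<Rightarrow> 'a mor \<Rightarrow> 'a mor" is "(-)"
  unfolding minus_diag_def plus_diag_def [symmetric] by (intro eqU.add_cong eqU.scale_cong)
lift_definition times_mor :: "'a mor \<Rightarrow> 'a mor \<Rightarrow> 'a mor" is "(*)" by (rule eqU.vert_cong)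
instance
proof
  fix a b c :: "'a mor"
  show "a + b + c = a + (b + c)" by transfer (intro eqU.linear_rel linear_rel.add_assoc)
  show "a + b = b + a" by transfer (intro eqU.linear_rel linear_rel.add_comm)
  show "0 + a = a" by transfer (intro eqU.linear_rel linear_rel.add_zero)
  show "- a + a = 0" by transfer (intro eqU.linear_rel linear_rel.add_neg)
  show "a - b = a + - b"
    by transfer (simp add: minus_diag_def uminus_diag_def plus_diag_def eqU.refl)
  show "a * b * c = a * (b * c)" by transfer (intro eqU.cat_rel cat_rel.vert_assoc)
  show "(a + b) * c = a * c + b * c" by transfer (intro eqU.linear_rel linear_rel.vert_add_left)
  show "a * (b + c) = a * b + a * c" by transfer (intro eqU.linear_rel linear_rel.vert_add_right)
qed
end

lift_definition scale :: "'k::field \<Rightarrow> 'k mor \<Rightarrow> 'k mor" is Scale by (rule eqU.scale_cong)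
lift_definition hcomp :: "'k::field mor \<Rightarrow> 'k mor \<Rightarrow> 'k mor" is Horiz by (rule eqU.horiz_cong)

text \<open>The \<open>2\<close>-morphisms \<open>v 1\<^sub>l \<rightarrow> w 1\<^sub>l\<close>, of arbitrary degree.\<close>

definition HOM :: "letter list \<Rightarrow> letter list \<Rightarrow> int \<Rightarrow> 'k::field mor set" where
  "HOM v w l = {f. cls (Ident w l) * f = f \<and> f * cls (Ident v l) = f}"

inductive has_degree :: "'k::field diag \<Rightarrow> int \<Rightarrow> bool" where
  "has_degree 0 n"
| "has_degree f n \<Longrightarrow> has_degree g n \<Longrightarrow> has_degree (f + g) n"
| "has_degree f n \<Longrightarrow> has_degree (Scale c f) n"
| "has_degree (Ident w l) 0"
| "has_degree (Gen g l) (gdeg g l)"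
| "has_degree f m \<Longrightarrow> has_degree g n \<Longrightarrow> has_degree (f * g) (m + n)"
| "has_degree f m \<Longrightarrow> has_degree g n \<Longrightarrow> has_degree (f \<star> g) (m + n)"

definition DEG :: "int \<Rightarrow> 'k::field mor set" where
  "DEG n = {cls f |f. has_degree f n}"


section \<open>The family of \<open>p\<close>-differentials\<close>

text \<open>\<open>pxb\<close>, \<open>pyb\<close>, \<open>pab\<close> are the barred parameters.\<close>

record 'k params =
  px :: "int \<Rightarrow> 'k"
  pxb :: "int \<Rightarrow> 'k"
  py :: "int \<Rightarrow> 'k"
  pyb :: "int \<Rightarrow> 'k"
  pa :: "int \<Rightarrow> 'k"
  pab :: "int \<Rightarrow> 'k"

text \<open>In characteristic \<open>p > 0\<close> the set \<open>\<int>\<close>, the image of the integers in the field, is the prime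
  field.\<close>

definition admissible :: "'k::field params \<Rightarrow> bool" where
  "admissible P \<longleftrightarrow>
     (\<forall>l. {px P l, pxb P l, py P l, pyb P l, pa P l, pab P l} \<subseteq> \<int>) \<and>
     (\<forall>l. pa P l - pab P l = px P (l + 2) - px P l - 2 * py P l) \<and>
     (\<forall>l. px P l + pxb P l = - of_int l) \<and>
     (\<forall>l. py P l + pyb P l = -1)"

definition p_differential :: "nat \<Rightarrow> 'k::field params \<Rightarrow> ('k mor \<Rightarrow> 'k mor) \<Rightarrow> bool" where
  "p_differential p P D \<longleftrightarrow>
     (\<forall>f g. D (f + g) = D f + D g) \<and>
     (\<forall>c f. D (scale c f) = scale c (D f)) \<and>
     (\<forall>v w l. D ` HOM v w l \<subseteq> HOM v w l) \<and>
     (\<forall>n. D ` DEG n \<subseteq> DEG (n + 2)) \<and>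
     (\<forall>f. (D ^^ p) f = 0) \<and>
     (\<forall>f g. D (f * g) = D f * g + f * D g) \<and>
     (\<forall>f g. D (hcomp f g) = hcomp (D f) g + hcomp f (D g)) \<and>
     (\<forall>l. D (cls (\<xi> l)) = cls (\<xi> l * \<xi> l)) \<and>
     (\<forall>l. D (cls (\<xi>' l)) = cls (\<xi>' l * \<xi>' l)) \<and>
     (\<forall>l. D (cls (\<tau> l)) =
        cls (Scale (pa P l) (Ident [\<E>, \<E>] l)
             - Scale (1 + pa P l) ((\<xi> (l + 2) \<star> Ident [\<E>] l) * \<tau> l)
             + Scale (pa P l - 1) ((Ident [\<E>] (l + 2) \<star> \<xi> l) * \<tau> l))) \<and>
     (\<forall>l. D (cls (\<tau>' (l + 4))) =
        cls (Scale (pab P l) (Ident [\<F>, \<F>] (l + 4))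
             - Scale (1 + pab P l) (\<tau>' (l + 4) * (Ident [\<F>] (l + 2) \<star> \<xi>' (l + 4)))
             + Scale (pab P l - 1) (\<tau>' (l + 4) * (\<xi>' (l + 2) \<star> Ident [\<F>] (l + 4))))) \<and>
     (\<forall>l. D (cls (\<epsilon>' l)) =
        cls (Scale (px P (l - 2)) (\<epsilon>' l * (\<xi> (l - 2) \<star> Ident [\<F>] l))
             + Scale (py P (l - 2)) (bub_plus 1 l * \<epsilon>' l))) \<and>
     (\<forall>l. D (cls (\<eta>' l)) =
        cls (Scale (pxb P (l - 2)) ((\<xi> (l - 2) \<star> Ident [\<F>] l) * \<eta>' l)
             + Scale (pyb P (l - 2)) (\<eta>' l * bub_plus 1 l))) \<and>
     (\<forall>l. D (cls (\<epsilon> l)) =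
        cls (- Scale (pxb P l + 2 * pyb P l) (\<epsilon> l * (Ident [\<F>] (l + 2) \<star> \<xi> l))
             - Scale (pyb P l) (bub_plus 1 l * \<epsilon> l))) \<and>
     (\<forall>l. D (cls (\<eta> l)) =
        cls (- Scale (px P l + 2 * py P l) ((Ident [\<F>] (l + 2) \<star> \<xi> l) * \<eta> l)
             - Scale (py P l) (\<eta> l * bub_plus 1 l)))"

text \<open>The parameters of \<open>\<partial>\<^sub>-\<^sub>1\<close>.\<close>

definition params_minus1 :: "'k::field params" where
  "params_minus1 = \<lparr> px = (\<lambda>m. -1 - of_int m), pxb = (\<lambda>m. 1), py = (\<lambda>m. 0), pyb = (\<lambda>m. -1),
                     pa = (\<lambda>m. -1), pab = (\<lambda>m. 1) \<rparr>"


section \<open>Fantastic filtrations\<close>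

text \<open>
  Here \<open>d\<close> is the differential of the \<open>p\<close>-DG algebra \<open>R\<close>, and \<open>e\<close> is the idempotent such that the
  filtration is one of \<open>R e\<close>.
\<close>

definition F_less ::
    "('r, 'm) ring_scheme \<Rightarrow> 'i set \<Rightarrow> ('i \<Rightarrow> 'r) \<Rightarrow> ('i \<Rightarrow> 'r) \<Rightarrow> 'i rel \<Rightarrow> 'i \<Rightarrow> 'r set" where
  "F_less R I u v ord i =
     {(\<Oplus>\<^bsub>R\<^esub>k \<in> {k \<in> I. (k, i) \<in> ord \<and> k \<noteq> i}. s k \<otimes>\<^bsub>R\<^esub> (u k \<otimes>\<^bsub>R\<^esub> v k)) |s. s \<in> I \<rightarrow> carrier R}"

definition fc_filtration ::
    "('r, 'm) ring_scheme \<Rightarrow> ('r \<Rightarrow> 'r) \<Rightarrow> 'i set \<Rightarrow> ('i \<Rightarrow> 'r) \<Rightarrow> ('i \<Rightarrow> 'r) \<Rightarrow> 'r \<Rightarrow> bool" where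
  "fc_filtration R d I u v e \<longleftrightarrow>
     finite I \<and> u \<in> I \<rightarrow> carrier R \<and> v \<in> I \<rightarrow> carrier R \<and>
     (\<forall>i\<in>I. u i \<otimes>\<^bsub>R\<^esub> v i \<otimes>\<^bsub>R\<^esub> u i = u i) \<and>
     (\<forall>i\<in>I. v i \<otimes>\<^bsub>R\<^esub> u i \<otimes>\<^bsub>R\<^esub> v i = v i) \<and>
     (\<forall>i\<in>I. \<forall>j\<in>I. i \<noteq> j \<longrightarrow> v i \<otimes>\<^bsub>R\<^esub> u j = \<zero>\<^bsub>R\<^esub>) \<and>
     e = (\<Oplus>\<^bsub>R\<^esub>i\<in>I. u i \<otimes>\<^bsub>R\<^esub> v i) \<and>
     d e = \<zero>\<^bsub>R\<^esub> \<and>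
     (\<forall>i\<in>I. d (v i \<otimes>\<^bsub>R\<^esub> u i) = \<zero>\<^bsub>R\<^esub>) \<and>
     (\<exists>ord. linear_order_on I ord \<and>
        (\<forall>i\<in>I. v i \<otimes>\<^bsub>R\<^esub> d (u i) = \<zero>\<^bsub>R\<^esub> \<and> u i \<otimes>\<^bsub>R\<^esub> d (v i) \<in> F_less R I u v ord i))"

text \<open>
  The endomorphism algebra of \<open>\<Oplus>\<^bsub>j\<in>J\<^esub> X j 1\<^sub>l\<close>: matrices indexed by \<open>J\<close> whose \<open>(j, k)\<close> entry is a
  \<open>2\<close>-morphism \<open>X k 1\<^sub>l \<rightarrow> X j 1\<^sub>l\<close>, with value \<open>0\<close> at indices outside \<open>J\<close>.
\<close>

definition End_ring ::
    "'j set \<Rightarrow> ('j \<Rightarrow> letter list) \<Rightarrow> int \<Rightarrow> ('j \<Rightarrow> 'j \<Rightarrow> 'k::field mor) ring" where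
  "End_ring J X l =
     \<lparr> carrier = {r. \<forall>j k. (j \<in> J \<and> k \<in> J \<longrightarrow> r j k \<in> HOM (X k) (X j) l) \<and>
                           (\<not> (j \<in> J \<and> k \<in> J) \<longrightarrow> r j k = 0)},
       mult = (\<lambda>r s j k. \<Sum>i\<in>J. r j i * s i k),
       one = (\<lambda>j k. if j = k \<and> j \<in> J then cls (Ident (X j) l) else 0),
       zero = (\<lambda>j k. 0),
       add = (\<lambda>r s j k. r j k + s j k) \<rparr>"

lemma HOM_zero: "0 \<in> HOM v w l"
  by (simp add: HOM_def)

lemma HOM_add: "f \<in> HOM v w l \<Longrightarrow> g \<in> HOM v w l \<Longrightarrow> f + g \<in> HOM v w l"
  by (simp add: HOM_def distrib_left distrib_right)

lemma HOM_uminus: "f \<in> HOM v w l \<Longrightarrow> - f \<in> HOM v w l"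
  by (simp add: HOM_def)

lemma HOM_mult: "f \<in> HOM v w l \<Longrightarrow> g \<in> HOM u v l \<Longrightarrow> f * g \<in> HOM u w l"
  unfolding HOM_def mem_Collect_eq by (metis mult.assoc)

lemma HOM_sum: "(\<And>i. i \<in> A \<Longrightarrow> f i \<in> HOM v w l) \<Longrightarrow> sum f A \<in> HOM v w l"
  by (induction A rule: infinite_finite_induct) (auto intro: HOM_zero HOM_add)

lemma HOM_ident: "cls (Ident w l) \<in> HOM w w l"
  using eqU.cat_rel [OF cat_rel.vert_ident [of w l w l]]
  by (simp add: HOM_def times_mor.abs_eq mor.abs_eq_iff)

lemma ring_End_ring:
  fixes J :: "'j set"
  assumes "finite J"
  shows "ring (End_ring J X l :: ('j \<Rightarrow> 'j \<Rightarrow> 'k::field mor) ring)" (is "ring ?R")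
proof (rule ringI)
  show "abelian_group ?R"
  proof (rule abelian_groupI)
    fix r :: "'j \<Rightarrow> 'j \<Rightarrow> 'k mor" assume "r \<in> carrier ?R"
    then show "\<exists>s \<in> carrier ?R. s \<oplus>\<^bsub>?R\<^esub> r = \<zero>\<^bsub>?R\<^esub>"
      by (intro bexI [of _ "\<lambda>j k. - r j k"]) (auto simp: End_ring_def intro: HOM_uminus)
  qed (auto simp: End_ring_def intro: HOM_zero HOM_add simp: algebra_simps)
  show "Group.monoid ?R"
  proof (rule monoidI)
    fix r s :: "'j \<Rightarrow> 'j \<Rightarrow> 'k mor"
    assume rs: "r \<in> carrier ?R" "s \<in> carrier ?R"
    have "r j i * s i k \<in> HOM (X k) (X j) l" if "i \<in> J" "j \<in> J" "k \<in> J" for i j k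
      using rs that by (intro HOM_mult [where v = "X i"]) (simp_all add: End_ring_def)
    moreover have "r j i * s i k = 0" if "j \<notin> J \<or> k \<notin> J" for i j k
      using rs that by (auto simp: End_ring_def)
    ultimately show "r \<otimes>\<^bsub>?R\<^esub> s \<in> carrier ?R"
      by (auto simp: End_ring_def intro!: HOM_sum sum.neutral)
  next
    show "\<one>\<^bsub>?R\<^esub> \<in> carrier ?R"
      by (auto simp: End_ring_def intro: HOM_ident HOM_zero)
  next
    fix r s t :: "'j \<Rightarrow> 'j \<Rightarrow> 'k mor"
    have "(\<Sum>i\<in>J. (\<Sum>h\<in>J. r j h * s h i) * t i k) = (\<Sum>i\<in>J. r j i * (\<Sum>h\<in>J. s i h * t h k))" for j k
      by (simp add: sum_distrib_left sum_distrib_right mult.assoc) (rule sum.swap)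
    then show "r \<otimes>\<^bsub>?R\<^esub> s \<otimes>\<^bsub>?R\<^esub> t
        = r \<otimes>\<^bsub>?R\<^esub> (s \<otimes>\<^bsub>?R\<^esub> t)"
      by (simp add: End_ring_def)
  next
    fix r :: "'j \<Rightarrow> 'j \<Rightarrow> 'k mor"
    assume r: "r \<in> carrier ?R"
    have "(\<Sum>i\<in>J. (if j = i \<and> j \<in> J then cls (Ident (X j) l) else 0) * r i k) = r j k" for j k
    proof (cases "j \<in> J")
      case True
      have "(\<Sum>i\<in>J. (if j = i \<and> j \<in> J then cls (Ident (X j) l) else 0) * r i k)
          = (\<Sum>i\<in>J. if j = i then cls (Ident (X j) l) * r i k else 0)"
        using True by (intro sum.cong) auto
      also have "\<dots> = r j k"
        using assms True r by (cases "k \<in> J") (auto simp: End_ring_def HOM_def)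
      finally show ?thesis .
    qed (use r in \<open>auto simp: End_ring_def\<close>)
    then show "\<one>\<^bsub>?R\<^esub> \<otimes>\<^bsub>?R\<^esub> r = r"
      by (simp add: End_ring_def)
    have "(\<Sum>i\<in>J. r j i * (if i = k \<and> i \<in> J then cls (Ident (X i) l) else 0)) = r j k" for j k
    proof (cases "k \<in> J")
      case True
      have "(\<Sum>i\<in>J. r j i * (if i = k \<and> i \<in> J then cls (Ident (X i) l) else 0))
          = (\<Sum>i\<in>J. if i = k then r j i * cls (Ident (X i) l) else 0)"
        using True by (intro sum.cong) auto
      also have "\<dots> = r j k"
        using assms True r by (cases "j \<in> J") (auto simp: End_ring_def HOM_def)
      finally show ?thesis .
    next
      case False
      then have "(\<Sum>i\<in>J. r j i * (if i = k \<and> i \<in> J then cls (Ident (X i) l) else 0)) = 0"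
        by (intro sum.neutral) auto
      then show ?thesis using False r by (auto simp: End_ring_def)
    qed
    then show "r \<otimes>\<^bsub>?R\<^esub> \<one>\<^bsub>?R\<^esub> = r"
      by (simp add: End_ring_def)
  qed
qed (auto simp: End_ring_def sum.distrib distrib_left distrib_right)

text \<open>A \<open>p\<close>-differential on \<open>\<U>\<close>, applied entrywise, is one on \<open>End_ring J X l\<close>.\<close>

lemma End_ring_differential:
  assumes D: "p_differential p P D" and "finite J"
    and r: "r \<in> carrier (End_ring J X l)" and s: "s \<in> carrier (End_ring J X l)"
  defines "d \<equiv> (\<lambda>r j k. D (r j k))"
  shows "d r \<in> carrier (End_ring J X l)"
    and "d (r \<oplus>\<^bsub>End_ring J X l\<^esub> s) = d r \<oplus>\<^bsub>End_ring J X l\<^esub> d s"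
    and "d (r \<otimes>\<^bsub>End_ring J X l\<^esub> s)
         = (d r \<otimes>\<^bsub>End_ring J X l\<^esub> s) \<oplus>\<^bsub>End_ring J X l\<^esub> (r \<otimes>\<^bsub>End_ring J X l\<^esub> d s)"
    and "(d ^^ p) r = \<zero>\<^bsub>End_ring J X l\<^esub>"
proof -
  have add: "D (f + g) = D f + D g" and mult: "D (f * g) = D f * g + f * D g"
    and nil: "(D ^^ p) f = 0" and hom: "f \<in> HOM v w l \<Longrightarrow> D f \<in> HOM v w l" for f g v w
    using D by (simp_all add: p_differential_def image_subset_iff)
  have zero: "D 0 = 0"
    using add [of 0 0] by simp
  have sum: "D (\<Sum>i\<in>A. f i) = (\<Sum>i\<in>A. D (f i))" for A :: "'c set" and f
    by (induction A rule: infinite_finite_induct) (simp_all add: zero add)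
  have pow: "(d ^^ n) r = (\<lambda>j k. (D ^^ n) (r j k))" for n
    by (induction n) (simp_all add: d_def)
  show "d r \<in> carrier (End_ring J X l)"
    using r by (auto simp: End_ring_def d_def zero intro: hom)
  show "d (r \<oplus>\<^bsub>End_ring J X l\<^esub> s) = d r \<oplus>\<^bsub>End_ring J X l\<^esub> d s"
    by (simp add: End_ring_def d_def add)
  show "d (r \<otimes>\<^bsub>End_ring J X l\<^esub> s)
      = (d r \<otimes>\<^bsub>End_ring J X l\<^esub> s) \<oplus>\<^bsub>End_ring J X l\<^esub> (r \<otimes>\<^bsub>End_ring J X l\<^esub> d s)"
    by (simp add: End_ring_def d_def sum mult sum.distrib)
  show "(d ^^ p) r = \<zero>\<^bsub>End_ring J X l\<^esub>"
    by (simp add: pow nil End_ring_def)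
qed

text \<open>
  The direct sum of \<open>\<E>\<F>1\<^sub>l\<close>, \<open>\<F>\<E>1\<^sub>l\<close> and \<open>l\<close> copies of \<open>1\<^sub>l\<close>.  Its grading shifts change the degrees
  of matrix entries, but neither the ring nor the differential, and so do not enter below.
\<close>

datatype summand = EFsum | FEsum | Onesum nat

definition summands :: "int \<Rightarrow> summand set" where
  "summands l = {EFsum, FEsum} \<union> Onesum ` {..<nat l}"

fun summand_word :: "summand \<Rightarrow> letter list" where
  "summand_word EFsum = [\<E>, \<F>]"
| "summand_word FEsum = [\<F>, \<E>]"
| "summand_word (Onesum c) = []"

definition entry :: "'j \<Rightarrow> 'j \<Rightarrow> 'k::field mor \<Rightarrow> 'j \<Rightarrow> 'j \<Rightarrow> 'k mor" where
  "entry j k f = (\<lambda>j' k'. if j' = j \<and> k' = k then f else 0)"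

text \<open>
  The data \<open>u'\<^sub>i\<close> (projections) and \<open>v'\<^sub>i\<close> (inclusions), \<open>0 \<le> i \<le> l\<close>, and the summand onto
  which \<open>u'\<^sub>i\<close> projects.
\<close>

definition proj :: "int \<Rightarrow> nat \<Rightarrow> 'k::field diag" where
  "proj l i = (if i < nat l then \<epsilon>' l * (\<xi>pow (l - 2) i \<star> Ident [\<F>] l) else \<sigma> l)"

definition incl :: "int \<Rightarrow> nat \<Rightarrow> 'k::field diag" where
  "incl l i =
     (if i < nat l
      then dsum2 (l - 1 - int i) (\<lambda>a b. (\<xi>pow (l - 2) a \<star> Ident [\<F>] l) * \<eta>' l * bub_minus (int b) l)
      else - \<sigma>' l)"

definition piece :: "int \<Rightarrow> nat \<Rightarrow> summand" where
  "piece l i = (if i < nat l then Onesum i else FEsum)"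

text \<open>The data yield a fantastic filtration on \<open>\<E>\<F>1\<^sub>l\<close> for the differential \<open>D\<close>.\<close>

definition yields_fc :: "('k::field mor \<Rightarrow> 'k mor) \<Rightarrow> int \<Rightarrow> bool" where
  "yields_fc D l \<longleftrightarrow>
     fc_filtration (End_ring (summands l) summand_word l) (\<lambda>r j k. D (r j k)) {0..nat l}
       (\<lambda>i. entry EFsum (piece l i) (cls (incl l i)))
       (\<lambda>i. entry (piece l i) EFsum (cls (proj l i)))
       (entry EFsum EFsum (cls (Ident [\<E>, \<F>] l)))"

end

theory Submission
  imports Defs "HOL-Computational_Algebra.Formal_Power_Series"
    "HOL-Computational_Algebra.Polynomial" "HOL-Computational_Algebra.Fraction_Field"
begin

text \<open>
  Since \<open>u'\<^sub>i v'\<^sub>i\<close> is an identity, \<open>u'\<^sub>i \<partial>(v'\<^sub>i) = - \<partial>(u'\<^sub>i) v'\<^sub>i\<close>, and the conditions on the filtration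
  only involve \<open>\<partial>(u'\<^sub>i)\<close>.  By the Leibniz rule \<open>\<partial>(u'\<^sub>c) = (x + c) u'\<^sub>c\<^sub>+\<^sub>1 + y b u'\<^sub>c\<close> with \<open>x = x\<^bsub>l-2\<^esub>\<close>, \<open>y = y\<^bsub>l-2\<^esub>\<close>
  and \<open>b = b\<^sup>+\<^sub>1\<close>, while \<open>\<partial>\<sigma>\<close> is a combination of \<open>\<sigma>\<close> with a dot on either strand, of \<open>\<sigma>\<close> with a bubble on
  either side, and of \<open>\<eta> \<epsilon>'\<close>.  For \<open>\<partial>\<^sub>-\<^sub>1\<close> this leaves \<open>\<partial>(u'\<^sub>c) = (c + 1 - l) u'\<^sub>c\<^sub>+\<^sub>1\<close> and \<open>\<partial>\<sigma> = l \<eta> u'\<^sub>0\<close>, so that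
  the order \<open>l - 1 < \<dots> < 0 < l\<close> on the indices works.

  Conversely, the vanishing of \<open>\<partial>(u'\<^sub>i) v'\<^sub>i\<close> for all \<open>i\<close> kills the coefficients of \<open>b\<close> and of the two dots and two
  bubbles on \<open>\<F>\<E>1\<^sub>l\<close>, provided that \<open>b\<close> is nonzero and that there are few enough linear relations between dots and
  bubbles.  This is seen in a model of \<open>\<U>\<close>: the equivariant cohomology of the Grassmannians of \<open>k\<close>-planes in
  \<open>N\<close>-space, localised at the torus fixed points.  For distinct elements \<open>t\<^sub>1, \<dots>, t\<^sub>N\<close> of a field, the weight
  \<open>2 k - N\<close> is represented by the functions on the \<open>k\<close>-element subsets of \<open>{t\<^sub>1, \<dots>, t\<^sub>N}\<close>, the \<open>1\<close>-morphisms \<open>\<E>\<close> and \<open>\<F>\<close>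
  add and remove an element, and a dot multiplies by that element; all relations become identities
  between rational functions of Lagrange interpolation type.
\<close>

section \<open>Lagrange interpolation sums\<close>

text \<open>Two kinds of argument are needed because the 2-category is only given by generators and
  relations. Equalities, such as the duality between \<open>proj l i\<close> and
  \<open>incl l j\<close>, can be derived inside the presentation. That a 2-morphism is nonzero
  cannot: it takes a representation of the whole presentation. Hence every relation is checked in
  \<open>interp_sound\<close>, although only a few matrix entries are inspected in the end. The
  model carries no differential. The derivatives are computed in the presentation, and what is
  transported to the model is a linear relation between fixed 2-morphisms, whose coefficients are
  then read off. The number of points is \<open>l + 2\<close>, so that the sets of weight
  \<open>l\<close> are the complements of single points; the sum of all points is kept nonzero to
  tell bubbles from dots. The case \<open>l = 1\<close> is special: the index 0 is then also the
  last index \<open>l - 1\<close>, where the coefficient of the next dotted cap is mixed with that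
  of the bubble. Hence a single weight determines the parameters only from \<open>l = 2\<close> on,
  and the value of \<open>y\<close> at -1 has to be fetched from another weight.\<close>

text \<open>
  The bubbles of the model are the coefficients of \<open>quot_fps B A\<close> with \<open>A\<close> and \<open>B\<close> complementary; negative
  indices occur, hence \<open>icoeff\<close>.
\<close>

definition quot_fps :: "'a::field set \<Rightarrow> 'a set \<Rightarrow> 'a fps" where
  "quot_fps B A = (\<Prod>b\<in>B. 1 - fps_const b * fps_X) * inverse (\<Prod>a\<in>A. 1 - fps_const a * fps_X)"

definition icoeff :: "'a::zero fps \<Rightarrow> int \<Rightarrow> 'a" where
  "icoeff F n = (if n < 0 then 0 else fps_nth F (nat n))"

text \<open>The sum of the residues of
  \<open>z ^ m * (\<Prod>b\<in>B. z - b) / (\<Prod>a\<in>A. z - a)\<close> at its finite poles;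
  \<open>lagrange_sum_eq\<close> evaluates it at infinity instead.\<close>

definition lagrange_sum :: "'a::field set \<Rightarrow> 'a set \<Rightarrow> nat \<Rightarrow> 'a" where
  "lagrange_sum B A m = (\<Sum>a\<in>A. a ^ m * (\<Prod>b\<in>B. a - b) / (\<Prod>c\<in>A - {a}. a - c))"

lemma nth_0_prod_linear [simp]:
  "fps_nth (\<Prod>a\<in>A. 1 - fps_const (a :: 'a::field) * fps_X) 0 = 1"
  by (induction A rule: infinite_finite_induct) auto

lemma quot_fps_nth_0 [simp]: "fps_nth (quot_fps B A) 0 = 1"
  by (simp add: quot_fps_def)

lemma quot_fps_inverse: "quot_fps B A * quot_fps A B = 1"
proof -
  have "quot_fps B A * quot_fps A B
     = ((\<Prod>b\<in>B. 1 - fps_const b * fps_X) * inverse (\<Prod>b\<in>B. 1 - fps_const b * fps_X))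
     * ((\<Prod>b\<in>A. 1 - fps_const b * fps_X) * inverse (\<Prod>b\<in>A. 1 - fps_const b * fps_X))"
    unfolding quot_fps_def by (simp only: ac_simps)
  also have "\<dots> = 1"
    by (simp add: inverse_mult_eq_1')
  finally show ?thesis .
qed

lemma quot_fps_insert_num:
  "finite B \<Longrightarrow> b \<notin> B \<Longrightarrow> quot_fps (insert b B) A = (1 - fps_const b * fps_X) * quot_fps B A"
  by (simp add: quot_fps_def mult.assoc)

lemma quot_fps_insert_den:
  assumes "finite A" "a \<notin> A"
  shows "(1 - fps_const a * fps_X) * quot_fps B (insert a A) = quot_fps B A"
proof -
  let ?L = "1 - fps_const a * fps_X"
  have "?L * quot_fps B (insert a A) = ?L * inverse ?L * quot_fps B A"
    using assms by (simp add: quot_fps_def fps_inverse_mult mult.assoc mult.left_commute)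
  also have "?L * inverse ?L = 1"
    by (rule inverse_mult_eq_1') simp
  finally show ?thesis by simp
qed

lemma icoeff_linear_mult:
  "icoeff ((1 - fps_const (b :: 'a::field) * fps_X) * F) n = icoeff F n - b * icoeff F (n - 1)"
proof -
  have eq: "(1 - fps_const b * fps_X) * F = F - fps_const b * (fps_X * F)"
    by (simp add: algebra_simps)
  show ?thesis
  proof (cases "n \<le> 0")
    case False
    then have "nat n = Suc (nat (n - 1))" by simp
    then show ?thesis using False by (simp add: icoeff_def eq)
  qed (auto simp: icoeff_def)
qed

text \<open>Write one factor \<open>a\<close> as \<open>c + (a - c)\<close>: the factor
  \<open>a - c\<close> cancels in the denominator for \<open>a \<noteq> c\<close> and kills the term
  \<open>a = c\<close>.\<close>

lemma lagrange_sum_empty_step: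
  assumes "finite A" "c \<in> A"
  shows "lagrange_sum {} A (Suc m) = c * lagrange_sum {} A m + lagrange_sum {} (A - {c}) m"
proof -
  have "a ^ Suc m / (\<Prod>d\<in>A - {a}. a - d) - c * (a ^ m / (\<Prod>d\<in>A - {a}. a - d))
      = a ^ m / (\<Prod>d\<in>A - {c} - {a}. a - d)" if "a \<in> A - {c}" for a
  proof -
    have "(\<Prod>d\<in>A - {a}. a - d) = (a - c) * (\<Prod>d\<in>A - {a} - {c}. a - d)"
      using assms that by (intro prod.remove) auto
    moreover have "A - {c} - {a} = A - {a} - {c}" by auto
    moreover have "(\<Prod>d\<in>A - {a} - {c}. a - d) \<noteq> 0"
      using assms by auto
    ultimately show ?thesis using that by (simp add: divide_simps) (simp add: algebra_simps)
  qed
  note * = this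
  have "lagrange_sum {} A (Suc m) - c * lagrange_sum {} A m
     = (\<Sum>a\<in>A. a ^ Suc m / (\<Prod>d\<in>A - {a}. a - d) - c * (a ^ m / (\<Prod>d\<in>A - {a}. a - d)))"
    by (simp add: lagrange_sum_def sum_subtractf sum_distrib_left)
  also have "\<dots> = (\<Sum>a\<in>A - {c}. a ^ Suc m / (\<Prod>d\<in>A - {a}. a - d) - c * (a ^ m / (\<Prod>d\<in>A - {a}. a - d)))"
    using assms by (intro sum.mono_neutral_right) auto
  also have "\<dots> = lagrange_sum {} (A - {c}) m"
    using * by (simp add: lagrange_sum_def)
  finally show ?thesis by (simp add: algebra_simps)
qed

text \<open>The recursion of \<open>lagrange_sum_empty_step\<close> has the form of
  \<open>icoeff_linear_mult\<close>, so the two sides agree by induction on the number of points and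
  on \<open>m\<close>. It does not reach \<open>m = 0\<close>; there two different points are
  compared.\<close>

lemma lagrange_sum_empty:
  assumes "finite A"
  shows "lagrange_sum {} A m = icoeff (quot_fps {} A) (int m + 1 - int (card A))"
  using assms
proof (induction "card A" arbitrary: A m rule: less_induct)
  case less
  show ?case
  proof (cases "A = {}")
    case True
    then show ?thesis by (simp add: lagrange_sum_def icoeff_def quot_fps_def)
  next
    case False
    then obtain c where c: "c \<in> A" by auto
    have card: "card (A - {d}) < card A" "int (card (A - {d})) = int (card A) - 1" if "d \<in> A" for d
      using that less.prems card_Diff1_less [of A d] card.remove [of A d] by linarith+
    have den: "(1 - fps_const d * fps_X) * quot_fps {} A = quot_fps {} (A - {d})" if "d \<in> A" for d
      using quot_fps_insert_den [of "A - {d}" d "{}"] that less.prems by (simp add: insert_absorb)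
    have IH: "lagrange_sum {} (A - {d}) m = icoeff (quot_fps {} (A - {d})) (int m + 2 - int (card A))"
      if "d \<in> A" for d m
      using less.hyps [OF card(1) [OF that], of m] less.prems unfolding card(2) [OF that]
      by (simp add: algebra_simps)
    show ?thesis
    proof (induction m)
      case 0
      show ?case
      proof (cases "A = {c}")
        case True
        then show ?thesis by (simp add: lagrange_sum_def icoeff_def)
      next
        case False
        then obtain d where d: "d \<in> A" "d \<noteq> c" using c by auto
        have "card {c, d} \<le> card A" using c d less.prems by (intro card_mono) auto
        then have two: "card A \<ge> 2" using d by auto
        \<comment> \<open>Subtracting the recursions for \<open>c\<close> and \<open>d\<close>
          eliminates the sum with \<open>m = 1\<close>. With one point removed, both sums are 1 if
          \<open>card A = 2\<close> and 0 if \<open>card A > 2\<close>.\<close>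
        have "(d - c) * lagrange_sum {} A 0 = lagrange_sum {} (A - {c}) 0 - lagrange_sum {} (A - {d}) 0"
          using lagrange_sum_empty_step [OF less.prems c, of 0]
            lagrange_sum_empty_step [OF less.prems d(1), of 0] by (simp add: algebra_simps)
        also have "\<dots> = 0"
          unfolding IH [OF c] IH [OF d(1)] using two by (cases "card A = 2") (auto simp: icoeff_def)
        finally have "lagrange_sum {} A 0 = 0" using d by simp
        then show ?thesis using two by (simp add: icoeff_def)
      qed
    next
      case (Suc m)
      have "lagrange_sum {} A (Suc m) = c * icoeff (quot_fps {} A) (int m + 1 - int (card A))
          + icoeff ((1 - fps_const c * fps_X) * quot_fps {} A) (int m + 2 - int (card A))"
        unfolding lagrange_sum_empty_step [OF less.prems c] Suc IH [OF c] den [OF c] ..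
      also have "\<dots> = icoeff (quot_fps {} A) (int (Suc m) + 1 - int (card A))"
        unfolding icoeff_linear_mult by (simp add: algebra_simps)
      finally show ?case .
    qed
  qed
qed

text \<open>A new \<open>b\<close> multiplies each summand by \<open>a - b\<close>, that is, raises
  \<open>m\<close> by one or multiplies by \<open>- b\<close>; for the power series this is the new
  linear factor in the numerator.\<close>

theorem lagrange_sum_eq:
  assumes "finite A" "finite B"
  shows "lagrange_sum B A m = icoeff (quot_fps B A) (int m + int (card B) + 1 - int (card A))"
  using assms(2)
proof (induction B arbitrary: m rule: finite_induct)
  case empty
  then show ?case using lagrange_sum_empty [OF assms(1)] by simp
next
  case (insert b B)
  have "lagrange_sum (insert b B) A m = lagrange_sum B A (Suc m) - b * lagrange_sum B A m"
    using insert.hyps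
    by (simp add: lagrange_sum_def sum_distrib_left sum_subtractf [symmetric] diff_divide_distrib [symmetric])
       (intro sum.cong; simp add: algebra_simps)
  then show ?case
    using insert.hyps unfolding insert.IH quot_fps_insert_num [OF insert.hyps] icoeff_linear_mult
    by (simp add: algebra_simps)
qed

section \<open>Matrices indexed by paths\<close>

text \<open>
  A path is a list of elements that are added (\<open>\<E>\<close>) or removed (\<open>\<F>\<close>).  As in words, the last entry of the
  list is the first step.
\<close>

fun move :: "letter \<Rightarrow> 'a \<Rightarrow> 'a set \<Rightarrow> 'a set" where
  "move \<E> x S = insert x S"
| "move \<F> x S = S - {x}"

primrec endp :: "'a set \<Rightarrow> (letter \<times> 'a) list \<Rightarrow> 'a set" where
  "endp S [] = S"
| "endp S (s # p) = move (fst s) (snd s) (endp S p)"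

definition splits :: "'a list \<Rightarrow> ('a list \<times> 'a list) set" where
  "splits q = {(a, b). a @ b = q}"

lemma endp_append: "endp S (p @ q) = endp (endp S q) p"
  by (induction p) auto

lemma splits_eq: "splits q = (\<lambda>n. (take n q, drop n q)) ` {..length q}"
proof -
  have "(a, b) \<in> (\<lambda>n. (take n (a @ b), drop n (a @ b))) ` {..length (a @ b)}" for a b :: "'a list"
    by (rule image_eqI [of _ _ "length a"]) auto
  then show ?thesis by (auto simp: splits_def)
qed

lemma finite_splits [simp]: "finite (splits q)"
  by (simp add: splits_eq)

text \<open>Both sides run over the ways to cut \<open>q\<close> into three pieces.\<close>

lemma sum_splits_Sigma:
  "(\<Sum>x\<in>splits q. \<Sum>y\<in>splits (fst x). F (fst y) (snd y) (snd x))
   = (\<Sum>x\<in>splits q. \<Sum>y\<in>splits (snd x). F (fst x) (fst y) (snd y))"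
proof -
  have "(\<Sum>x\<in>splits q. \<Sum>y\<in>splits (fst x). F (fst y) (snd y) (snd x))
      = (\<Sum>z\<in>{(a, b, c). a @ b @ c = q}. F (fst z) (fst (snd z)) (snd (snd z)))"
    unfolding sum.Sigma [OF finite_splits ballI [OF finite_splits]]
    by (rule sum.reindex_bij_witness [where
          i = "\<lambda>z. ((fst z @ fst (snd z), snd (snd z)), (fst z, fst (snd z)))" and
          j = "\<lambda>(x, y). (fst y, snd y, snd x)"])
      (auto simp: splits_def)
  also have "\<dots> = (\<Sum>x\<in>splits q. \<Sum>y\<in>splits (snd x). F (fst x) (fst y) (snd y))"
    unfolding sum.Sigma [OF finite_splits ballI [OF finite_splits]]
    by (rule sum.reindex_bij_witness [symmetric, where
          i = "\<lambda>z. ((fst z, fst (snd z) @ snd (snd z)), (fst (snd z), snd (snd z)))" and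
          j = "\<lambda>(x, y). (fst x, fst y, snd y)"])
      (auto simp: splits_def)
  finally show ?thesis .
qed

lemma sum_splits_length:
  assumes "\<And>a b. a @ b = q \<Longrightarrow> length a \<noteq> n \<Longrightarrow> F a b = 0" "n \<le> length q"
  shows "(\<Sum>x\<in>splits q. F (fst x) (snd x)) = F (take n q) (drop n q)"
proof -
  have "(\<Sum>x\<in>splits q. F (fst x) (snd x)) = (\<Sum>x\<in>{(take n q, drop n q)}. F (fst x) (snd x))"
  proof (rule sum.mono_neutral_right)
    show "\<forall>x \<in> splits q - {(take n q, drop n q)}. F (fst x) (snd x) = 0"
    proof
      fix x assume "x \<in> splits q - {(take n q, drop n q)}"
      then have "fst x @ snd x = q" "x \<noteq> (take n q, drop n q)" by (auto simp: splits_def)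
      moreover from this have "length (fst x) \<noteq> n" by (metis append_eq_conv_conj prod.collapse)
      ultimately show "F (fst x) (snd x) = 0" using assms(1) by blast
    qed
  qed (use finite_splits [of q] in \<open>auto simp: splits_def\<close>)
  then show ?thesis by simp
qed

text \<open>
  \<open>f S q p\<close> is the coefficient of the path \<open>q\<close> in the image of the path \<open>p\<close>, both starting at \<open>S\<close>.  All words are
  treated at once, so that \<open>vmul\<close> is an infinite matrix product; the convention \<open>g S q p \<noteq> 0\<close> in its definition makes
  the sum meaningful when the columns of \<open>g\<close> are finite.
\<close>

type_synonym 'a matrices = "'a set \<Rightarrow> (letter \<times> 'a) list \<Rightarrow> (letter \<times> 'a) list \<Rightarrow> 'a"

definition vmul :: "'a::field matrices \<Rightarrow> 'a matrices \<Rightarrow> 'a matrices" where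
  "vmul f g = (\<lambda>S r p. \<Sum>q | g S q p \<noteq> 0. f S r q * g S q p)"

text \<open>The matrices do not record where a path has to be cut, so all cuts are summed over;
  fixed words of the left factor leave only one of them (\<open>hmul_typed\<close>). The left factor
  starts where the right part of the path ends.\<close>

definition hmul :: "'a::field matrices \<Rightarrow> 'a matrices \<Rightarrow> 'a matrices" where
  "hmul f g = (\<lambda>S q p. \<Sum>y\<in>splits q. \<Sum>x\<in>splits p. f (endp S (snd x)) (fst y) (fst x) * g S (snd y) (snd x))"

text \<open>Sums over infinite sets are 0 by default, so associativity and right linearity of
  \<open>vmul\<close> are only claimed for such matrices. All interpretations of diagrams are of
  this kind.\<close>

definition finite_columns :: "'a::field matrices \<Rightarrow> bool" where
  "finite_columns f \<longleftrightarrow> (\<forall>S p. finite {q. f S q p \<noteq> 0})"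

lemma vmul_eq_sum:
  "finite Q \<Longrightarrow> (\<And>q. g S q p \<noteq> 0 \<Longrightarrow> q \<in> Q) \<Longrightarrow> vmul f g S r p = (\<Sum>q\<in>Q. f S r q * g S q p)"
  unfolding vmul_def by (rule sum.mono_neutral_left) auto

lemma finite_columns_add:
  assumes "finite_columns f" "finite_columns g"
  shows "finite_columns (\<lambda>S q p. f S q p + g S q p)"
  unfolding finite_columns_def
proof (intro allI)
  fix S p
  show "finite {q. f S q p + g S q p \<noteq> 0}"
    by (rule finite_subset [of _ "{q. f S q p \<noteq> 0} \<union> {q. g S q p \<noteq> 0}"])
      (use assms in \<open>auto simp: finite_columns_def\<close>)
qed

lemma finite_columns_scale: "finite_columns f \<Longrightarrow> finite_columns (\<lambda>S q p. c * f S q p)"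
  unfolding finite_columns_def
  by (metis (mono_tags, lifting) Collect_mono finite_subset mult_zero_right)

lemma vmul_nonzero: "vmul f g S r p \<noteq> 0 \<Longrightarrow> \<exists>q. f S r q \<noteq> 0 \<and> g S q p \<noteq> 0"
  unfolding vmul_def by (drule sum.not_neutral_contains_not_neutral) auto

lemma hmul_nonzero:
  assumes "hmul f g S q p \<noteq> 0"
  shows "\<exists>q1 q2 p1 p2. q = q1 @ q2 \<and> p = p1 @ p2 \<and> f (endp S p2) q1 p1 \<noteq> 0 \<and> g S q2 p2 \<noteq> 0"
proof (rule ccontr)
  assume "\<not> ?thesis"
  then have "f (endp S (snd x)) (fst y) (fst x) * g S (snd y) (snd x) = 0"
    if "y \<in> splits q" "x \<in> splits p" for x y
    using that by (cases x; cases y) (auto simp: splits_def)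
  then have "hmul f g S q p = 0"
    unfolding hmul_def by (intro sum.neutral ballI)
  then show False using assms by contradiction
qed

lemma finite_columns_vmul:
  assumes "finite_columns f" "finite_columns g"
  shows "finite_columns (vmul f g)"
  unfolding finite_columns_def
proof (intro allI)
  fix S p
  have "{r. vmul f g S r p \<noteq> 0} \<subseteq> (\<Union>q\<in>{q. g S q p \<noteq> 0}. {r. f S r q \<noteq> 0})"
    using vmul_nonzero [of f g S _ p] by fastforce
  then show "finite {q. vmul f g S q p \<noteq> 0}"
    by (rule finite_subset) (use assms in \<open>auto simp: finite_columns_def\<close>)
qed

lemma finite_columns_hmul:
  assumes "finite_columns f" "finite_columns g"
  shows "finite_columns (hmul f g)"
  unfolding finite_columns_def
proof (intro allI)
  fix S p
  have "{q. hmul f g S q p \<noteq> 0} \<subseteq> (\<Union>x\<in>splits p. (\<lambda>(q1, q2). q1 @ q2) `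
          ({q. f (endp S (snd x)) q (fst x) \<noteq> 0} \<times> {q. g S q (snd x) \<noteq> 0}))"
    by (auto dest!: hmul_nonzero simp: splits_def image_iff) blast
  then show "finite {q. hmul f g S q p \<noteq> 0}"
    by (rule finite_subset) (use assms in \<open>auto simp: finite_columns_def\<close>)
qed

lemma vmul_assoc:
  assumes "finite_columns g" "finite_columns h"
  shows "vmul (vmul f g) h = vmul f (vmul g h)"
proof (intro ext)
  fix S r p
  \<comment> \<open>For a fixed column \<open>p\<close> only finitely many intermediate paths
    matter: \<open>Q\<close> above \<open>h\<close>, and then \<open>R\<close> above
    \<open>g\<close>.\<close>
  define Q where "Q = {q. h S q p \<noteq> 0}"
  define R where "R = (\<Union>q\<in>Q. {r. g S r q \<noteq> 0})"
  have fin: "finite Q" "finite R"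
    using assms by (auto simp: Q_def R_def finite_columns_def)
  have "vmul (vmul f g) h S r p = (\<Sum>q\<in>Q. vmul f g S r q * h S q p)"
    by (intro vmul_eq_sum fin) (simp add: Q_def)
  also have "\<dots> = (\<Sum>q\<in>Q. (\<Sum>s\<in>R. f S r s * g S s q) * h S q p)"
    by (intro sum.cong HOL.refl arg_cong2 [of _ _ _ _ "(*)"] vmul_eq_sum fin) (auto simp: R_def)
  also have "\<dots> = (\<Sum>s\<in>R. f S r s * (\<Sum>q\<in>Q. g S s q * h S q p))"
    by (simp add: sum_distrib_left sum_distrib_right mult.assoc) (rule sum.swap)
  also have "\<dots> = (\<Sum>s\<in>R. f S r s * vmul g h S s p)"
    by (intro sum.cong HOL.refl arg_cong2 [of _ _ _ _ "(*)"] vmul_eq_sum [symmetric] fin) (auto simp: Q_def)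
  also have "\<dots> = vmul f (vmul g h) S r p"
    by (intro vmul_eq_sum [symmetric] fin) (auto dest!: vmul_nonzero simp: R_def Q_def)
  finally show "vmul (vmul f g) h S r p = vmul f (vmul g h) S r p" .
qed

text \<open>\<open>endp_append\<close> gives the leftmost factor the same starting set in both
  bracketings; what remains is to choose two cuts in each path.\<close>

lemma hmul_assoc: "hmul (hmul f g) h = hmul f (hmul g h)"
proof (intro ext)
  fix S q p
  have "hmul (hmul f g) h S q p
     = (\<Sum>y\<in>splits q. \<Sum>y'\<in>splits (fst y). \<Sum>x\<in>splits p. \<Sum>x'\<in>splits (fst x).
          f (endp S (snd x' @ snd x)) (fst y') (fst x') * g (endp S (snd x)) (snd y') (snd x') * h S (snd y) (snd x))"
    unfolding hmul_def sum_distrib_right endp_append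
    by (rule sum.cong [OF HOL.refl], rule sum.swap)
  also have "\<dots> = (\<Sum>y\<in>splits q. \<Sum>y'\<in>splits (snd y). \<Sum>x\<in>splits p. \<Sum>x'\<in>splits (fst x).
          f (endp S (snd x' @ snd x)) (fst y) (fst x') * g (endp S (snd x)) (fst y') (snd x') * h S (snd y') (snd x))"
    by (rule sum_splits_Sigma)
  also have "\<dots> = (\<Sum>y\<in>splits q. \<Sum>y'\<in>splits (snd y). \<Sum>x\<in>splits p. \<Sum>x'\<in>splits (snd x).
          f (endp S (fst x' @ snd x')) (fst y) (fst x) * g (endp S (snd x')) (fst y') (fst x') * h S (snd y') (snd x'))"
    by (rule sum.cong [OF HOL.refl], rule sum.cong [OF HOL.refl], rule sum_splits_Sigma)
  also have "\<dots> = hmul f (hmul g h) S q p"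
    unfolding hmul_def sum_distrib_left mult.assoc [symmetric]
    by (rule sum.cong [OF HOL.refl], rule HOL.trans [OF _ sum.swap]) (auto simp: splits_def intro!: sum.cong)
  finally show "hmul (hmul f g) h S q p = hmul f (hmul g h) S q p" .
qed

lemma vmul_add_left: "vmul (\<lambda>S q p. f S q p + g S q p) h = (\<lambda>S q p. vmul f h S q p + vmul g h S q p)"
  by (simp add: vmul_def distrib_right sum.distrib)

lemma vmul_scale_left: "vmul (\<lambda>S q p. c * f S q p) g = (\<lambda>S q p. c * vmul f g S q p)"
  by (simp add: vmul_def sum_distrib_left mult.assoc)

lemma vmul_add_right:
  assumes "finite_columns g" "finite_columns h"
  shows "vmul f (\<lambda>S q p. g S q p + h S q p) = (\<lambda>S q p. vmul f g S q p + vmul f h S q p)"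
proof (intro ext)
  fix S r p
  let ?Q = "{q. g S q p \<noteq> 0} \<union> {q. h S q p \<noteq> 0}"
  have fin: "finite ?Q" using assms by (simp add: finite_columns_def)
  have "vmul f (\<lambda>S q p. g S q p + h S q p) S r p = (\<Sum>q\<in>?Q. f S r q * (g S q p + h S q p))"
    by (intro vmul_eq_sum fin) auto
  moreover have "vmul f g S r p = (\<Sum>q\<in>?Q. f S r q * g S q p)"
    "vmul f h S r p = (\<Sum>q\<in>?Q. f S r q * h S q p)"
    by (intro vmul_eq_sum fin; simp)+
  ultimately show "vmul f (\<lambda>S q p. g S q p + h S q p) S r p = vmul f g S r p + vmul f h S r p"
    by (simp add: distrib_left sum.distrib)
qed

lemma vmul_scale_right:
  assumes "finite_columns g"
  shows "vmul f (\<lambda>S q p. c * g S q p) = (\<lambda>S q p. c * vmul f g S q p)"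
proof (intro ext)
  fix S r p
  let ?Q = "{q. g S q p \<noteq> 0}"
  have fin: "finite ?Q" using assms by (simp add: finite_columns_def)
  have "vmul f (\<lambda>S q p. c * g S q p) S r p = (\<Sum>q\<in>?Q. f S r q * (c * g S q p))"
    by (intro vmul_eq_sum fin) auto
  then show "vmul f (\<lambda>S q p. c * g S q p) S r p = c * vmul f g S r p"
    by (simp add: vmul_def sum_distrib_left ac_simps)
qed

lemma hmul_add_left: "hmul (\<lambda>S q p. f S q p + g S q p) h = (\<lambda>S q p. hmul f h S q p + hmul g h S q p)"
  by (simp add: hmul_def distrib_right sum.distrib)

lemma hmul_add_right: "hmul f (\<lambda>S q p. g S q p + h S q p) = (\<lambda>S q p. hmul f g S q p + hmul f h S q p)"
  by (simp add: hmul_def distrib_left sum.distrib)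

lemma hmul_scale_left: "hmul (\<lambda>S q p. c * f S q p) g = (\<lambda>S q p. c * hmul f g S q p)"
  by (simp add: hmul_def sum_distrib_left mult.assoc)

lemma hmul_scale_right: "hmul f (\<lambda>S q p. c * g S q p) = (\<lambda>S q p. c * hmul f g S q p)"
  by (simp add: hmul_def sum_distrib_left mult.left_commute)

section \<open>The model at the fixed points of Grassmannians\<close>

locale flag_model =
  fixes \<Omega> :: "'a::field set" and \<phi> :: "'k::field \<Rightarrow> 'a"
  assumes finite_\<Omega>: "finite \<Omega>"
    and \<phi>_add: "\<phi> (c + d) = \<phi> c + \<phi> d"
    and \<phi>_mult: "\<phi> (c * d) = \<phi> c * \<phi> d"
    and \<phi>_1: "\<phi> 1 = 1"
begin

lemma \<phi>_0: "\<phi> 0 = 0"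
  using \<phi>_add [of 0 0] by (metis add_cancel_right_right add_0)

lemma \<phi>_uminus: "\<phi> (- c) = - \<phi> c"
  using \<phi>_add [of "- c" c] by (simp add: \<phi>_0 eq_neg_iff_add_eq_0)

fun avail :: "letter \<Rightarrow> 'a set \<Rightarrow> 'a set" where
  "avail \<E> S = \<Omega> - S"
| "avail \<F> S = S"

primrec path :: "'a set \<Rightarrow> (letter \<times> 'a) list \<Rightarrow> bool" where
  "path S [] \<longleftrightarrow> True"
| "path S (s # p) \<longleftrightarrow> path S p \<and> snd s \<in> avail (fst s) (endp S p)"

definition state :: "int \<Rightarrow> 'a set \<Rightarrow> bool" where
  "state l S \<longleftrightarrow> S \<subseteq> \<Omega> \<and> 2 * int (card S) - int (card \<Omega>) = l"

definition paths :: "'a set \<Rightarrow> letter list \<Rightarrow> (letter \<times> 'a) list set" where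
  "paths S w = {p. path S p \<and> map fst p = w}"

text \<open>
  The ratio of the Euler classes at two adjacent fixed points.  The adjunctions are normalised by
  \<open>\<eta> = \<epsilon>' = 1\<close>, which puts all weights into \<open>\<epsilon>\<close> and \<open>\<eta>'\<close>; the crossing \<open>\<tau>\<close> is the divided difference operator
  \<open>f \<mapsto> (f - s f) / (x - y)\<close>, and \<open>\<tau>'\<close> is forced by cyclicity.
\<close>

definition euler :: "'a set \<Rightarrow> 'a \<Rightarrow> 'a" where
  "euler S x = (\<Prod>s\<in>S. x - s) / (\<Prod>r\<in>\<Omega> - S - {x}. x - r)"

fun gen_value :: "gen \<Rightarrow> 'a set \<Rightarrow> 'a list \<Rightarrow> 'a list \<Rightarrow> 'a" where
  "gen_value gXi S q p = p ! 0"
| "gen_value gXi' S q p = p ! 0"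
| "gen_value gTau S q p = 1 / (p ! 0 - p ! 1)"
| "gen_value gTau' S q p = 1 / (q ! 1 - q ! 0)"
| "gen_value gEta S q p = 1"
| "gen_value gEps S q p = euler S (p ! 1)"
| "gen_value gEta' S q p = 1 / euler (S - {q ! 1}) (q ! 1)"
| "gen_value gEps' S q p = 1"

definition ident_mat :: "letter list \<Rightarrow> int \<Rightarrow> 'a matrices" where
  "ident_mat w l = (\<lambda>S q p. if state l S \<and> path S p \<and> map fst p = w \<and> q = p then 1 else 0)"

text \<open>Requiring equal end points makes the matrix commute with multiplication by functions of
  the initial and of the final set, as for a map of bimodules.\<close>

definition gen_mat :: "gen \<Rightarrow> int \<Rightarrow> 'a matrices" where
  "gen_mat g l = (\<lambda>S q p. if state l S \<and> q \<in> paths S (gcod g) \<and> p \<in> paths S (gdom g) \<and> endp S q = endp S p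
     then gen_value g S (map snd q) (map snd p) else 0)"

primrec interp :: "'k diag \<Rightarrow> 'a matrices" where
  "interp Zero = (\<lambda>S q p. 0)"
| "interp (Add f g) = (\<lambda>S q p. interp f S q p + interp g S q p)"
| "interp (Scale c f) = (\<lambda>S q p. \<phi> c * interp f S q p)"
| "interp (Ident w l) = ident_mat w l"
| "interp (Gen g l) = gen_mat g l"
| "interp (Vert f g) = vmul (interp f) (interp g)"
| "interp (f \<star> g) = hmul (interp f) (interp g)"

lemma interp_simps [simp]:
  "interp 0 = (\<lambda>S q p. 0)"
  "interp (f + g) = (\<lambda>S q p. interp f S q p + interp g S q p)"
  "interp (f * g) = vmul (interp f) (interp g)"
  "interp (- f) = (\<lambda>S q p. - interp f S q p)"
  "interp (f - g) = (\<lambda>S q p. interp f S q p - interp g S q p)"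
  by (simp_all add: zero_diag_def plus_diag_def times_diag_def uminus_diag_def minus_diag_def \<phi>_uminus \<phi>_1)

lemma path_append: "path S (p @ q) \<longleftrightarrow> path S q \<and> path (endp S q) p"
  by (induction p) (auto simp: endp_append)

lemma endp_subset: "S \<subseteq> \<Omega> \<Longrightarrow> path S p \<Longrightarrow> endp S p \<subseteq> \<Omega>"
proof (induction p)
  case (Cons s p)
  then show ?case by (cases s; cases "fst s") auto
qed auto

lemma state_endp: "state l S \<Longrightarrow> path S p \<Longrightarrow> state (tgt (map fst p) l) (endp S p)"
proof (induction p)
  case (Cons s p)
  obtain X x where s: "s = (X, x)" by (cases s)
  have st: "state (tgt (map fst p) l) (endp S p)" using Cons by simp
  then have "finite (endp S p)" using finite_\<Omega> by (auto simp: state_def intro: finite_subset)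
  moreover have "card (endp S p) > 0" if "x \<in> endp S p"
    using that calculation by (auto simp: card_gt_0_iff)
  ultimately show ?case
    using st Cons.prems s by (cases X) (auto simp: state_def tgt_def card_insert_if card_Diff_singleton_if of_nat_diff)
qed (simp add: tgt_def)

lemma paths_Nil [simp]: "paths S [] = {[]}"
  by (auto simp: paths_def)

lemma paths_Cons: "paths S (X # w) = (\<lambda>(p, x). (X, x) # p) ` (SIGMA p:paths S w. avail X (endp S p))"
  by (auto simp: paths_def image_iff map_eq_Cons_conv)

lemma finite_avail: "S \<subseteq> \<Omega> \<Longrightarrow> finite (avail X S)"
  using finite_\<Omega> by (cases X) (auto intro: finite_subset)

lemma finite_paths: "S \<subseteq> \<Omega> \<Longrightarrow> finite (paths S w)"
proof (induction w)
  case (Cons X w)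
  then show ?case
    unfolding paths_Cons
    by (intro finite_imageI finite_SigmaI finite_avail endp_subset) (auto simp: paths_def)
qed simp

lemma sum_paths_Cons:
  assumes "S \<subseteq> \<Omega>"
  shows "(\<Sum>p\<in>paths S (X # w). G p) = (\<Sum>p\<in>paths S w. \<Sum>x\<in>avail X (endp S p). G ((X, x) # p))"
proof -
  have "(\<Sum>p\<in>paths S (X # w). G p)
      = (\<Sum>z\<in>(SIGMA p:paths S w. avail X (endp S p)). G ((X, snd z) # fst z))"
    unfolding paths_Cons
    by (subst sum.reindex) (auto simp: inj_on_def case_prod_beta)
  also have "\<dots> = (\<Sum>p\<in>paths S w. \<Sum>x\<in>avail X (endp S p). G ((X, x) # p))"
    using endp_subset [OF assms]
    by (subst sum.Sigma) (auto simp: case_prod_beta paths_def intro!: finite_paths [unfolded paths_def] finite_avail assms)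
  finally show ?thesis .
qed

lemma sum_paths_append:
  assumes "S \<subseteq> \<Omega>"
  shows "(\<Sum>p\<in>paths S (w @ v). G p) = (\<Sum>q\<in>paths S v. \<Sum>p\<in>paths (endp S q) w. G (p @ q))"
  using assms
proof (induction w arbitrary: G)
  case (Cons X w)
  have "(\<Sum>p\<in>paths S ((X # w) @ v). G p)
      = (\<Sum>p\<in>paths S (w @ v). \<Sum>x\<in>avail X (endp S p). G ((X, x) # p))"
    using Cons.prems by (simp add: sum_paths_Cons)
  also have "\<dots> = (\<Sum>q\<in>paths S v. \<Sum>p\<in>paths (endp S q) w. \<Sum>x\<in>avail X (endp S (p @ q)). G ((X, x) # p @ q))"
    using Cons by simp
  also have "\<dots> = (\<Sum>q\<in>paths S v. \<Sum>p\<in>paths (endp S q) (X # w). G (p @ q))"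
  proof (rule sum.cong [OF HOL.refl])
    fix q assume "q \<in> paths S v"
    then have "endp S q \<subseteq> \<Omega>" using Cons.prems by (auto simp: paths_def dest: endp_subset)
    then show "(\<Sum>p\<in>paths (endp S q) w. \<Sum>x\<in>avail X (endp S (p @ q)). G ((X, x) # p @ q))
        = (\<Sum>p\<in>paths (endp S q) (X # w). G (p @ q))"
      by (simp add: sum_paths_Cons endp_append)
  qed
  finally show ?case .
qed simp

section \<open>Supports of matrices, and the axioms of a strict 2-category\<close>

definition preserving :: "'a matrices \<Rightarrow> bool" where
  "preserving f \<longleftrightarrow> finite_columns f \<and>
     (\<forall>S q p. f S q p \<noteq> 0 \<longrightarrow> S \<subseteq> \<Omega> \<and> path S q \<and> path S p \<and> endp S q = endp S p)"

definition typed :: "letter list \<Rightarrow> letter list \<Rightarrow> int \<Rightarrow> 'a matrices \<Rightarrow> bool" where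
  "typed v w l f \<longleftrightarrow>
     (\<forall>S q p. f S q p \<noteq> 0 \<longrightarrow> state l S \<and> q \<in> paths S w \<and> p \<in> paths S v \<and> endp S q = endp S p)"

lemma typed_preserving: "typed v w l f \<Longrightarrow> preserving f"
  unfolding preserving_def finite_columns_def
proof (intro conjI allI impI)
  fix S p
  assume f: "typed v w l f"
  show "finite {q. f S q p \<noteq> 0}"
  proof (cases "state l S")
    case True
    then show ?thesis using f
      by (intro finite_subset [OF _ finite_paths [of S w]]) (auto simp: typed_def state_def)
  next
    case False
    then have "{q. f S q p \<noteq> 0} = {}" using f by (auto simp: typed_def)
    then show ?thesis by simp
  qed
qed (auto simp: typed_def paths_def state_def)

lemma typed_ident: "typed w w l (ident_mat w l)"
  by (auto simp: typed_def ident_mat_def paths_def)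

lemma typed_gen: "typed (gdom g) (gcod g) l (gen_mat g l)"
  by (auto simp: typed_def gen_mat_def)

lemma typed_add: "typed v w l f \<Longrightarrow> typed v w l g \<Longrightarrow> typed v w l (\<lambda>S q p. f S q p + g S q p)"
  unfolding typed_def by (metis add_cancel_right_left)

lemma typed_uminus: "typed v w l f \<Longrightarrow> typed v w l (\<lambda>S q p. - f S q p)"
  unfolding typed_def by auto

lemma typed_zero: "typed v w l (\<lambda>S q p. 0)"
  unfolding typed_def by auto

lemma preserving_vmul: "preserving f \<Longrightarrow> preserving g \<Longrightarrow> preserving (vmul f g)"
  unfolding preserving_def
  by (intro conjI finite_columns_vmul; (elim conjE; assumption)?; (intro allI impI)?; (drule vmul_nonzero)?) metis

lemma preserving_hmul: "preserving f \<Longrightarrow> preserving g \<Longrightarrow> preserving (hmul f g)"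
  unfolding preserving_def
  by (intro conjI finite_columns_hmul; (elim conjE; assumption)?; (intro allI impI)?; (drule hmul_nonzero)?)
    (fastforce simp: path_append endp_append)+

lemma preserving_interp: "preserving (interp f)"
proof (induction f)
  case Zero then show ?case by (simp add: preserving_def finite_columns_def)
next
  case (Add f g) then show ?case
    unfolding preserving_def interp.simps
    by (intro conjI finite_columns_add; (elim conjE; assumption)?; (intro allI impI)?) (metis add_0)+
next
  case (Scale c f) then show ?case
    unfolding preserving_def interp.simps
    by (intro conjI finite_columns_scale; (elim conjE; assumption)?; (intro allI impI)?) (metis mult_zero_right)+
next
  case (Ident w l) then show ?case using typed_preserving [OF typed_ident] by simp
next
  case (Gen g l) then show ?case using typed_preserving [OF typed_gen] by simp
next
  case (Vert f g) then show ?case by (simp add: preserving_vmul)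
next
  case (Horiz f g) then show ?case by (simp add: preserving_hmul)
qed

lemma finite_columns_interp: "finite_columns (interp f)"
  using preserving_interp by (auto simp: preserving_def)

lemma vmul_ident_left:
  assumes "finite_columns f"
  shows "vmul (ident_mat w l) f = (\<lambda>S q p. if state l S \<and> q \<in> paths S w then f S q p else 0)"
proof (intro ext)
  fix S r p
  have fin: "finite {q. f S q p \<noteq> 0}" using assms by (simp add: finite_columns_def)
  have "vmul (ident_mat w l) f S r p
      = (\<Sum>q | f S q p \<noteq> 0. if q = r then (if state l S \<and> r \<in> paths S w then f S r p else 0) else 0)"
    unfolding vmul_def by (intro sum.cong) (auto simp: ident_mat_def paths_def)
  also have "\<dots> = (if state l S \<and> r \<in> paths S w then f S r p else 0)"
    using fin by (subst sum.delta) auto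
  finally show "vmul (ident_mat w l) f S r p = (if state l S \<and> r \<in> paths S w then f S r p else 0)" .
qed

lemma vmul_ident_right:
  "vmul f (ident_mat w l) = (\<lambda>S q p. if state l S \<and> p \<in> paths S w then f S q p else 0)"
proof (intro ext)
  fix S r p
  have "vmul f (ident_mat w l) S r p
      = (\<Sum>q\<in>{p}. if state l S \<and> p \<in> paths S w then f S r p else 0)"
    by (subst vmul_eq_sum [of "{p}"]) (auto simp: ident_mat_def paths_def split: if_splits)
  then show "vmul f (ident_mat w l) S r p = (if state l S \<and> p \<in> paths S w then f S r p else 0)"
    by simp
qed

lemma vmul_ident_typed:
  assumes "typed v w l f"
  shows "vmul (ident_mat w l) f = f" "vmul f (ident_mat v l) = f"
proof -
  have "finite_columns f" using typed_preserving [OF assms] by (simp add: preserving_def)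
  then show "vmul (ident_mat w l) f = f" "vmul f (ident_mat v l) = f"
    using assms by (intro ext; force simp: vmul_ident_left vmul_ident_right typed_def)+
qed

text \<open>The left factor vanishes unless its two arguments have the lengths of \<open>w\<close>
  and \<open>v\<close>; this leaves one cut of \<open>q\<close> and one of \<open>p\<close>.\<close>

lemma hmul_typed:
  assumes "typed v w m f"
  shows "hmul f g S q p =
    f (endp S (drop (length v) p)) (take (length w) q) (take (length v) p)
      * g S (drop (length w) q) (drop (length v) p)"
proof -
  have 0: "f T a b = 0" if "length a \<noteq> length w \<or> length b \<noteq> length v" for T a b
    using assms that by (force simp: typed_def paths_def)
  show ?thesis
  proof (cases "length w \<le> length q \<and> length v \<le> length p")
    case True
    have "hmul f g S q p = (\<Sum>y\<in>splits q.
        f (endp S (drop (length v) p)) (fst y) (take (length v) p) * g S (snd y) (drop (length v) p))"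
      unfolding hmul_def
      by (intro sum.cong HOL.refl sum_splits_length
          [where F = "\<lambda>a b. f (endp S b) _ a * g S _ b"]) (use True 0 in auto)
    also have "\<dots> = f (endp S (drop (length v) p)) (take (length w) q) (take (length v) p)
      * g S (drop (length w) q) (drop (length v) p)"
      by (intro sum_splits_length
          [where F = "\<lambda>a b. f (endp S (drop (length v) p)) a (take (length v) p) * g S b (drop (length v) p)"])
        (use True 0 in auto)
    finally show ?thesis .
  next
    case False
    then have "f T a b = 0" if "(a, a') \<in> splits q" "(b, b') \<in> splits p" for T a b a' b'
      using that by (intro 0) (auto simp: splits_def)
    moreover have "f (endp S (drop (length v) p)) (take (length w) q) (take (length v) p) = 0"
      using False by (intro 0) auto
    ultimately show ?thesis unfolding hmul_def by (auto intro!: sum.neutral)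
  qed
qed

lemma hmul_ident: "hmul (ident_mat w m) (ident_mat v l) = (if m = tgt v l then ident_mat (w @ v) l else (\<lambda>S q p. 0))"
proof (intro ext)
  fix S q p
  have *: "state (tgt (map fst (drop (length w) p)) l) (endp S (drop (length w) p))"
    if "state l S" "path S (drop (length w) p)"
    using state_endp [OF that] .
  have app: "(take n q = take n p \<and> drop n q = drop n p) \<longleftrightarrow> q = p" for n
    by (metis append_take_drop_id)
  have word: "map fst (take (length w) p) = w \<and> map fst (drop (length w) p) = v \<longleftrightarrow> map fst p = w @ v"
    by (metis append_eq_conv_conj append_take_drop_id drop_map map_append take_map)
  have path: "path S p \<longleftrightarrow> path S (drop (length w) p) \<and> path (endp S (drop (length w) p)) (take (length w) p)"
    by (metis append_take_drop_id path_append)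
  let ?t = "take (length w)" and ?d = "drop (length w)"
  have state_unique: "state m T \<Longrightarrow> state m' T \<longleftrightarrow> m = m'" for m m' T
    by (auto simp: state_def)
  have "hmul (ident_mat w m) (ident_mat v l) S q p
      = (if (state m (endp S (?d p)) \<and> path (endp S (?d p)) (?t p) \<and> map fst (?t p) = w \<and> ?t q = ?t p)
          \<and> (state l S \<and> path S (?d p) \<and> map fst (?d p) = v \<and> ?d q = ?d p) then 1 else 0)"
    by (subst hmul_typed [OF typed_ident]) (simp add: ident_mat_def)
  also have "\<dots> = (if m = tgt v l \<and> state l S \<and> path S p \<and> map fst p = w @ v \<and> q = p then 1 else 0)"
    using * word path app [of "length w"] state_unique [of "tgt v l" "endp S (?d p)" m]
    by (intro if_cong HOL.refl) metis
  finally show "hmul (ident_mat w m) (ident_mat v l) S q p = (if m = tgt v l then ident_mat (w @ v) l else (\<lambda>S q p. 0)) S q p"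
    by (simp add: ident_mat_def)
qed

lemma hmul_unit_left:
  assumes "\<And>S q p. f S q p \<noteq> 0 \<Longrightarrow> state l S \<and> p \<in> paths S w"
  shows "hmul (ident_mat [] (tgt w l)) f = f"
proof (intro ext)
  fix S q p
  show "hmul (ident_mat [] (tgt w l)) f S q p = f S q p"
    unfolding hmul_typed [OF typed_ident]
    using assms [of S q p] state_endp [of l S p] by (auto simp: ident_mat_def paths_def)
qed

lemma hmul_unit_right:
  assumes "\<And>S q p. f S q p \<noteq> 0 \<Longrightarrow> state l S"
  shows "hmul f (ident_mat [] l) = f"
proof (intro ext)
  fix S q p
  have "hmul f (ident_mat [] l) S q p = (\<Sum>y\<in>splits q. \<Sum>x\<in>splits p. if x = (p, []) then if y = (q, []) then f S q p else 0 else 0)"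
    unfolding hmul_def using assms [of S q p]
    by (cases "f S q p = 0"; intro sum.cong HOL.refl) (auto simp: ident_mat_def splits_def)
  also have "\<dots> = (\<Sum>y\<in>splits q. if y = (q, []) then f S q p else 0)"
    by (intro sum.cong HOL.refl, subst sum.delta [OF finite_splits]) (simp add: splits_def [of p])
  also have "\<dots> = f S q p"
    by (subst sum.delta [OF finite_splits]) (simp add: splits_def [of q])
  finally show "hmul f (ident_mat [] l) S q p = f S q p" .
qed

text \<open>A middle path for the word \<open>w @ v\<close> is a middle path for \<open>v\<close>
  followed by one for \<open>w\<close>, and the lengths of the words prevent any other cut. The sum
  over middle paths therefore splits, except that the path for \<open>w\<close> starts where the one
  for \<open>v\<close> ends.\<close>

lemma interchange:
  assumes pres: "preserving F" "preserving F'" "preserving G" "preserving G'"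
    and F: "\<And>S r q. F S r q \<noteq> 0 \<Longrightarrow> state m S \<and> q \<in> paths S w"
    and F': "\<And>S q p. F' S q p \<noteq> 0 \<Longrightarrow> state m S \<and> q \<in> paths S w"
    and G: "\<And>S r q. G S r q \<noteq> 0 \<Longrightarrow> state l S \<and> q \<in> paths S v"
    and G': "\<And>S q p. G' S q p \<noteq> 0 \<Longrightarrow> state l S \<and> q \<in> paths S v"
  shows "hmul (vmul F F') (vmul G G') = vmul (hmul F G) (hmul F' G')"
proof (intro ext)
  fix S r p
  have F0: "F T a b = 0" if "length b \<noteq> length w" for T a b
    using F [of T a b] that by (cases "F T a b = 0") (auto simp: paths_def)
  have F'0: "F' T a b = 0" if "length a \<noteq> length w" for T a b
    using F' [of T a b] that by (cases "F' T a b = 0") (auto simp: paths_def)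
  show "hmul (vmul F F') (vmul G G') S r p = vmul (hmul F G) (hmul F' G') S r p"
  proof (cases "state l S")
    case False
    then have "G' S a b = 0" for a b using G' by blast
    then show ?thesis by (simp add: hmul_def vmul_def)
  next
    case True
    then have S: "S \<subseteq> \<Omega>" by (simp add: state_def)
    have FF': "vmul F F' T a b = (\<Sum>q\<in>paths T w. F T a q * F' T q b)" if "T \<subseteq> \<Omega>" for T a b
      using that F' by (intro vmul_eq_sum finite_paths) auto
    have GG': "vmul G G' S a b = (\<Sum>q\<in>paths S v. G S a q * G' S q b)" for a b
      using S G' by (intro vmul_eq_sum finite_paths) auto
    have FG: "hmul F G S r (q1 @ q2) = (\<Sum>y\<in>splits r. F (endp S q2) (fst y) q1 * G S (snd y) q2)"
      if "q1 \<in> paths T w" for q1 q2 T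
    proof -
      have len: "length q1 = length w" using that by (auto simp: paths_def)
      have "hmul F G S r (q1 @ q2) = (\<Sum>y\<in>splits r.
         F (endp S (drop (length w) (q1 @ q2))) (fst y) (take (length w) (q1 @ q2)) * G S (snd y) (drop (length w) (q1 @ q2)))"
        unfolding hmul_def
        by (intro sum.cong HOL.refl sum_splits_length
          [where F = "\<lambda>a b. F (endp S b) _ a * G S _ b"]) (use len F0 in auto)
      then show ?thesis using len by simp
    qed
    have F'G': "hmul F' G' S (q1 @ q2) p = (\<Sum>x\<in>splits p. F' (endp S (snd x)) q1 (fst x) * G' S q2 (snd x))"
      if "q1 \<in> paths T w" for q1 q2 T
    proof -
      have len: "length q1 = length w" using that by (auto simp: paths_def)
      have "hmul F' G' S (q1 @ q2) p = (\<Sum>x\<in>splits p.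
         F' (endp S (snd x)) (take (length w) (q1 @ q2)) (fst x) * G' S (drop (length w) (q1 @ q2)) (snd x))"
        unfolding hmul_def
        by (subst sum.swap, intro sum.cong HOL.refl sum_splits_length
          [where F = "\<lambda>a b. F' (endp S (snd _)) a (fst _) * G' S b (snd _)"]) (use len F'0 in auto)
      then show ?thesis using len by simp
    qed
    have "vmul (hmul F G) (hmul F' G') S r p = (\<Sum>q\<in>paths S (w @ v). hmul F G S r q * hmul F' G' S q p)"
    proof (rule vmul_eq_sum [OF finite_paths [OF S]])
      fix q assume "hmul F' G' S q p \<noteq> 0"
      then obtain q1 q2 p1 p2 where q: "q = q1 @ q2" "F' (endp S p2) q1 p1 \<noteq> 0" "G' S q2 p2 \<noteq> 0"
        by (blast dest: hmul_nonzero)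
      moreover have "endp S q2 = endp S p2" using q pres by (auto simp: preserving_def)
      ultimately show "q \<in> paths S (w @ v)"
        using F' [OF q(2)] G' [OF q(3)] by (auto simp: paths_def path_append)
    qed
    also have "\<dots> = (\<Sum>q2\<in>paths S v. \<Sum>q1\<in>paths (endp S q2) w.
        (\<Sum>y\<in>splits r. F (endp S q2) (fst y) q1 * G S (snd y) q2)
        * (\<Sum>x\<in>splits p. F' (endp S (snd x)) q1 (fst x) * G' S q2 (snd x)))"
      unfolding sum_paths_append [OF S]
      by (intro sum.cong HOL.refl arg_cong2 [of _ _ _ _ "(*)"]; rule FG F'G'; assumption)
    also have "\<dots> = (\<Sum>q2\<in>paths S v. \<Sum>y\<in>splits r. \<Sum>x\<in>splits p. \<Sum>q1\<in>paths (endp S q2) w.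
        F (endp S q2) (fst y) q1 * G S (snd y) q2 * (F' (endp S (snd x)) q1 (fst x) * G' S q2 (snd x)))"
      unfolding sum_product
      by (rule sum.cong [OF HOL.refl], rule HOL.trans [OF sum.swap], rule sum.cong [OF HOL.refl], rule sum.swap)
    also have "\<dots> = (\<Sum>q2\<in>paths S v. \<Sum>y\<in>splits r. \<Sum>x\<in>splits p.
        vmul F F' (endp S (snd x)) (fst y) (fst x) * (G S (snd y) q2 * G' S q2 (snd x)))"
    proof (intro sum.cong HOL.refl)
      fix q2 y x
      show "(\<Sum>q1\<in>paths (endp S q2) w.
          F (endp S q2) (fst y) q1 * G S (snd y) q2 * (F' (endp S (snd x)) q1 (fst x) * G' S q2 (snd x)))
        = vmul F F' (endp S (snd x)) (fst y) (fst x) * (G S (snd y) q2 * G' S q2 (snd x))"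
      \<comment> \<open>Since \<open>G'\<close> preserves end points, the left middle path starts at
        \<open>endp S (snd x)\<close> in every nonzero term. This set does not involve
        \<open>q2\<close>, so the sum over \<open>q1\<close> can be carried out separately.\<close>
      proof (cases "G' S q2 (snd x) = 0")
        case False
        then have "path S (snd x)" and eq: "endp S q2 = endp S (snd x)"
          using pres(4) by (auto simp: preserving_def)
        with S have sub: "endp S (snd x) \<subseteq> \<Omega>" by (blast dest: endp_subset)
        show ?thesis unfolding eq FF' [OF sub] sum_distrib_right
          by (intro sum.cong HOL.refl) (simp add: mult_ac)
      qed simp
    qed
    also have "\<dots> = (\<Sum>y\<in>splits r. \<Sum>x\<in>splits p. \<Sum>q2\<in>paths S v.
        vmul F F' (endp S (snd x)) (fst y) (fst x) * (G S (snd y) q2 * G' S q2 (snd x)))"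
      by (rule HOL.trans [OF sum.swap], rule sum.cong [OF HOL.refl], rule sum.swap)
    also have "\<dots> = hmul (vmul F F') (vmul G G') S r p"
      unfolding hmul_def GG' sum_distrib_left ..
    finally show ?thesis ..
  qed
qed

lemma interp_linear_rel: "f \<approx>\<^sub>l g \<Longrightarrow> interp f = interp g"
  by (induction rule: linear_rel.induct)
    (auto simp: algebra_simps \<phi>_add \<phi>_mult \<phi>_1 vmul_add_left vmul_add_right vmul_scale_left
      vmul_scale_right hmul_add_left hmul_add_right hmul_scale_left hmul_scale_right finite_columns_interp)

lemma interp_cat_rel: "f \<approx>\<^sub>c g \<Longrightarrow> interp f = interp g"
proof (induction rule: cat_rel.induct)
  case (vert_assoc f g h)
  then show ?case by (simp add: vmul_assoc finite_columns_interp)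
next
  case (vert_ident w m v l)
  show ?case
    by (auto simp: vmul_ident_right fun_eq_iff) (auto simp: ident_mat_def paths_def state_def)
next
  case (gen_dom g l)
  then show ?case by (simp add: vmul_ident_typed [OF typed_gen])
next
  case (gen_cod g l)
  then show ?case by (simp add: vmul_ident_typed [OF typed_gen])
next
  case (horiz_assoc f g h)
  then show ?case by (simp add: hmul_assoc)
next
  case (horiz_ident w m v l)
  then show ?case by (simp add: hmul_ident)
next
  case (horiz_unit_left w l f)
  show ?case unfolding interp_simps interp.simps
    by (rule hmul_unit_left) (simp add: vmul_ident_right split: if_splits)
next
  case (horiz_unit_right f w l)
  show ?case unfolding interp_simps interp.simps
    by (rule hmul_unit_right) (simp add: vmul_ident_right split: if_splits)
next
  case (interchange f w m f' g v l g')
  show ?case unfolding interp_simps interp.simps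
    by (rule flag_model.interchange [OF flag_model_axioms, where w = w and m = m and v = v and l = l])
      ((intro preserving_vmul preserving_interp typed_preserving [OF typed_ident])+,
       simp_all add: vmul_ident_right vmul_ident_left finite_columns_interp split: if_splits)
qed

section \<open>Words of a diagram and entries of composites\<close>

definition shaped :: "letter list \<Rightarrow> letter list \<Rightarrow> 'a matrices \<Rightarrow> bool" where
  "shaped v w f \<longleftrightarrow>
     (\<forall>S q p. f S q p \<noteq> 0 \<longrightarrow> S \<subseteq> \<Omega> \<and> q \<in> paths S w \<and> p \<in> paths S v \<and> endp S q = endp S p)"

text \<open>
  For \<open>0\<close> both words are \<open>[]\<close>; this is harmless for endomorphisms of \<open>1\<^sub>l\<close> such as the bubbles, but sums of
  \<open>2\<close>-morphisms between longer words are not \<open>well_typed\<close> when they end in \<open>Zero\<close>.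
\<close>

primrec dom_word :: "'k diag \<Rightarrow> letter list" where
  "dom_word Zero = []"
| "dom_word (Add f g) = dom_word f"
| "dom_word (Scale c f) = dom_word f"
| "dom_word (Ident w l) = w"
| "dom_word (Gen g l) = gdom g"
| "dom_word (Vert f g) = dom_word g"
| "dom_word (f \<star> g) = dom_word f @ dom_word g"

primrec cod_word :: "'k diag \<Rightarrow> letter list" where
  "cod_word Zero = []"
| "cod_word (Add f g) = cod_word f"
| "cod_word (Scale c f) = cod_word f"
| "cod_word (Ident w l) = w"
| "cod_word (Gen g l) = gcod g"
| "cod_word (Vert f g) = cod_word f"
| "cod_word (f \<star> g) = cod_word f @ cod_word g"

primrec well_typed :: "'k diag \<Rightarrow> bool" where
  "well_typed Zero \<longleftrightarrow> True"
| "well_typed (Add f g) \<longleftrightarrow>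
     well_typed f \<and> well_typed g \<and> dom_word f = dom_word g \<and> cod_word f = cod_word g"
| "well_typed (Scale c f) \<longleftrightarrow> well_typed f"
| "well_typed (Ident w l) \<longleftrightarrow> True"
| "well_typed (Gen g l) \<longleftrightarrow> True"
| "well_typed (Vert f g) \<longleftrightarrow> well_typed f \<and> well_typed g \<and> dom_word f = cod_word g"
| "well_typed (f \<star> g) \<longleftrightarrow> well_typed f \<and> well_typed g"

lemma word_simps [simp]:
  "dom_word 0 = []" "cod_word 0 = []" "well_typed 0"
  "dom_word (f + g) = dom_word f" "cod_word (f + g) = cod_word f"
  "well_typed (f + g) \<longleftrightarrow> well_typed f \<and> well_typed g \<and> dom_word f = dom_word g \<and> cod_word f = cod_word g"
  "dom_word (- f) = dom_word f" "cod_word (- f) = cod_word f" "well_typed (- f) \<longleftrightarrow> well_typed f"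
  "dom_word (f - g) = dom_word f" "cod_word (f - g) = cod_word f"
  "well_typed (f - g) \<longleftrightarrow> well_typed f \<and> well_typed g \<and> dom_word f = dom_word g \<and> cod_word f = cod_word g"
  "dom_word (f * g) = dom_word g" "cod_word (f * g) = cod_word f"
  "well_typed (f * g) \<longleftrightarrow> well_typed f \<and> well_typed g \<and> dom_word f = cod_word g"
  by (simp_all add: zero_diag_def plus_diag_def times_diag_def uminus_diag_def minus_diag_def)

lemma shaped_vmul: "shaped v w f \<Longrightarrow> shaped u v' g \<Longrightarrow> shaped u w (vmul f g)"
  by (force simp: shaped_def dest: vmul_nonzero)

lemma shaped_hmul: "shaped v w f \<Longrightarrow> shaped v' w' g \<Longrightarrow> shaped (v @ v') (w @ w') (hmul f g)"
  unfolding shaped_def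
  by (intro allI impI, drule hmul_nonzero) (fastforce simp: paths_def path_append endp_append)

lemma shaped_add: "shaped v w f \<Longrightarrow> shaped v w g \<Longrightarrow> shaped v w (\<lambda>S q p. f S q p + g S q p)"
  unfolding shaped_def by (metis add_cancel_right_left)

lemma shaped_scale: "shaped v w f \<Longrightarrow> shaped v w (\<lambda>S q p. c * f S q p)"
  unfolding shaped_def by (metis mult_zero_right)

lemma shaped_zero: "shaped v w (\<lambda>S q p. 0)"
  unfolding shaped_def by auto

lemma shaped_interp: "well_typed f \<Longrightarrow> shaped (dom_word f) (cod_word f) (interp f)"
proof (induction f)
  case (Ident w l) then show ?case by (auto simp: shaped_def ident_mat_def state_def paths_def)
next
  case (Gen g l) then show ?case by (auto simp: shaped_def gen_mat_def state_def)
qed (auto intro: shaped_vmul shaped_hmul shaped_add shaped_scale shaped_zero)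

lemma interp_dsum: "interp (dsum f as) S q p = (\<Sum>a\<leftarrow>as. interp (f a) S q p)"
  by (induction as) (simp_all add: dsum_def)

lemma interp_dsum2:
  "interp (dsum2 n f) S q p = (\<Sum>a<nat (n + 1). interp (f a (nat (n - int a))) S q p)"
proof -
  have "interp (dsum2 n f) S q p = (\<Sum>a\<in>{0..n}. interp (f (nat a) (nat (n - a))) S q p)"
    by (simp add: dsum2_def interp_dsum sum_set_upto_conv_sum_list_int [symmetric])
  also have "\<dots> = (\<Sum>a<nat (n + 1). interp (f a (nat (n - int a))) S q p)"
    by (rule sum.reindex_bij_witness [of _ int nat]) auto
  finally show ?thesis .
qed

lemma shaped_eqI:
  assumes "shaped v w f" "shaped v w g"
    and "\<And>S q p. \<lbrakk>S \<subseteq> \<Omega>; q \<in> paths S w; p \<in> paths S v; endp S q = endp S p\<rbrakk> \<Longrightarrow> f S q p = g S q p"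
  shows "f = g"
proof (intro ext)
  fix S q p
  show "f S q p = g S q p"
  proof (cases "S \<subseteq> \<Omega> \<and> q \<in> paths S w \<and> p \<in> paths S v \<and> endp S q = endp S p")
    case False
    then have "f S q p = 0" using assms(1) unfolding shaped_def by metis
    moreover have "g S q p = 0" using False assms(2) unfolding shaped_def by metis
    ultimately show ?thesis by simp
  qed (use assms(3) in blast)
qed

text \<open>Reduces a composite to any finite set \<open>Q\<close> that contains all contributing
  intermediate paths. In most diagrams below the labels at the top and bottom leave a single such
  path.\<close>

lemma interp_mult:
  assumes "well_typed g" "finite Q"
    and "\<And>q. \<lbrakk>q \<in> paths S (cod_word g); interp f S r q \<noteq> 0; interp g S q p \<noteq> 0\<rbrakk> \<Longrightarrow> q \<in> Q"
  shows "interp (f * g) S r p = (\<Sum>q\<in>Q. interp f S r q * interp g S q p)"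
proof -
  have fin: "finite {q. interp g S q p \<noteq> 0}"
    using finite_columns_interp [of g] by (simp add: finite_columns_def)
  have "interp (f * g) S r p = (\<Sum>q\<in>{q. interp g S q p \<noteq> 0} \<union> Q. interp f S r q * interp g S q p)"
    unfolding interp_simps by (rule vmul_eq_sum) (use assms fin in auto)
  also have "\<dots> = (\<Sum>q\<in>Q. interp f S r q * interp g S q p)"
    using assms fin shaped_interp [OF assms(1)]
    by (intro sum.mono_neutral_right) (auto simp: shaped_def)
  finally show ?thesis .
qed

lemma interp_mult_single:
  assumes "well_typed g"
    and "\<And>q. \<lbrakk>q \<in> paths S (cod_word g); interp f S r q \<noteq> 0; interp g S q p \<noteq> 0\<rbrakk> \<Longrightarrow> q = q0"
  shows "interp (f * g) S r p = interp f S r q0 * interp g S q0 p"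
  using interp_mult [of g "{q0}" S f r p] assms by auto

lemma interp_mult_single3:
  assumes "well_typed g" "cod_word g = [X, Y, Z]"
    and "\<And>x y z. \<lbrakk>interp f S r [(X, x), (Y, y), (Z, z)] \<noteq> 0; interp g S [(X, x), (Y, y), (Z, z)] p \<noteq> 0\<rbrakk>
      \<Longrightarrow> x = x0 \<and> y = y0 \<and> z = z0"
  shows "interp (f * g) S r p
    = interp f S r [(X, x0), (Y, y0), (Z, z0)] * interp g S [(X, x0), (Y, y0), (Z, z0)] p"
proof (rule interp_mult_single [OF assms(1)])
  fix q assume q: "q \<in> paths S (cod_word g)" "interp f S r q \<noteq> 0" "interp g S q p \<noteq> 0"
  from q(1) obtain x y z where "q = [(X, x), (Y, y), (Z, z)]"
    unfolding assms(2) by (auto simp: paths_def map_eq_Cons_conv)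
  with q(2-) assms(3) show "q = [(X, x0), (Y, y0), (Z, z0)]" by blast
qed

lemma interp_mult_single4:
  assumes "well_typed g" "cod_word g = [W, X, Y, Z]"
    and "\<And>w x y z. \<lbrakk>interp f S r [(W, w), (X, x), (Y, y), (Z, z)] \<noteq> 0;
      interp g S [(W, w), (X, x), (Y, y), (Z, z)] p \<noteq> 0\<rbrakk> \<Longrightarrow> w = w0 \<and> x = x0 \<and> y = y0 \<and> z = z0"
  shows "interp (f * g) S r p
    = interp f S r [(W, w0), (X, x0), (Y, y0), (Z, z0)] * interp g S [(W, w0), (X, x0), (Y, y0), (Z, z0)] p"
proof (rule interp_mult_single [OF assms(1)])
  fix q assume q: "q \<in> paths S (cod_word g)" "interp f S r q \<noteq> 0" "interp g S q p \<noteq> 0"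
  from q(1) obtain w x y z where "q = [(W, w), (X, x), (Y, y), (Z, z)]"
    unfolding assms(2) by (auto simp: paths_def map_eq_Cons_conv)
  with q(2-) assms(3) show "q = [(W, w0), (X, x0), (Y, y0), (Z, z0)]" by blast
qed

lemma interp_mult_nonzero4:
  assumes "interp (f * g) S r p \<noteq> 0" "well_typed f" "dom_word f = [W, X, Y, Z]"
  obtains w x y z where "interp f S r [(W, w), (X, x), (Y, y), (Z, z)] \<noteq> 0"
    "interp g S [(W, w), (X, x), (Y, y), (Z, z)] p \<noteq> 0"
proof -
  obtain q where q: "q \<in> paths S (dom_word f)" "interp f S r q \<noteq> 0" "interp g S q p \<noteq> 0"
    using assms(1) shaped_interp [OF assms(2)] unfolding interp_simps
    by (auto dest!: vmul_nonzero simp: shaped_def)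
  moreover from q(1) obtain w x y z where "q = [(W, w), (X, x), (Y, y), (Z, z)]"
    unfolding assms(3) by (auto simp: paths_def map_eq_Cons_conv)
  ultimately show thesis using that by blast
qed

text \<open>\<open>hmul_typed\<close> needs a fixed weight, which \<open>shaped\<close> does not
  provide. But wherever the cut has the right length, the left factor is evaluated at one set only,
  the end of the right part of \<open>p\<close>; the weight of this set can be imposed on
  \<open>f\<close> without changing the entry.\<close>

lemma interp_horiz:
  assumes "well_typed f"
  shows "interp (f \<star> g) S q p =
    interp f (endp S (drop (length (dom_word f)) p)) (take (length (cod_word f)) q) (take (length (dom_word f)) p)
      * interp g S (drop (length (cod_word f)) q) (drop (length (dom_word f)) p)"
proof -
  have 0: "interp f T a b = 0" if "length a \<noteq> length (cod_word f) \<or> length b \<noteq> length (dom_word f)" for T a b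
    using shaped_interp [OF assms] that unfolding shaped_def paths_def by (metis (mono_tags, lifting) length_map mem_Collect_eq)
  have 1: "typed (dom_word f) (cod_word f) l (\<lambda>S q p. if state l S then interp f S q p else 0)" for l
    using shaped_interp [OF assms] by (auto simp: shaped_def typed_def)
  let ?D = "drop (length (dom_word f)) p"
  define l where "l = 2 * int (card (endp S ?D)) - int (card \<Omega>)"
  have 2: "interp f T a b = (if state l T then interp f T a b else 0)" if "T = endp S ?D" for T a b
  proof (cases "interp f T a b = 0")
    case False
    then have "T \<subseteq> \<Omega>" using shaped_interp [OF assms] unfolding shaped_def by blast
    then show ?thesis using that by (simp add: state_def l_def)
  qed simp
  have 3: "interp f (endp S b2) a b1 = (if state l (endp S b2) then interp f (endp S b2) a b1 else 0)"
    if "b1 @ b2 = p" for a b1 b2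
  proof (cases "length b1 = length (dom_word f)")
    case True
    then have "b2 = ?D" using that by auto
    then show ?thesis by (intro 2) simp
  qed (use 0 in auto)
  have "interp (f \<star> g) S q p = hmul (\<lambda>S q p. if state l S then interp f S q p else 0) (interp g) S q p"
    unfolding interp.simps hmul_def
    by (intro sum.cong HOL.refl arg_cong2 [of _ _ _ _ "(*)"] 3) (auto simp: splits_def)
  then show ?thesis
    unfolding hmul_typed [OF 1] by (simp only: 2 [OF HOL.refl, symmetric])
qed

declare interp_simps(3) [simp del] interp.simps(7) [simp del]

lemma state_remove [simp]: "x \<in> S \<Longrightarrow> x \<in> \<Omega> \<Longrightarrow> state m (S - {x}) \<longleftrightarrow> state (m + 2) S"
proof -
  assume x: "x \<in> S" "x \<in> \<Omega>"
  have "S - {x} \<subseteq> \<Omega> \<longleftrightarrow> S \<subseteq> \<Omega>" using x by auto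
  moreover have "int (card (S - {x})) = int (card S) - 1" if "S \<subseteq> \<Omega>"
    using card.remove [OF finite_subset [OF that finite_\<Omega>] x(1)] by linarith
  ultimately show ?thesis by (auto simp: state_def)
qed

lemma state_insert [simp]: "x \<notin> S \<Longrightarrow> x \<in> \<Omega> \<Longrightarrow> state m (insert x S) \<longleftrightarrow> state (m - 2) S"
  using finite_\<Omega> by (auto simp: state_def finite_subset)

lemma state_subset: "state l S \<Longrightarrow> S \<subseteq> \<Omega>"
  by (simp add: state_def)

lemma state_unique: "state l S \<Longrightarrow> state m S \<longleftrightarrow> m = l"
  by (auto simp: state_def)

lemma insert1_eq [simp]: "a \<notin> S \<Longrightarrow> b \<notin> S \<Longrightarrow> insert a S = insert b S \<longleftrightarrow> a = b"
  by (auto simp: set_eq_iff)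

lemma remove1_eq [simp]: "a \<in> S \<Longrightarrow> b \<in> S \<Longrightarrow> S - {a} = S - {b} \<longleftrightarrow> a = b"
  by (auto simp: set_eq_iff)

lemma insert2_eq:
  "\<lbrakk>a \<notin> T; b \<notin> T; a \<noteq> b; a' \<notin> T; b' \<notin> T; a' \<noteq> b'\<rbrakk> \<Longrightarrow>
   insert b' (insert a' T) = insert b (insert a T) \<longleftrightarrow> (a' = a \<and> b' = b \<or> a' = b \<and> b' = a)"
  by (auto simp: set_eq_iff)

lemma remove2_eq:
  "\<lbrakk>a \<in> T; b \<in> T; a \<noteq> b; a' \<in> T; b' \<in> T; a' \<noteq> b'\<rbrakk> \<Longrightarrow>
   T - {a'} - {b'} = T - {a} - {b} \<longleftrightarrow> (a' = a \<and> b' = b \<or> a' = b \<and> b' = a)"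
  by (auto simp: set_eq_iff)

lemma gen_entries:
  "gen_mat gXi l S [(X, i')] [(Y, i)] = (if state l S \<and> X = \<E> \<and> Y = \<E> \<and> i \<in> \<Omega> - S \<and> i' = i then i else 0)"
  "gen_mat gXi' l S [(X, i')] [(Y, i)] = (if state l S \<and> X = \<F> \<and> Y = \<F> \<and> i \<in> S \<and> i' = i then i else 0)"
  "gen_mat gEta l S [(X, j), (Y, i)] [] = (if state l S \<and> X = \<F> \<and> Y = \<E> \<and> i \<in> \<Omega> - S \<and> j = i then 1 else 0)"
  "gen_mat gEps l S [] [(X, j), (Y, i)] = (if state l S \<and> X = \<F> \<and> Y = \<E> \<and> i \<in> \<Omega> - S \<and> j = i then euler S i else 0)"
  "gen_mat gEta' l S [(X, j), (Y, i)] [] = (if state l S \<and> X = \<E> \<and> Y = \<F> \<and> i \<in> S \<and> j = i then 1 / euler (S - {i}) i else 0)"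
  "gen_mat gEps' l S [] [(X, j), (Y, i)] = (if state l S \<and> X = \<E> \<and> Y = \<F> \<and> i \<in> S \<and> j = i then 1 else 0)"
  by (auto simp: gen_mat_def paths_def state_def)

lemma tau_entry:
  "gen_mat gTau l S [(X', b'), (Y', a')] [(X, b), (Y, a)] =
    (if state l S \<and> X = \<E> \<and> Y = \<E> \<and> X' = \<E> \<and> Y' = \<E> \<and> a \<in> \<Omega> - S \<and> b \<in> \<Omega> - S \<and> a \<noteq> b \<and>
        (a' = a \<and> b' = b \<or> a' = b \<and> b' = a)
     then 1 / (b - a) else 0)"
proof -
  have "insert b' (insert a' S) = insert b (insert a S) \<longleftrightarrow> (a' = a \<and> b' = b \<or> a' = b \<and> b' = a)"
    if "a \<in> \<Omega> - S \<and> b \<in> \<Omega> - insert a S \<and> a' \<in> \<Omega> - S \<and> b' \<in> \<Omega> - insert a' S"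
    using that by (intro insert2_eq) auto
  then show ?thesis by (auto simp: gen_mat_def paths_def)
qed

lemma tau'_entry:
  "gen_mat gTau' l S [(X', b'), (Y', a')] [(X, b), (Y, a)] =
    (if state l S \<and> X = \<F> \<and> Y = \<F> \<and> X' = \<F> \<and> Y' = \<F> \<and> a \<in> S \<and> b \<in> S \<and> a \<noteq> b \<and>
        (a' = a \<and> b' = b \<or> a' = b \<and> b' = a)
     then 1 / (a' - b') else 0)"
proof -
  have "S - {a'} - {b'} = S - {a} - {b} \<longleftrightarrow> (a' = a \<and> b' = b \<or> a' = b \<and> b' = a)"
    if "a \<in> S \<and> b \<in> S - {a} \<and> a' \<in> S \<and> b' \<in> S - {a'}"
    using that by (intro remove2_eq) auto
  then show ?thesis by (auto simp: gen_mat_def paths_def)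
qed

lemmas entries = gen_entries tau_entry tau'_entry ident_mat_def

lemma \<xi>pow_words [simp]: "dom_word (\<xi>pow l n) = [\<E>]" "cod_word (\<xi>pow l n) = [\<E>]" "well_typed (\<xi>pow l n)"
  by (induction n) auto

lemma mem_paths_Cons: "q \<in> paths S (X # w) \<longleftrightarrow> (\<exists>x p. q = (X, x) # p \<and> p \<in> paths S w \<and> x \<in> avail X (endp S p))"
  by (auto simp: paths_Cons)

lemma \<xi>pow_entry:
  "interp (\<xi>pow l n) S [(X, i')] [(Y, i)]
    = (if state l S \<and> X = \<E> \<and> Y = \<E> \<and> i \<in> \<Omega> - S \<and> i' = i then i ^ n else 0)"
proof (induction n arbitrary: X i')
  case (Suc n)
  have "interp (\<xi>pow l (Suc n)) S [(X, i')] [(Y, i)]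
      = interp (\<xi> l) S [(X, i')] [(\<E>, i)] * interp (\<xi>pow l n) S [(\<E>, i)] [(Y, i)]"
    unfolding \<xi>pow.simps
    by (rule interp_mult_single) (auto simp: mem_paths_Cons Suc split: if_splits)
  then show ?case by (simp add: Suc entries)
qed (auto simp: entries)

lemma euler_nonzero: "S \<subseteq> \<Omega> \<Longrightarrow> x \<notin> S \<Longrightarrow> euler S x \<noteq> 0"
  using finite_\<Omega> finite_subset [of S \<Omega>] by (auto simp: euler_def)

lemma \<sigma>_words [simp]: "dom_word (\<sigma> l) = [\<E>, \<F>]" "cod_word (\<sigma> l) = [\<F>, \<E>]" "well_typed (\<sigma> l)"
  by (simp_all add: \<sigma>_def)

lemma \<sigma>'_words [simp]: "dom_word (\<sigma>' l) = [\<F>, \<E>]" "cod_word (\<sigma>' l) = [\<E>, \<F>]" "well_typed (\<sigma>' l)"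
  by (simp_all add: \<sigma>'_def)

lemma nonzero_entries:
  "ident_mat w l S q p \<noteq> 0 \<Longrightarrow> q = p"
  "gen_mat gXi l S [(X, i')] [(Y, i)] \<noteq> 0 \<Longrightarrow> i' = i"
  "gen_mat gXi' l S [(X, i')] [(Y, i)] \<noteq> 0 \<Longrightarrow> i' = i"
  "gen_mat gEta l S [(X, j), (Y, i)] [] \<noteq> 0 \<Longrightarrow> j = i"
  "gen_mat gEps l S [] [(X, j), (Y, i)] \<noteq> 0 \<Longrightarrow> j = i"
  "gen_mat gEta' l S [(X, j), (Y, i)] [] \<noteq> 0 \<Longrightarrow> j = i"
  "gen_mat gEps' l S [] [(X, j), (Y, i)] \<noteq> 0 \<Longrightarrow> j = i"
  "gen_mat gTau l S [(X', b'), (Y', a')] [(X, b), (Y, a)] \<noteq> 0 \<Longrightarrow> a' = a \<and> b' = b \<or> a' = b \<and> b' = a"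
  "gen_mat gTau' l S [(X', b'), (Y', a')] [(X, b), (Y, a)] \<noteq> 0 \<Longrightarrow> a' = a \<and> b' = b \<or> a' = b \<and> b' = a"
  "interp (\<xi>pow l n) S [(X, i')] [(Y, i)] \<noteq> 0 \<Longrightarrow> i' = i"
  by (auto simp: gen_entries tau_entry tau'_entry ident_mat_def \<xi>pow_entry split: if_splits)

text \<open>The cup creates a pair labelled \<open>d\<close>, and the cap removes a pair labelled
  \<open>i\<close>. So the path below the crossing has labels \<open>d, d, j, i\<close> and the one
  above it \<open>d, c, i, i\<close>: the crossing either keeps or exchanges \<open>d\<close> and
  \<open>j\<close>, with the value \<open>1 / (d - j)\<close> in both cases.\<close>

lemma \<sigma>_entry:
  assumes "S \<subseteq> \<Omega>" "i \<in> S" "j \<in> \<Omega>" "j \<in> S \<Longrightarrow> j = i" "c \<in> \<Omega> - S" "d \<in> insert c S"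
  shows "interp (\<sigma> l) S [(\<F>, d), (\<E>, c)] [(\<E>, j), (\<F>, i)]
    = (if state l S \<and> (j = i \<and> d = c \<or> j = c \<and> d = i) then 1 / (d - j) else 0)"
proof -
  let ?A = "Ident [\<F>, \<E>] l \<star> \<epsilon>' l"
    and ?T = "Ident [\<F>] (l + 2) \<star> \<tau> (l - 2) \<star> Ident [\<F>] l"
    and ?B = "\<eta> l \<star> Ident [\<E>, \<F>] l"
  have "interp (\<sigma> l) S [(\<F>, d), (\<E>, c)] [(\<E>, j), (\<F>, i)]
    = interp (?A * ?T) S
        [(\<F>, d), (\<E>, c)] [(\<F>, d), (\<E>, d), (\<E>, j), (\<F>, i)]
      * interp ?B S [(\<F>, d), (\<E>, d), (\<E>, j), (\<F>, i)] [(\<E>, j), (\<F>, i)]"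
    unfolding \<sigma>_def
    by (rule interp_mult_single4) (auto elim!: interp_mult_nonzero4 simp: interp_horiz dest!: nonzero_entries)
  also have "interp (?A * ?T) S
        [(\<F>, d), (\<E>, c)] [(\<F>, d), (\<E>, d), (\<E>, j), (\<F>, i)]
    = interp ?A S [(\<F>, d), (\<E>, c)] [(\<F>, d), (\<E>, c), (\<E>, i), (\<F>, i)]
      * interp ?T S
          [(\<F>, d), (\<E>, c), (\<E>, i), (\<F>, i)] [(\<F>, d), (\<E>, d), (\<E>, j), (\<F>, i)]"
    by (rule interp_mult_single4) (auto simp: interp_horiz dest!: nonzero_entries)
  also note * = calculation
  have i: "insert i S = S" "i \<in> \<Omega>" "c \<noteq> i" "i \<noteq> c" using assms by auto
  consider "j = i" "d = c" | "j = c" "d = i" | "\<not> (j = i \<and> d = c \<or> j = c \<and> d = i)" by blast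
  then show ?thesis
  proof cases
    case 1
    have "interp ?A S [(\<F>, c), (\<E>, c)] [(\<F>, c), (\<E>, c), (\<E>, i), (\<F>, i)]
        = (if state l S then 1 else 0)"
      using assms(1,2,5) i by (simp add: interp_horiz entries)
    moreover have "interp ?T S
          [(\<F>, c), (\<E>, c), (\<E>, i), (\<F>, i)] [(\<F>, c), (\<E>, c), (\<E>, i), (\<F>, i)]
        = (if state l S then 1 / (c - i) else 0)"
      using assms(1,2,5) i by (simp add: interp_horiz entries)
    moreover have "interp ?B S [(\<F>, c), (\<E>, c), (\<E>, i), (\<F>, i)] [(\<E>, i), (\<F>, i)]
        = (if state l S then 1 else 0)"
      using assms(1,2,5) i by (simp add: interp_horiz entries)
    ultimately show ?thesis using * 1 by simp
  next
    case 2
    have "interp ?A S [(\<F>, i), (\<E>, c)] [(\<F>, i), (\<E>, c), (\<E>, i), (\<F>, i)]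
        = (if state l S then 1 else 0)"
      using assms(1,2,5) i by (simp add: interp_horiz entries)
    moreover have "interp ?T S
          [(\<F>, i), (\<E>, c), (\<E>, i), (\<F>, i)] [(\<F>, i), (\<E>, i), (\<E>, c), (\<F>, i)]
        = (if state l S then 1 / (i - c) else 0)"
      using assms(1,2,5) i by (simp add: interp_horiz entries)
    moreover have "interp ?B S [(\<F>, i), (\<E>, i), (\<E>, c), (\<F>, i)] [(\<E>, c), (\<F>, i)]
        = (if state l S then 1 else 0)"
      using assms(1,2,5) i by (simp add: interp_horiz entries)
    ultimately show ?thesis using * 2 by simp
  next
    case 3
    have "interp ?T S
          [(\<F>, d), (\<E>, c), (\<E>, i), (\<F>, i)] [(\<F>, d), (\<E>, d), (\<E>, j), (\<F>, i)] = 0"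
      using 3 by (auto simp: interp_horiz entries)
    then show ?thesis using 3 unfolding * by auto
  qed
qed

text \<open>The intermediate paths are again forced. The cap now contributes an Euler factor at the
  set \<open>insert j (S - {i})\<close> reached by the target path, and the cup an inverse one at
  \<open>S\<close>.\<close>

lemma \<sigma>'_entry:
  assumes "S \<subseteq> \<Omega>" "b \<in> \<Omega> - S" "d \<in> insert b S" "i \<in> S" "j \<in> \<Omega>" "j \<in> S \<Longrightarrow> j = i"
  shows "interp (\<sigma>' l) S [(\<E>, j), (\<F>, i)] [(\<F>, d), (\<E>, b)]
    = (if state l S \<and> (d = b \<and> j = i \<or> d = i \<and> j = b)
       then euler (insert j (S - {i})) d / (euler (S - {i}) i * (b - i)) else 0)"
proof -
  let ?A = "\<epsilon> l \<star> Ident [\<E>, \<F>] l"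
    and ?T = "Ident [\<F>] (l + 2) \<star> \<tau> (l - 2) \<star> Ident [\<F>] l"
    and ?B = "Ident [\<F>, \<E>] l \<star> \<eta>' l"
  have "interp (\<sigma>' l) S [(\<E>, j), (\<F>, i)] [(\<F>, d), (\<E>, b)]
    = interp (?A * ?T) S
        [(\<E>, j), (\<F>, i)] [(\<F>, d), (\<E>, b), (\<E>, i), (\<F>, i)]
      * interp ?B S [(\<F>, d), (\<E>, b), (\<E>, i), (\<F>, i)] [(\<F>, d), (\<E>, b)]"
    unfolding \<sigma>'_def
    by (rule interp_mult_single4) (auto elim!: interp_mult_nonzero4 simp: interp_horiz dest!: nonzero_entries)
  also have "interp (?A * ?T) S
        [(\<E>, j), (\<F>, i)] [(\<F>, d), (\<E>, b), (\<E>, i), (\<F>, i)]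
    = interp ?A S [(\<E>, j), (\<F>, i)] [(\<F>, d), (\<E>, d), (\<E>, j), (\<F>, i)]
      * interp ?T S
          [(\<F>, d), (\<E>, d), (\<E>, j), (\<F>, i)] [(\<F>, d), (\<E>, b), (\<E>, i), (\<F>, i)]"
    by (rule interp_mult_single4) (auto simp: interp_horiz dest!: nonzero_entries)
  also note * = calculation
  have i: "insert i S = S" "i \<in> \<Omega>" "b \<noteq> i" "i \<noteq> b" using assms by auto
  consider "d = b" "j = i" | "d = i" "j = b" | "\<not> (d = b \<and> j = i \<or> d = i \<and> j = b)" by blast
  then show ?thesis
  proof cases
    case 1
    have "interp ?A S [(\<E>, i), (\<F>, i)] [(\<F>, b), (\<E>, b), (\<E>, i), (\<F>, i)]
        = (if state l S then euler S b else 0)"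
      using assms(1,2,4) i by (simp add: interp_horiz entries)
    moreover have "interp ?T S
          [(\<F>, b), (\<E>, b), (\<E>, i), (\<F>, i)] [(\<F>, b), (\<E>, b), (\<E>, i), (\<F>, i)]
        = (if state l S then 1 / (b - i) else 0)"
      using assms(1,2,4) i by (simp add: interp_horiz entries)
    moreover have "interp ?B S [(\<F>, b), (\<E>, b), (\<E>, i), (\<F>, i)] [(\<F>, b), (\<E>, b)]
        = (if state l S then 1 / euler (S - {i}) i else 0)"
      using assms(1,2,4) i by (simp add: interp_horiz entries)
    ultimately show ?thesis using * 1 i(1) by simp
  next
    case 2
    have "interp ?A S [(\<E>, b), (\<F>, i)] [(\<F>, i), (\<E>, i), (\<E>, b), (\<F>, i)]
        = (if state l S then euler (insert b (S - {i})) i else 0)"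
      using assms(1,2,4) i by (simp add: interp_horiz entries)
    moreover have "interp ?T S
          [(\<F>, i), (\<E>, i), (\<E>, b), (\<F>, i)] [(\<F>, i), (\<E>, b), (\<E>, i), (\<F>, i)]
        = (if state l S then 1 / (b - i) else 0)"
      using assms(1,2,4) i by (simp add: interp_horiz entries)
    moreover have "interp ?B S [(\<F>, i), (\<E>, b), (\<E>, i), (\<F>, i)] [(\<F>, i), (\<E>, b)]
        = (if state l S then 1 / euler (S - {i}) i else 0)"
      using assms(1,2,4) i by (simp add: interp_horiz entries)
    ultimately show ?thesis using * 2 by simp
  next
    case 3
    have "interp ?T S
          [(\<F>, d), (\<E>, d), (\<E>, j), (\<F>, i)] [(\<F>, d), (\<E>, b), (\<E>, i), (\<F>, i)] = 0"
      using 3 by (auto simp: interp_horiz entries)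
    then show ?thesis using 3 unfolding * by auto
  qed
qed

section \<open>Biadjunction and cyclicity\<close>

lemma interp_zigzag_E1:
  "interp ((\<epsilon>' (l + 2) \<star> Ident [\<E>] l) * (Ident [\<E>] l \<star> \<eta> l)) = interp (Ident [\<E>] l)" (is "interp (?f * ?g) = interp ?h")
proof (rule shaped_eqI [of "[\<E>]" "[\<E>]"])
  fix S q p
  assume S: "S \<subseteq> \<Omega>" "q \<in> paths S [\<E>]" "p \<in> paths S [\<E>]" "endp S q = endp S p"
  then obtain i where qp: "q = [(\<E>, i)]" "p = [(\<E>, i)]" "i \<in> \<Omega>" "i \<notin> S"
    by (auto simp: mem_paths_Cons)
  have "interp (?f * ?g) S q p = interp ?f S q [(\<E>, i), (\<F>, i), (\<E>, i)]
       * interp ?g S [(\<E>, i), (\<F>, i), (\<E>, i)] p"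
    by (rule interp_mult_single3) (auto simp: qp interp_horiz dest!: nonzero_entries)
  moreover have "interp ?f S q [(\<E>, i), (\<F>, i), (\<E>, i)] = (if state l S then 1 else 0)"
    using S(1) qp by (simp add: interp_horiz entries)
  moreover have "interp ?g S [(\<E>, i), (\<F>, i), (\<E>, i)] p = (if state l S then 1 else 0)"
    using S(1) qp by (simp add: interp_horiz entries)
  ultimately show "interp (?f * ?g) S q p = interp ?h S q p"
    using qp by (simp add: ident_mat_def)
qed (use shaped_interp [of "?f * ?g"] shaped_interp [of ?h] in simp_all)

text \<open>The weights of \<open>\<eta>'\<close> and \<open>\<epsilon>\<close> refer to the same
  set and the same label, so they cancel.\<close>

lemma interp_zigzag_E2:
  "interp ((Ident [\<E>] l \<star> \<epsilon> l) * (\<eta>' (l + 2) \<star> Ident [\<E>] l)) = interp (Ident [\<E>] l)" (is "interp (?f * ?g) = interp ?h")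
proof (rule shaped_eqI [of "[\<E>]" "[\<E>]"])
  fix S q p
  assume S: "S \<subseteq> \<Omega>" "q \<in> paths S [\<E>]" "p \<in> paths S [\<E>]" "endp S q = endp S p"
  then obtain i where qp: "q = [(\<E>, i)]" "p = [(\<E>, i)]" "i \<in> \<Omega>" "i \<notin> S"
    by (auto simp: mem_paths_Cons)
  have "interp (?f * ?g) S q p = interp ?f S q [(\<E>, i), (\<F>, i), (\<E>, i)]
       * interp ?g S [(\<E>, i), (\<F>, i), (\<E>, i)] p"
    by (rule interp_mult_single3) (auto simp: qp interp_horiz dest!: nonzero_entries)
  moreover have "interp ?f S q [(\<E>, i), (\<F>, i), (\<E>, i)] = (if state l S then euler S i else 0)"
    using S(1) qp by (simp add: interp_horiz entries)
  moreover have "interp ?g S [(\<E>, i), (\<F>, i), (\<E>, i)] p = (if state l S then 1 / euler S i else 0)"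
    using S(1) qp by (simp add: interp_horiz entries)
  ultimately show "interp (?f * ?g) S q p = interp ?h S q p"
    using qp S(1) by (simp add: ident_mat_def euler_nonzero)
qed (use shaped_interp [of "?f * ?g"] shaped_interp [of ?h] in simp_all)

lemma interp_zigzag_F1:
  "interp ((\<epsilon> (l - 2) \<star> Ident [\<F>] l) * (Ident [\<F>] l \<star> \<eta>' l)) = interp (Ident [\<F>] l)" (is "interp (?f * ?g) = interp ?h")
proof (rule shaped_eqI [of "[\<F>]" "[\<F>]"])
  fix S q p
  assume S: "S \<subseteq> \<Omega>" "q \<in> paths S [\<F>]" "p \<in> paths S [\<F>]" "endp S q = endp S p"
  then obtain i where qp: "q = [(\<F>, i)]" "p = [(\<F>, i)]" "i \<in> \<Omega>" "i \<in> S"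
    by (auto simp: mem_paths_Cons)
  have "interp (?f * ?g) S q p = interp ?f S q [(\<F>, i), (\<E>, i), (\<F>, i)]
       * interp ?g S [(\<F>, i), (\<E>, i), (\<F>, i)] p"
    by (rule interp_mult_single3) (auto simp: qp interp_horiz dest!: nonzero_entries)
  moreover have "interp ?f S q [(\<F>, i), (\<E>, i), (\<F>, i)] = (if state l S then euler (S - {i}) i else 0)"
    using S(1) qp by (simp add: interp_horiz entries)
  moreover have "interp ?g S [(\<F>, i), (\<E>, i), (\<F>, i)] p = (if state l S then 1 / euler (S - {i}) i else 0)"
    using S(1) qp by (simp add: interp_horiz entries)
  moreover have "euler (S - {i}) i \<noteq> 0" using S(1) by (intro euler_nonzero) auto
  ultimately show "interp (?f * ?g) S q p = interp ?h S q p"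
    using qp S(1) by (simp add: ident_mat_def)
qed (use shaped_interp [of "?f * ?g"] shaped_interp [of ?h] in simp_all)

lemma interp_zigzag_F2:
  "interp ((Ident [\<F>] l \<star> \<epsilon>' l) * (\<eta> (l - 2) \<star> Ident [\<F>] l)) = interp (Ident [\<F>] l)" (is "interp (?f * ?g) = interp ?h")
proof (rule shaped_eqI [of "[\<F>]" "[\<F>]"])
  fix S q p
  assume S: "S \<subseteq> \<Omega>" "q \<in> paths S [\<F>]" "p \<in> paths S [\<F>]" "endp S q = endp S p"
  then obtain i where qp: "q = [(\<F>, i)]" "p = [(\<F>, i)]" "i \<in> \<Omega>" "i \<in> S"
    by (auto simp: mem_paths_Cons)
  have "interp (?f * ?g) S q p = interp ?f S q [(\<F>, i), (\<E>, i), (\<F>, i)]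
       * interp ?g S [(\<F>, i), (\<E>, i), (\<F>, i)] p"
    by (rule interp_mult_single3) (auto simp: qp interp_horiz dest!: nonzero_entries)
  moreover have "interp ?f S q [(\<F>, i), (\<E>, i), (\<F>, i)] = (if state l S then 1 else 0)"
    using S(1) qp by (simp add: interp_horiz entries insert_absorb)
  moreover have "interp ?g S [(\<F>, i), (\<E>, i), (\<F>, i)] p = (if state l S then 1 else 0)"
    using S(1) qp by (simp add: interp_horiz entries insert_absorb)
  ultimately show "interp (?f * ?g) S q p = interp ?h S q p"
    using qp S(1) by (simp add: ident_mat_def insert_absorb)
qed (use shaped_interp [of "?f * ?g"] shaped_interp [of ?h] in simp_all)

lemma interp_mult_single2:
  assumes "well_typed g" "cod_word g = [X, Y]"
    and "\<And>x y. \<lbrakk>interp f S r [(X, x), (Y, y)] \<noteq> 0; interp g S [(X, x), (Y, y)] p \<noteq> 0\<rbrakk> \<Longrightarrow> x = x0 \<and> y = y0"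
  shows "interp (f * g) S r p = interp f S r [(X, x0), (Y, y0)] * interp g S [(X, x0), (Y, y0)] p"
proof (rule interp_mult_single [OF assms(1)])
  fix q assume q: "q \<in> paths S (cod_word g)" "interp f S r q \<noteq> 0" "interp g S q p \<noteq> 0"
  from q(1) obtain x y where "q = [(X, x), (Y, y)]"
    unfolding assms(2) by (auto simp: paths_def map_eq_Cons_conv)
  with q(2-) assms(3) show "q = [(X, x0), (Y, y0)]" by blast
qed

lemma interp_cyc_dot1:
  "interp (\<epsilon>' l * (\<xi> (l - 2) \<star> Ident [\<F>] l)) = interp (\<epsilon>' l * (Ident [\<E>] (l - 2) \<star> \<xi>' l))" (is "interp ?f = interp ?g")
proof (rule shaped_eqI [of "[\<E>, \<F>]" "[]"])
  fix S q p
  assume S: "S \<subseteq> \<Omega>" "q \<in> paths S []" "p \<in> paths S [\<E>, \<F>]" "endp S q = endp S p"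
  then obtain i where qp: "q = []" "p = [(\<E>, i), (\<F>, i)]" "i \<in> \<Omega>" "i \<in> S"
    by (auto simp: mem_paths_Cons)
  have "interp ?f S q p = interp (\<epsilon>' l) S q p * interp (\<xi> (l - 2) \<star> Ident [\<F>] l) S p p"
    "interp ?g S q p = interp (\<epsilon>' l) S q p * interp (Ident [\<E>] (l - 2) \<star> \<xi>' l) S p p"
    unfolding qp by (rule interp_mult_single2; auto simp: interp_horiz dest!: nonzero_entries)+
  moreover have "interp (\<xi> (l - 2) \<star> Ident [\<F>] l) S p p = interp (Ident [\<E>] (l - 2) \<star> \<xi>' l) S p p"
    using qp S(1) by (simp add: interp_horiz entries)
  ultimately show "interp ?f S q p = interp ?g S q p" by simp
qed (use shaped_interp [of ?f] shaped_interp [of ?g] in simp_all)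

lemma interp_cyc_dot2:
  "interp (\<epsilon> l * (\<xi>' (l + 2) \<star> Ident [\<E>] l)) = interp (\<epsilon> l * (Ident [\<F>] (l + 2) \<star> \<xi> l))" (is "interp ?f = interp ?g")
proof (rule shaped_eqI [of "[\<F>, \<E>]" "[]"])
  fix S q p
  assume S: "S \<subseteq> \<Omega>" "q \<in> paths S []" "p \<in> paths S [\<F>, \<E>]" "endp S q = endp S p"
  then obtain x y where qp: "q = []" "p = [(\<F>, x), (\<E>, y)]" "y \<in> \<Omega>" "y \<notin> S" "x = y \<or> x \<in> S" "S = insert y S - {x}"
    by (auto simp: mem_paths_Cons)
  then have "p = [(\<F>, y), (\<E>, y)]" by auto
  note qp = qp(1) this qp(3,4)
  have "interp ?f S q p = interp (\<epsilon> l) S q p * interp (\<xi>' (l + 2) \<star> Ident [\<E>] l) S p p"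
    "interp ?g S q p = interp (\<epsilon> l) S q p * interp (Ident [\<F>] (l + 2) \<star> \<xi> l) S p p"
    unfolding qp by (rule interp_mult_single2; auto simp: interp_horiz dest!: nonzero_entries)+
  moreover have "interp (\<xi>' (l + 2) \<star> Ident [\<E>] l) S p p = interp (Ident [\<F>] (l + 2) \<star> \<xi> l) S p p"
    using qp S(1) by (simp add: interp_horiz entries)
  ultimately show "interp ?f S q p = interp ?g S q p" by simp
qed (use shaped_interp [of ?f] shaped_interp [of ?g] in simp_all)

text \<open>The weight at the far right is determined by the lower factor of a vertical composite
  and by the right factor of a horizontal one, so the other factor need not be inspected.\<close>

primrec weighted :: "int \<Rightarrow> 'k diag \<Rightarrow> bool" where
  "weighted l Zero \<longleftrightarrow> True"
| "weighted l (Add f g) \<longleftrightarrow> weighted l f \<and> weighted l g"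
| "weighted l (Scale c f) \<longleftrightarrow> weighted l f"
| "weighted l (Ident w m) \<longleftrightarrow> m = l"
| "weighted l (Gen g m) \<longleftrightarrow> m = l"
| "weighted l (Vert f g) \<longleftrightarrow> weighted l g"
| "weighted l (f \<star> g) \<longleftrightarrow> weighted l g"

lemma weighted_simps [simp]:
  "weighted l 0"
  "weighted l (f + g) \<longleftrightarrow> weighted l f \<and> weighted l g"
  "weighted l (- f) \<longleftrightarrow> weighted l f"
  "weighted l (f - g) \<longleftrightarrow> weighted l f \<and> weighted l g"
  "weighted l (f * g) \<longleftrightarrow> weighted l g"
  by (simp_all add: zero_diag_def plus_diag_def times_diag_def uminus_diag_def minus_diag_def)

lemma weighted_interp: "weighted l f \<Longrightarrow> interp f S q p \<noteq> 0 \<Longrightarrow> state l S"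
proof (induction f arbitrary: q p)
  case (Add f g) then show ?case by (metis add_0 interp.simps(2) weighted.simps(2))
next
  case (Ident w m) then show ?case by (auto simp: ident_mat_def split: if_splits)
next
  case (Gen g m) then show ?case by (auto simp: gen_mat_def split: if_splits)
next
  case (Vert f g) then show ?case by (auto dest!: vmul_nonzero)
next
  case (Horiz f g) then show ?case unfolding interp.simps by (auto dest!: hmul_nonzero)
qed auto

lemma typed_interp: "well_typed f \<Longrightarrow> weighted l f \<Longrightarrow> typed (dom_word f) (cod_word f) l (interp f)"
  using shaped_interp [of f] weighted_interp [of l f] unfolding shaped_def typed_def by blast

lemma typed_eqI:
  assumes "typed v w l f" "typed v w l g"
    and "\<And>S q p. \<lbrakk>state l S; S \<subseteq> \<Omega>; q \<in> paths S w; p \<in> paths S v; endp S q = endp S p\<rbrakk> \<Longrightarrow> f S q p = g S q p"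
  shows "f = g"
proof (intro ext)
  fix S q p
  show "f S q p = g S q p"
  proof (cases "state l S \<and> q \<in> paths S w \<and> p \<in> paths S v \<and> endp S q = endp S p")
    case False
    then have "f S q p = 0" using assms(1) unfolding typed_def by metis
    moreover have "g S q p = 0" using False assms(2) unfolding typed_def by metis
    ultimately show ?thesis by simp
  qed (use assms(3) state_subset in blast)
qed

lemma interp_eqI:
  assumes "well_typed f" "weighted l f" "well_typed g" "weighted l g" "dom_word g = dom_word f" "cod_word g = cod_word f"
    and "\<And>S q p. \<lbrakk>state l S; S \<subseteq> \<Omega>; q \<in> paths S (cod_word f); p \<in> paths S (dom_word f); endp S q = endp S p\<rbrakk>
      \<Longrightarrow> interp f S q p = interp g S q p"
  shows "interp f = interp g"
  using typed_interp [OF assms(1,2)] typed_interp [OF assms(3,4)] assms(5-)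
  by (intro typed_eqI [of "dom_word f" "cod_word f" l]) auto

text \<open>Moving \<open>a\<close> into the set takes the factor \<open>x - a\<close> out of the
  denominator and puts another one into the numerator; hence the square.\<close>

lemma euler_insert:
  assumes "a \<in> \<Omega> - S" "x \<noteq> a" "S \<subseteq> \<Omega>"
  shows "euler (insert a S) x = euler S x * (x - a)\<^sup>2"
proof -
  have fin: "finite S" "finite (\<Omega> - S - {x} - {a})" using assms finite_\<Omega> by (auto intro: finite_subset)
  have num: "(\<Prod>s\<in>insert a S. x - s) = (x - a) * (\<Prod>s\<in>S. x - s)"
    using assms fin by simp
  have den: "(\<Prod>r\<in>\<Omega> - S - {x}. x - r) = (x - a) * (\<Prod>r\<in>\<Omega> - S - {x} - {a}. x - r)"
    using assms finite_\<Omega> by (intro prod.remove) auto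
  have eq: "\<Omega> - insert a S - {x} = \<Omega> - S - {x} - {a}" by auto
  have "(\<Prod>r\<in>\<Omega> - S - {x} - {a}. x - r) \<noteq> 0" using fin by auto
  then show ?thesis
    using assms unfolding euler_def num den eq by (simp add: divide_simps power2_eq_square)
qed

text \<open>The squares \<open>(a - b)\<^sup>2\<close> and \<open>(b - a)\<^sup>2\<close> agree.
  This symmetry lets one matrix \<open>\<tau>'\<close> be the mate of \<open>\<tau>\<close> under
  both adjunctions.\<close>

lemma euler_swap:
  assumes "a \<in> \<Omega> - S" "b \<in> \<Omega> - S" "a \<noteq> b" "S \<subseteq> \<Omega>"
  shows "euler S a * euler (insert a S) b = euler S b * euler (insert b S) a"
proof -
  have "(b - a)\<^sup>2 = (a - b)\<^sup>2" by (rule power2_commute)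
  then show ?thesis
    using assms by (simp add: euler_insert)
qed

lemma \<epsilon>'\<^sub>2_words [simp]: "dom_word (\<epsilon>'\<^sub>2 l) = [\<E>, \<E>, \<F>, \<F>]" "cod_word (\<epsilon>'\<^sub>2 l) = []" "well_typed (\<epsilon>'\<^sub>2 l)"
  by (simp_all add: \<epsilon>'\<^sub>2_def)

lemma \<epsilon>\<^sub>2_words [simp]: "dom_word (\<epsilon>\<^sub>2 l) = [\<F>, \<F>, \<E>, \<E>]" "cod_word (\<epsilon>\<^sub>2 l) = []" "well_typed (\<epsilon>\<^sub>2 l)"
  by (simp_all add: \<epsilon>\<^sub>2_def)

lemma \<epsilon>'\<^sub>2_factor:
  "interp (\<epsilon>'\<^sub>2 l) S [] [(\<E>, b), (\<E>, a), (\<F>, j), (\<F>, i)] =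
     interp (\<epsilon>' l) S [] [(\<E>, b), (\<F>, i)] *
     interp (Ident [\<E>] (l - 2) \<star> \<epsilon>' (l - 2) \<star> Ident [\<F>] l) S [(\<E>, b), (\<F>, i)] [(\<E>, b), (\<E>, a), (\<F>, j), (\<F>, i)]"
  unfolding \<epsilon>'\<^sub>2_def
  by (rule interp_mult_single2) (auto simp: interp_horiz dest!: nonzero_entries)

lemma \<epsilon>\<^sub>2_factor:
  "interp (\<epsilon>\<^sub>2 l) S [] [(\<F>, d), (\<F>, c), (\<E>, b), (\<E>, a)] =
     interp (\<epsilon> l) S [] [(\<F>, d), (\<E>, a)] *
     interp (Ident [\<F>] (l + 2) \<star> \<epsilon> (l + 2) \<star> Ident [\<E>] l) S [(\<F>, d), (\<E>, a)] [(\<F>, d), (\<F>, c), (\<E>, b), (\<E>, a)]"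
  unfolding \<epsilon>\<^sub>2_def
  by (rule interp_mult_single2) (auto simp: interp_horiz dest!: nonzero_entries)

lemma \<epsilon>\<^sub>2_nonzero:
  "interp (\<epsilon>'\<^sub>2 l) S [] [(\<E>, b), (\<E>, a), (\<F>, j), (\<F>, i)] \<noteq> 0 \<Longrightarrow> b = i \<and> a = j"
  "interp (\<epsilon>\<^sub>2 l) S [] [(\<F>, d), (\<F>, c), (\<E>, b), (\<E>, a)] \<noteq> 0 \<Longrightarrow> d = a \<and> c = b"
  unfolding \<epsilon>'\<^sub>2_factor \<epsilon>\<^sub>2_factor by (auto simp: interp_horiz dest!: nonzero_entries)

lemma \<epsilon>'\<^sub>2_entry:
  assumes "state l S" "i \<in> S" "j \<in> S" "i \<noteq> j"
  shows "interp (\<epsilon>'\<^sub>2 l) S [] [(\<E>, b), (\<E>, a), (\<F>, j), (\<F>, i)] = (if b = i \<and> a = j then 1 else 0)"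
proof -
  have "i \<in> \<Omega>" "j \<in> \<Omega>" using assms state_subset by auto
  have "interp (\<epsilon>' l) S [] [(\<E>, b), (\<F>, i)] = (if b = i then 1 else 0)"
    using assms by (simp add: entries)
  moreover have "interp (Ident [\<E>] (l - 2) \<star> \<epsilon>' (l - 2) \<star> Ident [\<F>] l) S [(\<E>, i), (\<F>, i)] [(\<E>, i), (\<E>, a), (\<F>, j), (\<F>, i)]
      = (if a = j then 1 else 0)"
    using assms \<open>i \<in> \<Omega>\<close> \<open>j \<in> \<Omega>\<close> by (simp add: interp_horiz entries insert_absorb)
  ultimately show ?thesis unfolding \<epsilon>'\<^sub>2_factor by (cases "b = i") simp_all
qed

lemma \<epsilon>\<^sub>2_entry:
  assumes "state l S" "a \<in> \<Omega> - S" "b \<in> \<Omega> - S" "a \<noteq> b"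
  shows "interp (\<epsilon>\<^sub>2 l) S [] [(\<F>, d), (\<F>, c), (\<E>, b), (\<E>, a)]
    = (if d = a \<and> c = b then euler S a * euler (insert a S) b else 0)"
proof -
  have "interp (\<epsilon> l) S [] [(\<F>, d), (\<E>, a)] = (if d = a then euler S a else 0)"
    using assms by (simp add: entries)
  moreover have "interp (Ident [\<F>] (l + 2) \<star> \<epsilon> (l + 2) \<star> Ident [\<E>] l) S [(\<F>, a), (\<E>, a)] [(\<F>, a), (\<F>, c), (\<E>, b), (\<E>, a)]
      = (if c = b then euler (insert a S) b else 0)"
    using assms by (auto simp: interp_horiz entries)
  ultimately show ?thesis unfolding \<epsilon>\<^sub>2_factor by (cases "d = a") simp_all
qed

lemma paths_EE: "p \<in> paths S [\<E>, \<E>] \<longleftrightarrow> (\<exists>b a. p = [(\<E>, b), (\<E>, a)] \<and> a \<in> \<Omega> \<and> a \<notin> S \<and> b \<in> \<Omega> \<and> b \<notin> S \<and> a \<noteq> b)"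
  by (auto simp: mem_paths_Cons)

text \<open>\<open>\<epsilon>'\<^sub>2\<close> is nonzero only on nested pairs, which forces the
  intermediate path on each side and leaves a single entry of \<open>\<tau>\<close> or
  \<open>\<tau>'\<close>. This comparison explains why the value of \<open>\<tau>'\<close> depends
  on the labels of its target.\<close>

lemma cyc_cross1_sound:
  "interp (\<epsilon>'\<^sub>2 l * (\<tau> (l - 4) \<star> Ident [\<F>, \<F>] l)) = interp (\<epsilon>'\<^sub>2 l * (Ident [\<E>, \<E>] (l - 4) \<star> \<tau>' l))" (is "interp ?f = interp ?g")
proof (rule interp_eqI)
  fix S q p
  assume S: "state l S" "S \<subseteq> \<Omega>" "q \<in> paths S (cod_word ?f)" "p \<in> paths S (dom_word ?f)" "endp S q = endp S p"
  then obtain a b i j where qp: "q = []" "p = [(\<E>, b), (\<E>, a), (\<F>, j), (\<F>, i)]" "i \<in> S" "j \<in> S" "i \<noteq> j" "a \<noteq> b"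
    and ab: "a \<in> \<Omega> - (S - {i} - {j})" "b \<in> \<Omega> - (S - {i} - {j})" and ends: "S = insert b (insert a (S - {i} - {j}))"
    by (auto simp: mem_paths_Cons)
  have "insert b (insert a (S - {i} - {j})) = insert i (insert j (S - {i} - {j}))"
    using ends qp by auto
  then have ab': "a = j \<and> b = i \<or> a = i \<and> b = j"
    using qp ab by (subst (asm) insert2_eq) auto
  have "i \<in> \<Omega>" "j \<in> \<Omega>" using qp S by auto
  have "interp ?f S q p = interp (\<epsilon>'\<^sub>2 l) S [] [(\<E>, i), (\<E>, j), (\<F>, j), (\<F>, i)] *
      interp (\<tau> (l - 4) \<star> Ident [\<F>, \<F>] l) S [(\<E>, i), (\<E>, j), (\<F>, j), (\<F>, i)] p"
    unfolding qp
    by (rule interp_mult_single4) (auto simp: interp_horiz dest!: nonzero_entries \<epsilon>\<^sub>2_nonzero)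
  also have "\<dots> = 1 / (b - a)"
    using ab'
  proof
    assume "a = j \<and> b = i"
    then show ?thesis
      using S(1) qp(3-5) \<open>i \<in> \<Omega>\<close> \<open>j \<in> \<Omega>\<close> unfolding qp(2) by (simp add: interp_horiz \<epsilon>'\<^sub>2_entry entries)
  next
    assume "a = i \<and> b = j"
    then show ?thesis
      using S(1) qp(3-5) \<open>i \<in> \<Omega>\<close> \<open>j \<in> \<Omega>\<close> unfolding qp(2) by (simp add: interp_horiz \<epsilon>'\<^sub>2_entry entries)
  qed
  also have "1 / (b - a) = interp (\<epsilon>'\<^sub>2 l) S [] [(\<E>, b), (\<E>, a), (\<F>, a), (\<F>, b)] *
      interp (Ident [\<E>, \<E>] (l - 4) \<star> \<tau>' l) S [(\<E>, b), (\<E>, a), (\<F>, a), (\<F>, b)] p"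
    using ab'
  proof
    assume "a = j \<and> b = i"
    then show ?thesis
      using S(1) qp(3-5) \<open>i \<in> \<Omega>\<close> \<open>j \<in> \<Omega>\<close> unfolding qp(2) by (simp add: interp_horiz \<epsilon>'\<^sub>2_entry entries)
  next
    have "S - {j} - {i} = S - {i} - {j}" by auto
    moreover assume "a = i \<and> b = j"
    ultimately show ?thesis
      using S(1) qp(3-5) \<open>i \<in> \<Omega>\<close> \<open>j \<in> \<Omega>\<close> unfolding qp(2) by (simp add: interp_horiz \<epsilon>'\<^sub>2_entry entries)
  qed
  also have "\<dots> = interp ?g S q p"
    unfolding qp
    by (rule interp_mult_single4 [symmetric]) (auto simp: interp_horiz dest!: nonzero_entries \<epsilon>\<^sub>2_nonzero)
  finally show "interp ?f S q p = interp ?g S q p" .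
qed simp_all

text \<open>Here the nested caps carry Euler weights. If the labels \<open>c\<close> and
  \<open>d\<close> are exchanged against the nested order, the two sides see these weights in
  opposite order, and \<open>euler_swap\<close> is needed.\<close>

lemma cyc_cross2_sound:
  "interp (\<epsilon>\<^sub>2 l * (\<tau>' (l + 4) \<star> Ident [\<E>, \<E>] l)) = interp (\<epsilon>\<^sub>2 l * (Ident [\<F>, \<F>] (l + 4) \<star> \<tau> l))" (is "interp ?f = interp ?g")
proof (rule interp_eqI)
  fix S q p
  assume S: "state l S" "S \<subseteq> \<Omega>" "q \<in> paths S (cod_word ?f)" "p \<in> paths S (dom_word ?f)" "endp S q = endp S p"
  then obtain a b c d where qp: "q = []" "p = [(\<F>, d), (\<F>, c), (\<E>, b), (\<E>, a)]" "a \<in> \<Omega>" "a \<notin> S" "b \<in> \<Omega>" "b \<notin> S" "a \<noteq> b"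
    and cd: "c \<in> insert b (insert a S)" "d \<in> insert b (insert a S)" "c \<noteq> d" and ends: "S = insert b (insert a S) - {c} - {d}"
    by (auto simp: mem_paths_Cons)
  have "insert b (insert a S) - {c} - {d} = insert b (insert a S) - {a} - {b}"
    using ends qp by auto
  then have cd': "c = a \<and> d = b \<or> c = b \<and> d = a"
    using qp cd by (subst (asm) remove2_eq) auto
  have swap: "euler S b * euler (insert b S) a = euler S a * euler (insert a S) b"
    using qp S by (intro euler_swap) auto
  have comm: "insert a (insert b S) = insert b (insert a S)" by auto
  have "interp ?f S q p = interp (\<epsilon>\<^sub>2 l) S [] [(\<F>, a), (\<F>, b), (\<E>, b), (\<E>, a)] *
      interp (\<tau>' (l + 4) \<star> Ident [\<E>, \<E>] l) S [(\<F>, a), (\<F>, b), (\<E>, b), (\<E>, a)] p"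
    unfolding qp
    by (rule interp_mult_single4) (auto simp: interp_horiz dest!: nonzero_entries \<epsilon>\<^sub>2_nonzero)
  also have "\<dots> = euler S a * euler (insert a S) b / (b - a)"
    using cd'
  proof
    assume "c = a \<and> d = b"
    then show ?thesis
      using S(1) qp(3-) unfolding qp(2) by (simp add: interp_horiz \<epsilon>\<^sub>2_entry entries)
  next
    assume "c = b \<and> d = a"
    then show ?thesis
      using S(1) qp(3-) unfolding qp(2) by (simp add: interp_horiz \<epsilon>\<^sub>2_entry entries)
  qed
  also have "euler S a * euler (insert a S) b / (b - a) = interp (\<epsilon>\<^sub>2 l) S [] [(\<F>, d), (\<F>, c), (\<E>, c), (\<E>, d)] *
      interp (Ident [\<F>, \<F>] (l + 4) \<star> \<tau> l) S [(\<F>, d), (\<F>, c), (\<E>, c), (\<E>, d)] p"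
    using cd'
  proof
    assume "c = a \<and> d = b"
    then show ?thesis
      using S(1) qp(3-) swap comm unfolding qp(2) by (simp add: interp_horiz \<epsilon>\<^sub>2_entry entries)
  next
    assume "c = b \<and> d = a"
    then show ?thesis
      using S(1) qp(3-) unfolding qp(2) by (simp add: interp_horiz \<epsilon>\<^sub>2_entry entries)
  qed
  also have "\<dots> = interp ?g S q p"
    unfolding qp
    by (rule interp_mult_single4 [symmetric]) (auto simp: interp_horiz dest!: nonzero_entries \<epsilon>\<^sub>2_nonzero)
  finally show "interp ?f S q p = interp ?g S q p" .
qed simp_all

lemma interp_adj_rel: "f \<approx>\<^sub>a g \<Longrightarrow> interp f = interp g"
  by (induction rule: adj_rel.induct)
    (rule interp_zigzag_E1 interp_zigzag_E2 interp_zigzag_F1 interp_zigzag_F2 interp_cyc_dot1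
      interp_cyc_dot2 cyc_cross1_sound cyc_cross2_sound)+

section \<open>The nilHecke relations\<close>

lemma endp_EE:
  assumes "p \<in> paths S [\<E>, \<E>]" "q \<in> paths S [\<E>, \<E>]" "endp S q = endp S p"
  obtains a b a' b' where "p = [(\<E>, b), (\<E>, a)]" "q = [(\<E>, b'), (\<E>, a')]"
    "a \<in> \<Omega>" "a \<notin> S" "b \<in> \<Omega>" "b \<notin> S" "a \<noteq> b" "a' = a \<and> b' = b \<or> a' = b \<and> b' = a"
proof -
  obtain a b a' b' where *: "p = [(\<E>, b), (\<E>, a)]" "q = [(\<E>, b'), (\<E>, a')]"
    "a \<in> \<Omega>" "a \<notin> S" "b \<in> \<Omega>" "b \<notin> S" "a \<noteq> b" "a' \<notin> S" "b' \<notin> S" "a' \<noteq> b'"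
    using assms by (auto simp: paths_EE)
  moreover have "insert b' (insert a' S) = insert b (insert a S)" using assms * by simp
  ultimately show thesis using that insert2_eq by metis
qed

lemma interp_zero_words: "interp f = (\<lambda>S q p. 0)" if "well_typed f" "weighted l f"
  and "\<And>S q p. \<lbrakk>state l S; S \<subseteq> \<Omega>; q \<in> paths S (cod_word f); p \<in> paths S (dom_word f); endp S q = endp S p\<rbrakk>
      \<Longrightarrow> interp f S q p = 0"
  using that typed_zero by (intro typed_eqI [OF typed_interp]) auto

lemma tau_sq_sound: "interp (\<tau> l * \<tau> l) = interp 0"
  unfolding interp_simps(1)
proof (rule interp_zero_words)
  fix S q p
  assume S: "state l S" "q \<in> paths S (cod_word (\<tau> l * \<tau> l))" "p \<in> paths S (dom_word (\<tau> l * \<tau> l))" "endp S q = endp S p"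
  from S(3,2,4) have "p \<in> paths S [\<E>, \<E>]" "q \<in> paths S [\<E>, \<E>]" "endp S q = endp S p"
    by simp_all
  then obtain a b a' b' where qp: "p = [(\<E>, b), (\<E>, a)]" "q = [(\<E>, b'), (\<E>, a')]"
    "a \<in> \<Omega>" "a \<notin> S" "b \<in> \<Omega>" "b \<notin> S" "a \<noteq> b" "a' = a \<and> b' = b \<or> a' = b \<and> b' = a"
    by (rule endp_EE)
  \<comment> \<open>The lower crossing keeps or exchanges the labels; accordingly the upper one
    contributes \<open>1 / (b - a)\<close> or \<open>1 / (a - b)\<close>, and the two terms
    cancel.\<close>
  have "interp (\<tau> l * \<tau> l) S q p
      = (\<Sum>m\<in>{[(\<E>, b), (\<E>, a)], [(\<E>, a), (\<E>, b)]}. interp (\<tau> l) S q m * interp (\<tau> l) S m p)"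
    by (rule interp_mult) (auto simp: qp(1) paths_EE dest!: nonzero_entries)
  also have "\<dots> = 0"
    using qp(8) S(1) qp(3-7) unfolding qp(1,2)
    by (elim disjE) (simp_all add: tau_entry, simp_all add: divide_simps)
  finally show "interp (\<tau> l * \<tau> l) S q p = 0" .
qed simp_all

lemma interp_diff_eqI:
  assumes "well_typed (f - g)" "weighted l (f - g)" "well_typed h" "weighted l h" "dom_word h = dom_word f" "cod_word h = cod_word f"
    and "\<And>S q p. \<lbrakk>state l S; S \<subseteq> \<Omega>; q \<in> paths S (cod_word f); p \<in> paths S (dom_word f); endp S q = endp S p\<rbrakk>
      \<Longrightarrow> interp f S q p - interp g S q p = interp h S q p"
  shows "interp (f - g) = interp h"
  using assms by (intro interp_eqI [of _ l]) auto

lemma dot_cross1_sound: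
  "interp (\<tau> l * (\<xi> (l + 2) \<star> Ident [\<E>] l) - (Ident [\<E>] (l + 2) \<star> \<xi> l) * \<tau> l) = interp (Ident [\<E>, \<E>] l)" (is "interp (?f - ?g) = interp ?h")
proof (rule interp_diff_eqI)
  fix S q p
  assume S: "state l S" "q \<in> paths S (cod_word ?f)" "p \<in> paths S (dom_word ?f)" "endp S q = endp S p"
  from S(3,2,4) have "p \<in> paths S [\<E>, \<E>]" "q \<in> paths S [\<E>, \<E>]" "endp S q = endp S p"
    by simp_all
  then obtain a b a' b' where qp: "p = [(\<E>, b), (\<E>, a)]" "q = [(\<E>, b'), (\<E>, a')]"
    "a \<in> \<Omega>" "a \<notin> S" "b \<in> \<Omega>" "b \<notin> S" "a \<noteq> b" "a' = a \<and> b' = b \<or> a' = b \<and> b' = a"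
    by (rule endp_EE)
  have "interp ?f S q p = interp (\<tau> l) S q p * interp (\<xi> (l + 2) \<star> Ident [\<E>] l) S p p"
    unfolding qp(1) by (rule interp_mult_single2) (auto simp: interp_horiz dest!: nonzero_entries)
  moreover have "interp ?g S q p = interp (Ident [\<E>] (l + 2) \<star> \<xi> l) S q q * interp (\<tau> l) S q p"
    unfolding qp(2) by (rule interp_mult_single2) (auto simp: interp_horiz dest!: nonzero_entries)
  ultimately show "interp ?f S q p - interp ?g S q p = interp ?h S q p"
    using qp(8) S(1) qp(3-7) unfolding qp(1,2)
    by (elim disjE) (simp_all add: interp_horiz entries, simp_all add: divide_simps)
qed simp_all

lemma dot_cross2_sound:
  "interp ((\<xi> (l + 2) \<star> Ident [\<E>] l) * \<tau> l - \<tau> l * (Ident [\<E>] (l + 2) \<star> \<xi> l)) = interp (Ident [\<E>, \<E>] l)" (is "interp (?f - ?g) = interp ?h")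
proof (rule interp_diff_eqI)
  fix S q p
  assume S: "state l S" "q \<in> paths S (cod_word ?f)" "p \<in> paths S (dom_word ?f)" "endp S q = endp S p"
  from S(3,2,4) have "p \<in> paths S [\<E>, \<E>]" "q \<in> paths S [\<E>, \<E>]" "endp S q = endp S p"
    by simp_all
  then obtain a b a' b' where qp: "p = [(\<E>, b), (\<E>, a)]" "q = [(\<E>, b'), (\<E>, a')]"
    "a \<in> \<Omega>" "a \<notin> S" "b \<in> \<Omega>" "b \<notin> S" "a \<noteq> b" "a' = a \<and> b' = b \<or> a' = b \<and> b' = a"
    by (rule endp_EE)
  have "interp ?f S q p = interp (\<xi> (l + 2) \<star> Ident [\<E>] l) S q q * interp (\<tau> l) S q p"
    unfolding qp(2) by (rule interp_mult_single2) (auto simp: interp_horiz dest!: nonzero_entries)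
  moreover have "interp ?g S q p = interp (\<tau> l) S q p * interp (Ident [\<E>] (l + 2) \<star> \<xi> l) S p p"
    unfolding qp(1) by (rule interp_mult_single2) (auto simp: interp_horiz dest!: nonzero_entries)
  ultimately show "interp ?f S q p - interp ?g S q p = interp ?h S q p"
    using qp(8) S(1) qp(3-7) unfolding qp(1,2)
    by (elim disjE) (simp_all add: interp_horiz entries, simp_all add: divide_simps)
qed simp_all

lemma left_crossing_entry:
  assumes "state l S" "x \<in> \<Omega> - S" "y \<in> \<Omega> - S" "z \<in> \<Omega> - S" "x \<noteq> y" "x \<noteq> z" "y \<noteq> z"
  shows "interp (\<tau> (l + 2) \<star> Ident [\<E>] l) S [(\<E>, x'), (\<E>, y'), (\<E>, z')] [(\<E>, x), (\<E>, y), (\<E>, z)]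
    = (if z' = z \<and> (y' = y \<and> x' = x \<or> y' = x \<and> x' = y) then 1 / (x - y) else 0)"
  using assms by (auto simp: interp_horiz entries)

lemma right_crossing_entry:
  assumes "state l S" "x \<in> \<Omega> - S" "y \<in> \<Omega> - S" "z \<in> \<Omega> - S" "x \<noteq> y" "x \<noteq> z" "y \<noteq> z"
  shows "interp (Ident [\<E>] (l + 4) \<star> \<tau> l) S [(\<E>, x'), (\<E>, y'), (\<E>, z')] [(\<E>, x), (\<E>, y), (\<E>, z)]
    = (if x' = x \<and> (z' = z \<and> y' = y \<or> z' = y \<and> y' = z) then 1 / (y - z) else 0)"
  using assms by (auto simp: interp_horiz entries)

lemma mult_left_crossing:
  assumes "state l S" "x \<in> \<Omega> - S" "y \<in> \<Omega> - S" "z \<in> \<Omega> - S" "x \<noteq> y" "x \<noteq> z" "y \<noteq> z"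
  shows "interp (f * (\<tau> (l + 2) \<star> Ident [\<E>] l)) S r [(\<E>, x), (\<E>, y), (\<E>, z)]
    = (interp f S r [(\<E>, x), (\<E>, y), (\<E>, z)] + interp f S r [(\<E>, y), (\<E>, x), (\<E>, z)]) / (x - y)"
proof -
  have "interp (f * (\<tau> (l + 2) \<star> Ident [\<E>] l)) S r [(\<E>, x), (\<E>, y), (\<E>, z)]
      = (\<Sum>m\<in>{[(\<E>, x), (\<E>, y), (\<E>, z)], [(\<E>, y), (\<E>, x), (\<E>, z)]}. interp f S r m
          * interp (\<tau> (l + 2) \<star> Ident [\<E>] l) S m [(\<E>, x), (\<E>, y), (\<E>, z)])"
    by (rule interp_mult) (auto simp: mem_paths_Cons interp_horiz dest!: nonzero_entries)
  then show ?thesis using assms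
    by (simp add: left_crossing_entry) (simp add: add_divide_distrib)
qed

lemma mult_right_crossing:
  assumes "state l S" "x \<in> \<Omega> - S" "y \<in> \<Omega> - S" "z \<in> \<Omega> - S" "x \<noteq> y" "x \<noteq> z" "y \<noteq> z"
  shows "interp (f * (Ident [\<E>] (l + 4) \<star> \<tau> l)) S r [(\<E>, x), (\<E>, y), (\<E>, z)]
    = (interp f S r [(\<E>, x), (\<E>, y), (\<E>, z)] + interp f S r [(\<E>, x), (\<E>, z), (\<E>, y)]) / (y - z)"
proof -
  have "interp (f * (Ident [\<E>] (l + 4) \<star> \<tau> l)) S r [(\<E>, x), (\<E>, y), (\<E>, z)]
      = (\<Sum>m\<in>{[(\<E>, x), (\<E>, y), (\<E>, z)], [(\<E>, x), (\<E>, z), (\<E>, y)]}. interp f S r m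
          * interp (Ident [\<E>] (l + 4) \<star> \<tau> l) S m [(\<E>, x), (\<E>, y), (\<E>, z)])"
    by (rule interp_mult) (auto simp: mem_paths_Cons interp_horiz dest!: nonzero_entries)
  then show ?thesis using assms
    by (simp add: right_crossing_entry) (simp add: add_divide_distrib)
qed

lemma braid_sound:
  "interp ((\<tau> (l + 2) \<star> Ident [\<E>] l) * (Ident [\<E>] (l + 4) \<star> \<tau> l) * (\<tau> (l + 2) \<star> Ident [\<E>] l))
    = interp ((Ident [\<E>] (l + 4) \<star> \<tau> l) * (\<tau> (l + 2) \<star> Ident [\<E>] l) * (Ident [\<E>] (l + 4) \<star> \<tau> l))"
  (is "interp ?f = interp ?g")
proof (rule interp_eqI)
  fix S q p
  assume S: "state l S" "q \<in> paths S (cod_word ?f)" "p \<in> paths S (dom_word ?f)" "endp S q = endp S p"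
  from S(3) obtain a b c where p: "p = [(\<E>, c), (\<E>, b), (\<E>, a)]" "a \<in> \<Omega> - S" "b \<in> \<Omega> - S" "c \<in> \<Omega> - S" "a \<noteq> b" "a \<noteq> c" "b \<noteq> c"
    by (auto simp: mem_paths_Cons)
  from S(2) obtain x y z where q: "q = [(\<E>, x), (\<E>, y), (\<E>, z)]" "x \<notin> S" "y \<notin> S" "z \<notin> S" "x \<noteq> y" "x \<noteq> z" "y \<noteq> z"
    by (auto simp: mem_paths_Cons)
  have "insert x (insert y (insert z S)) = insert c (insert b (insert a S))"
    using S(4) p q by simp
  then have "{x, y, z} = {a, b, c}"
    using p(2-) q(2-) by (auto simp: set_eq_iff)
  then have mem: "x \<in> {a, b, c}" "y \<in> {a, b, c}" "z \<in> {a, b, c}" by blast+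
  note rules = mult_left_crossing [OF S(1)] mult_right_crossing [OF S(1)]
    left_crossing_entry [OF S(1)] right_crossing_entry [OF S(1)]
  have ne: "b \<noteq> a" "c \<noteq> a" "c \<noteq> b" using p by auto
  have f: "interp ?f S q p = (interp (\<tau> (l + 2) \<star> Ident [\<E>] l) S q [(\<E>, c), (\<E>, b), (\<E>, a)] / (b - a)
       + interp (\<tau> (l + 2) \<star> Ident [\<E>] l) S q [(\<E>, c), (\<E>, a), (\<E>, b)] / (b - a)
       + interp (\<tau> (l + 2) \<star> Ident [\<E>] l) S q [(\<E>, b), (\<E>, c), (\<E>, a)] / (c - a)
       + interp (\<tau> (l + 2) \<star> Ident [\<E>] l) S q [(\<E>, b), (\<E>, a), (\<E>, c)] / (c - a)) / (c - b)"
    using p ne by (simp add: rules add_divide_distrib)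
  have g: "interp ?g S q p = (interp (Ident [\<E>] (l + 4) \<star> \<tau> l) S q [(\<E>, c), (\<E>, b), (\<E>, a)] / (c - b)
       + interp (Ident [\<E>] (l + 4) \<star> \<tau> l) S q [(\<E>, b), (\<E>, c), (\<E>, a)] / (c - b)
       + interp (Ident [\<E>] (l + 4) \<star> \<tau> l) S q [(\<E>, c), (\<E>, a), (\<E>, b)] / (c - a)
       + interp (Ident [\<E>] (l + 4) \<star> \<tau> l) S q [(\<E>, a), (\<E>, c), (\<E>, b)] / (c - a)) / (b - a)"
    using p ne by (simp add: rules add_divide_distrib)
  \<comment> \<open>As the end points agree, \<open>q\<close> is a rearrangement of
    \<open>p\<close>; each of the six orders gives an identity of rational functions in the
    labels.\<close>
  have cases: "x = c \<and> y = b \<and> z = a \<or> x = c \<and> y = a \<and> z = b \<or> x = b \<and> y = c \<and> z = a \<or>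
      x = b \<and> y = a \<and> z = c \<or> x = a \<and> y = b \<and> z = c \<or> x = a \<and> y = c \<and> z = b"
    using mem q(5-) by auto
  show "interp ?f S q p = interp ?g S q p"
    unfolding f g unfolding q(1)
    using cases p(2-) ne
    by (elim disjE) (simp_all add: left_crossing_entry [OF S(1)] right_crossing_entry [OF S(1)],
        simp_all add: divide_simps, simp_all add: algebra_simps)
qed simp_all

lemma interp_nil_rel: "f \<approx>\<^sub>n g \<Longrightarrow> interp f = interp g"
  by (induction rule: nil_rel.induct) (rule tau_sq_sound braid_sound dot_cross1_sound dot_cross2_sound)+

end

text \<open>Multiplication of the linear multiple of \<open>H\<close> by the geometric series in
  \<open>x\<close> gives back \<open>H\<close>.\<close>

lemma icoeff_geometric:
  "icoeff H n = (\<Sum>a<nat (n + 1). x ^ a * icoeff ((1 - fps_const (x :: 'a::field) * fps_X) * H) (n - int a))"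
proof (induction "nat (n + 1)" arbitrary: n)
  case 0
  then show ?case by (simp add: icoeff_def)
next
  case (Suc m)
  have eq: "nat (n + 1) = Suc m" "m = nat (n - 1 + 1)" using Suc.hyps(2) by auto
  have "(\<Sum>a<nat (n + 1). x ^ a * icoeff ((1 - fps_const x * fps_X) * H) (n - int a))
      = icoeff ((1 - fps_const x * fps_X) * H) n
        + x * (\<Sum>a<m. x ^ a * icoeff ((1 - fps_const x * fps_X) * H) (n - 1 - int a))"
    unfolding eq(1) by (subst sum.lessThan_Suc_shift) (simp add: sum_distrib_left algebra_simps)
  also have "\<dots> = icoeff H n"
    using Suc.hyps(1) [OF eq(2)] eq(2) by (simp add: icoeff_linear_mult)
  finally show ?case ..
qed

lemma icoeff_geometric':
  "icoeff H n = (\<Sum>a<nat (n + 1). icoeff ((1 - fps_const (x :: 'a::field) * fps_X) * H) (int a) * x ^ nat (n - int a))"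
  unfolding icoeff_geometric [of H n x]
  by (rule sum.reindex_bij_witness [of _ "\<lambda>a. nat (n - int a)" "\<lambda>a. nat (n - int a)"]) auto

lemma icoeff_inverse:
  assumes "F * G = (1 :: 'a::field fps)"
  shows "(\<Sum>a<nat (m + 1). icoeff F (int a) * icoeff G (m - int a)) = (if m = 0 then 1 else 0)"
proof (cases "m < 0")
  case False
  then have "(\<Sum>a<nat (m + 1). icoeff F (int a) * icoeff G (m - int a)) = fps_nth (F * G) (nat m)"
    unfolding fps_mult_nth by (intro sum.cong) (auto simp: icoeff_def nat_diff_distrib)
  then show ?thesis using assms False by (simp add: fps_one_nth)
qed auto

context flag_model begin

section \<open>Real and fake bubbles\<close>

lemma dsum_words:
  assumes "\<And>a. a \<in> set as \<Longrightarrow> dom_word (f a) = [] \<and> cod_word (f a) = [] \<and> well_typed (f a)"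
  shows "dom_word (dsum f as) = [] \<and> cod_word (dsum f as) = [] \<and> well_typed (dsum f as)"
  using assms by (induction as) (auto simp: dsum_def)

lemma weighted_dsum: "(\<And>a. a \<in> set as \<Longrightarrow> weighted l (f a)) \<Longrightarrow> weighted l (dsum f as)"
  by (induction as) (auto simp: dsum_def)

lemma real_bub_words [simp]:
  "dom_word (real_bub_plus k l) = []" "cod_word (real_bub_plus k l) = []" "well_typed (real_bub_plus k l)"
  "dom_word (real_bub_minus k l) = []" "cod_word (real_bub_minus k l) = []" "well_typed (real_bub_minus k l)"
  "weighted l (real_bub_plus k l)" "weighted l (real_bub_minus k l)"
  by (simp_all add: real_bub_plus_def real_bub_minus_def)

lemma fake_bub_plus_words [simp]:
  "dom_word (fake_bub_plus m l) = []" "cod_word (fake_bub_plus m l) = []" "well_typed (fake_bub_plus m l)"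
  "weighted l (fake_bub_plus m l)"
proof (induction m rule: less_induct)
  case (less m)
  let ?s = "dsum (\<lambda>a. fake_bub_plus a l * real_bub_minus (int m - int a) l) [0..<m]"
  have "dom_word ?s = [] \<and> cod_word ?s = [] \<and> well_typed ?s" "weighted l ?s"
    by (intro dsum_words weighted_dsum; use less in simp)+
  then show "dom_word (fake_bub_plus m l) = []" "cod_word (fake_bub_plus m l) = []"
    "well_typed (fake_bub_plus m l)" "weighted l (fake_bub_plus m l)"
    by (simp_all add: fake_bub_plus.simps [of m])
qed

lemma fake_bub_minus_words [simp]:
  "dom_word (fake_bub_minus m l) = []" "cod_word (fake_bub_minus m l) = []" "well_typed (fake_bub_minus m l)"
  "weighted l (fake_bub_minus m l)"
proof (induction m rule: less_induct)
  case (less m)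
  let ?s = "dsum (\<lambda>a. real_bub_plus (int m - int a) l * fake_bub_minus a l) [0..<m]"
  have "dom_word ?s = [] \<and> cod_word ?s = [] \<and> well_typed ?s" "weighted l ?s"
    by (intro dsum_words weighted_dsum; use less in simp)+
  then show "dom_word (fake_bub_minus m l) = []" "cod_word (fake_bub_minus m l) = []"
    "well_typed (fake_bub_minus m l)" "weighted l (fake_bub_minus m l)"
    by (simp_all add: fake_bub_minus.simps [of m])
qed

lemma bub_words [simp]:
  "dom_word (bub_plus k l) = []" "cod_word (bub_plus k l) = []" "well_typed (bub_plus k l)" "weighted l (bub_plus k l)"
  "dom_word (bub_minus k l) = []" "cod_word (bub_minus k l) = []" "well_typed (bub_minus k l)" "weighted l (bub_minus k l)"
  by (simp_all add: bub_plus_def bub_minus_def)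

lemma card_complement:
  assumes "state l S"
  shows "int (card (\<Omega> - S)) = int (card S) - l"
proof -
  have "card S \<le> card \<Omega>" using assms finite_\<Omega> by (auto simp: state_def intro: card_mono)
  then show ?thesis
    using assms finite_\<Omega> by (auto simp: state_def card_Diff_subset finite_subset of_nat_diff)
qed

lemma finite_state: "state l S \<Longrightarrow> finite S"
  using finite_\<Omega> by (auto simp: state_def finite_subset)

lemma inverse_euler:
  "i \<in> S \<Longrightarrow> 1 / euler (S - {i}) i = (\<Prod>r\<in>\<Omega> - S. i - r) / (\<Prod>s\<in>S - {i}. i - s)"
proof -
  assume "i \<in> S"
  then have "\<Omega> - (S - {i}) - {i} = \<Omega> - S" by auto
  then show ?thesis by (simp add: euler_def)
qed

text \<open>The label on the circle runs through \<open>S\<close>. The inverse Euler weight of the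
  cup makes the sum over labels a Lagrange sum with exponent \<open>k + l - 1\<close>, and
  \<open>card_complement\<close> turns its index into \<open>k\<close>.\<close>

lemma real_bub_plus_entry:
  assumes S: "state l S" and k: "k \<ge> 1 - l"
  shows "interp (real_bub_plus k l) S [] [] = icoeff (quot_fps (\<Omega> - S) S) k"
proof -
  let ?n = "nat (k + l - 1)"
  have "S \<subseteq> \<Omega>" using S by (rule state_subset)
  have 1: "interp (\<epsilon>' l * (\<xi>pow (l - 2) ?n \<star> Ident [\<F>] l)) S [] [(\<E>, i), (\<F>, i)] = i ^ ?n" if "i \<in> S" for i
  proof -
    have "interp (\<epsilon>' l * (\<xi>pow (l - 2) ?n \<star> Ident [\<F>] l)) S [] [(\<E>, i), (\<F>, i)]
      = interp (\<epsilon>' l) S [] [(\<E>, i), (\<F>, i)] * interp (\<xi>pow (l - 2) ?n \<star> Ident [\<F>] l) S [(\<E>, i), (\<F>, i)] [(\<E>, i), (\<F>, i)]"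
      by (rule interp_mult_single2) (auto simp: interp_horiz dest!: nonzero_entries)
    then show ?thesis using that S \<open>S \<subseteq> \<Omega>\<close> by (auto simp: interp_horiz entries \<xi>pow_entry)
  qed
  have "interp (real_bub_plus k l) S [] []
      = (\<Sum>q\<in>(\<lambda>i. [(\<E>, i), (\<F>, i)]) ` S.
          interp (\<epsilon>' l * (\<xi>pow (l - 2) ?n \<star> Ident [\<F>] l)) S [] q * interp (\<eta>' l) S q [])"
    unfolding real_bub_plus_def
    by (rule interp_mult) (use finite_state [OF S] in \<open>auto simp: mem_paths_Cons dest!: nonzero_entries\<close>)
  also have "\<dots> = (\<Sum>i\<in>S. i ^ ?n * (1 / euler (S - {i}) i))"
    by (subst sum.reindex) (auto simp: inj_on_def 1 gen_entries S intro!: sum.cong)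
  also have "\<dots> = lagrange_sum (\<Omega> - S) S ?n"
    unfolding lagrange_sum_def by (intro sum.cong HOL.refl) (simp only: inverse_euler times_divide_eq_right)
  also have "\<dots> = icoeff (quot_fps (\<Omega> - S) S) (int ?n + int (card (\<Omega> - S)) + 1 - int (card S))"
    using finite_state [OF S] finite_\<Omega> by (intro lagrange_sum_eq) auto
  also have "int ?n + int (card (\<Omega> - S)) + 1 - int (card S) = k"
    using card_complement [OF S] k by simp
  finally show ?thesis .
qed

lemma real_bub_minus_entry:
  assumes S: "state l S" and k: "k \<ge> 1 + l"
  shows "interp (real_bub_minus k l) S [] [] = icoeff (quot_fps S (\<Omega> - S)) k"
proof -
  let ?n = "nat (k - l - 1)"
  have "S \<subseteq> \<Omega>" using S by (rule state_subset)
  have 1: "interp (\<epsilon> l * (Ident [\<F>] (l + 2) \<star> \<xi>pow l ?n)) S [] [(\<F>, i), (\<E>, i)] = euler S i * i ^ ?n" if "i \<in> \<Omega> - S" for i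
  proof -
    have "interp (\<epsilon> l * (Ident [\<F>] (l + 2) \<star> \<xi>pow l ?n)) S [] [(\<F>, i), (\<E>, i)]
      = interp (\<epsilon> l) S [] [(\<F>, i), (\<E>, i)] * interp (Ident [\<F>] (l + 2) \<star> \<xi>pow l ?n) S [(\<F>, i), (\<E>, i)] [(\<F>, i), (\<E>, i)]"
      by (rule interp_mult_single2) (auto simp: interp_horiz dest!: nonzero_entries)
    then show ?thesis using that S \<open>S \<subseteq> \<Omega>\<close> by (auto simp: interp_horiz entries \<xi>pow_entry)
  qed
  have "interp (real_bub_minus k l) S [] []
      = (\<Sum>q\<in>(\<lambda>i. [(\<F>, i), (\<E>, i)]) ` (\<Omega> - S).
          interp (\<epsilon> l * (Ident [\<F>] (l + 2) \<star> \<xi>pow l ?n)) S [] q * interp (\<eta> l) S q [])"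
    unfolding real_bub_minus_def
    by (rule interp_mult) (use finite_\<Omega> in \<open>auto simp: mem_paths_Cons dest!: nonzero_entries\<close>)
  also have "\<dots> = (\<Sum>i\<in>\<Omega> - S. i ^ ?n * euler S i)"
    by (subst sum.reindex) (auto simp: inj_on_def 1 gen_entries S intro!: sum.cong)
  also have "\<dots> = lagrange_sum S (\<Omega> - S) ?n"
    unfolding lagrange_sum_def euler_def by (intro sum.cong HOL.refl) simp
  also have "\<dots> = icoeff (quot_fps S (\<Omega> - S)) (int ?n + int (card S) + 1 - int (card (\<Omega> - S)))"
    using finite_state [OF S] finite_\<Omega> by (intro lagrange_sum_eq) auto
  also have "int ?n + int (card S) + 1 - int (card (\<Omega> - S)) = k"
    using card_complement [OF S] k by simp
  finally show ?thesis .
qed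

lemma interp_mult_Nil:
  assumes "well_typed g" "cod_word g = []"
  shows "interp (f * g) S r p = interp f S r [] * interp g S [] p"
  by (rule interp_mult_single) (use assms in auto)

text \<open>The recursion defining fake bubbles is the one for the coefficients of an inverse power
  series, and the series of the two orientations are inverse to each other by
  \<open>quot_fps_inverse\<close>.\<close>

lemma fake_bub_plus_entry:
  assumes S: "state l S" and m: "int m < 1 - l"
  shows "interp (fake_bub_plus m l) S [] [] = icoeff (quot_fps (\<Omega> - S) S) (int m)"
  using m
proof (induction m rule: less_induct)
  case (less m)
  let ?F = "quot_fps (\<Omega> - S) S" and ?G = "quot_fps S (\<Omega> - S)"
  show ?case
  proof (cases "m = 0")
    case True
    then show ?thesis using S by (simp add: fake_bub_plus.simps [of 0] ident_mat_def icoeff_def)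
  next
    case False
    have "interp (fake_bub_plus m l) S [] [] =
        - (\<Sum>a<m. interp (fake_bub_plus a l * real_bub_minus (int m - int a) l) S [] [])"
      using False by (subst fake_bub_plus.simps) (simp add: interp_dsum interv_sum_list_conv_sum_set_nat atLeast0LessThan)
    also have "\<dots> = - (\<Sum>a<m. icoeff ?F (int a) * icoeff ?G (int m - int a))"
      by (intro arg_cong [of _ _ uminus] sum.cong HOL.refl)
        (use less in \<open>simp add: interp_mult_Nil real_bub_minus_entry [OF S]\<close>)
    also have "\<dots> = icoeff ?F (int m)"
      using icoeff_inverse [OF quot_fps_inverse [of "\<Omega> - S" S], of "int m"] False
      by (simp add: nat_add_distrib) (simp add: icoeff_def neg_eq_iff_add_eq_0 add.commute)
    finally show ?thesis .
  qed
qed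

lemma fake_bub_minus_entry:
  assumes S: "state l S" and m: "int m < 1 + l"
  shows "interp (fake_bub_minus m l) S [] [] = icoeff (quot_fps S (\<Omega> - S)) (int m)"
  using m
proof (induction m rule: less_induct)
  case (less m)
  let ?F = "quot_fps S (\<Omega> - S)" and ?G = "quot_fps (\<Omega> - S) S"
  show ?case
  proof (cases "m = 0")
    case True
    then show ?thesis using S by (simp add: fake_bub_minus.simps [of 0] ident_mat_def icoeff_def)
  next
    case False
    have "interp (fake_bub_minus m l) S [] [] =
        - (\<Sum>a<m. interp (real_bub_plus (int m - int a) l * fake_bub_minus a l) S [] [])"
      using False by (subst fake_bub_minus.simps) (simp add: interp_dsum interv_sum_list_conv_sum_set_nat atLeast0LessThan)
    also have "\<dots> = - (\<Sum>a<m. icoeff ?F (int a) * icoeff ?G (int m - int a))"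
      by (intro arg_cong [of _ _ uminus] sum.cong HOL.refl)
        (use less in \<open>simp add: interp_mult_Nil real_bub_plus_entry [OF S]\<close>)
    also have "\<dots> = icoeff ?F (int m)"
      using icoeff_inverse [OF quot_fps_inverse [of S "\<Omega> - S"], of "int m"] False
      by (simp add: nat_add_distrib) (simp add: icoeff_def neg_eq_iff_add_eq_0 add.commute)
    finally show ?thesis .
  qed
qed

text \<open>One power series for all indices: real, fake and negative. The bubble relations thereby
  become statements about a series and its inverse.\<close>

lemma bub_entry:
  assumes S: "state l S"
  shows "interp (bub_plus k l) S [] [] = icoeff (quot_fps (\<Omega> - S) S) k"
    "interp (bub_minus k l) S [] [] = icoeff (quot_fps S (\<Omega> - S)) k"
proof -
  have "interp (fake_bub_plus (nat k) l) S [] [] = icoeff (quot_fps (\<Omega> - S) S) k" if "k \<ge> 0" "k < 1 - l"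
    using fake_bub_plus_entry [OF S, of "nat k"] that by simp
  then show "interp (bub_plus k l) S [] [] = icoeff (quot_fps (\<Omega> - S) S) k"
    by (auto simp: bub_plus_def real_bub_plus_entry [OF S] icoeff_def)
  have "interp (fake_bub_minus (nat k) l) S [] [] = icoeff (quot_fps S (\<Omega> - S)) k" if "k \<ge> 0" "k < 1 + l"
    using fake_bub_minus_entry [OF S, of "nat k"] that by simp
  then show "interp (bub_minus k l) S [] [] = icoeff (quot_fps S (\<Omega> - S)) k"
    by (auto simp: bub_minus_def real_bub_minus_entry [OF S] icoeff_def)
qed

lemma interp_eqI_Nil:
  assumes "well_typed f" "weighted l f" "well_typed g" "weighted l g"
    "dom_word f = []" "cod_word f = []" "dom_word g = []" "cod_word g = []"
    and "\<And>S. state l S \<Longrightarrow> interp f S [] [] = interp g S [] []"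
  shows "interp f = interp g"
  using assms by (intro interp_eqI [of _ l]) auto

lemma interp_bub_rel: "f \<approx>\<^sub>b g \<Longrightarrow> interp f = interp g"
proof (induction rule: bub_rel.induct)
  case (bub_plus_neg k l)
  then show ?case by (intro interp_eqI_Nil [of _ l]) (auto simp: bub_entry icoeff_def)
next
  case (bub_minus_neg k l)
  then show ?case by (intro interp_eqI_Nil [of _ l]) (auto simp: bub_entry icoeff_def)
next
  case (bub_plus_0 l)
  then show ?case by (intro interp_eqI_Nil [of _ l]) (auto simp: bub_entry icoeff_def ident_mat_def)
next
  case (bub_minus_0 l)
  then show ?case by (intro interp_eqI_Nil [of _ l]) (auto simp: bub_entry icoeff_def ident_mat_def)
next
  case (inf_grass m l)
  let ?s = "dsum2 m (\<lambda>a b. bub_plus (int a) l * bub_minus (int b) l)"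
  have words: "dom_word ?s = []" "cod_word ?s = []" "well_typed ?s" "weighted l ?s"
    unfolding dsum2_def by (auto simp: dsum_words intro!: weighted_dsum)
  show ?case
  proof (rule interp_eqI_Nil [of _ l])
    fix S assume S: "state l S"
    have "interp ?s S [] [] = (\<Sum>a<nat (m + 1). icoeff (quot_fps (\<Omega> - S) S) (int a) * icoeff (quot_fps S (\<Omega> - S)) (m - int a))"
      unfolding interp_dsum2 by (intro sum.cong HOL.refl) (auto simp: interp_mult_Nil bub_entry [OF S])
    also have "\<dots> = (if m = 0 then 1 else 0)"
      by (rule icoeff_inverse [OF quot_fps_inverse])
    finally show "interp ?s S [] [] = interp (if m = 0 then Ident [] l else 0) S [] []"
      using S by (simp add: ident_mat_def)
  qed (simp_all add: words)
qed

section \<open>Curls\<close>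

lemma typed_dsum: "(\<And>a. a \<in> set as \<Longrightarrow> typed v w l (interp (f a))) \<Longrightarrow> typed v w l (interp (dsum f as))"
  by (induction as) (auto simp: dsum_def intro: typed_zero typed_add)

lemma typed_dsum2: "(\<And>a b. typed v w l (interp (f a b))) \<Longrightarrow> typed v w l (interp (dsum2 n f))"
  unfolding dsum2_def by (rule typed_dsum)

lemma typed_dsum3: "(\<And>a b c. typed v w l (interp (f a b c))) \<Longrightarrow> typed v w l (interp (dsum3 n f))"
  unfolding dsum3_def by (intro typed_dsum2)

lemma typed_interpI:
  "well_typed f \<Longrightarrow> weighted l f \<Longrightarrow> v = dom_word f \<Longrightarrow> w = cod_word f \<Longrightarrow> typed v w l (interp f)"
  using typed_interp by simp

lemma \<xi>pow_weighted [simp]: "weighted m (\<xi>pow l n) \<longleftrightarrow> m = l"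
  by (induction n) auto

text \<open>The cap closes only if the crossing keeps the labels in place. Its value
  \<open>1 / (i - j)\<close> cancels, up to sign, the factor \<open>j - i\<close> in the weight of
  the cup, which leaves a Lagrange sum without the point \<open>i\<close> in the numerator.\<close>

lemma curl_right_value:
  assumes S: "state l S" "i \<in> \<Omega> - S"
  shows "interp ((Ident [\<E>] l \<star> \<epsilon>' l) * (\<tau> (l - 2) \<star> Ident [\<F>] l) * (Ident [\<E>] l \<star> \<eta>' l)) S [(\<E>, i)] [(\<E>, i)]
    = - icoeff (quot_fps (\<Omega> - S - {i}) S) (- l)"
proof -
  have "S \<subseteq> \<Omega>" using S by (simp add: state_subset)
  have fin: "finite S" "finite (\<Omega> - S - {i})" using S finite_\<Omega> by (auto simp: finite_state)
  let ?AT = "(Ident [\<E>] l \<star> \<epsilon>' l) * (\<tau> (l - 2) \<star> Ident [\<F>] l)"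
  have 1: "interp ?AT S [(\<E>, i)] [(\<E>, i), (\<E>, j), (\<F>, j)] = 1 / (i - j)" if "j \<in> S" for j
  proof -
    have "interp ?AT S [(\<E>, i)] [(\<E>, i), (\<E>, j), (\<F>, j)] =
      interp (Ident [\<E>] l \<star> \<epsilon>' l) S [(\<E>, i)] [(\<E>, i), (\<E>, j), (\<F>, j)]
        * interp (\<tau> (l - 2) \<star> Ident [\<F>] l) S [(\<E>, i), (\<E>, j), (\<F>, j)] [(\<E>, i), (\<E>, j), (\<F>, j)]"
      by (rule interp_mult_single3) (auto simp: interp_horiz dest!: nonzero_entries)
    moreover have "j \<in> \<Omega>" "i \<noteq> j" using that S \<open>S \<subseteq> \<Omega>\<close> by auto
    ultimately show ?thesis
      using S that \<open>S \<subseteq> \<Omega>\<close> by (simp add: interp_horiz entries insert_absorb)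
  qed
  have 2: "interp (Ident [\<E>] l \<star> \<eta>' l) S [(\<E>, i), (\<E>, j), (\<F>, j)] [(\<E>, i)] = 1 / euler (S - {j}) j" if "j \<in> S" for j
    using S that \<open>S \<subseteq> \<Omega>\<close> by (simp add: interp_horiz entries insert_absorb)
  have prod: "(\<Prod>r\<in>\<Omega> - S. j - r) = (j - i) * (\<Prod>r\<in>\<Omega> - S - {i}. j - r)" for j
    using S finite_\<Omega> by (intro prod.remove) auto
  have "interp (?AT * (Ident [\<E>] l \<star> \<eta>' l)) S [(\<E>, i)] [(\<E>, i)]
      = (\<Sum>q\<in>(\<lambda>j. [(\<E>, i), (\<E>, j), (\<F>, j)]) ` S. interp ?AT S [(\<E>, i)] q * interp (Ident [\<E>] l \<star> \<eta>' l) S q [(\<E>, i)])"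
    by (rule interp_mult) (use fin in \<open>auto simp: mem_paths_Cons interp_horiz dest!: nonzero_entries\<close>)
  also have "\<dots> = (\<Sum>j\<in>S. 1 / (i - j) * (1 / euler (S - {j}) j))"
    by (subst sum.reindex) (auto simp: inj_on_def 1 2 intro!: sum.cong)
  also have "\<dots> = - lagrange_sum (\<Omega> - S - {i}) S 0"
    unfolding lagrange_sum_def sum_negf [symmetric]
  proof (intro sum.cong HOL.refl)
    fix j assume j: "j \<in> S"
    then have "i - j \<noteq> 0" using S by auto
    then show "1 / (i - j) * (1 / euler (S - {j}) j)
        = - (j ^ 0 * (\<Prod>b\<in>\<Omega> - S - {i}. j - b) / (\<Prod>c\<in>S - {j}. j - c))"
      unfolding inverse_euler [OF j] prod by (simp add: divide_simps) (simp add: algebra_simps)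
  qed
  also have "lagrange_sum (\<Omega> - S - {i}) S 0 = icoeff (quot_fps (\<Omega> - S - {i}) S) (int (card (\<Omega> - S - {i})) + 1 - int (card S))"
    using lagrange_sum_eq [OF fin, of 0] by simp
  also have "int (card (\<Omega> - S - {i})) + 1 - int (card S) = - l"
    using card_complement [OF S(1)] card.remove [OF _ S(2)] finite_\<Omega> by simp
  finally show ?thesis .
qed

text \<open>The circle is to the left of the strand labelled \<open>i\<close>, so its label runs
  over the complement of \<open>insert i S\<close>; the crossing cancels the factor for
  \<open>i\<close> in the numerator of the Euler weight.\<close>

lemma curl_left_value:
  assumes S: "state (l - 2) S" "i \<in> \<Omega> - S"
  shows "interp ((\<epsilon> l \<star> Ident [\<E>] (l - 2)) * (Ident [\<F>] (l + 2) \<star> \<tau> (l - 2)) * (\<eta> l \<star> Ident [\<E>] (l - 2))) S [(\<E>, i)] [(\<E>, i)]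
    = icoeff (quot_fps S (\<Omega> - insert i S)) l"
proof -
  let ?U = "insert i S"
  have "S \<subseteq> \<Omega>" using S by (simp add: state_subset)
  have U: "state l ?U" using S by simp
  have fin: "finite S" "finite (\<Omega> - ?U)" using S finite_\<Omega> by (auto simp: finite_state)
  let ?AT = "(\<epsilon> l \<star> Ident [\<E>] (l - 2)) * (Ident [\<F>] (l + 2) \<star> \<tau> (l - 2))"
  have 1: "interp ?AT S [(\<E>, i)] [(\<F>, j), (\<E>, j), (\<E>, i)] = euler ?U j / (j - i)" if "j \<in> \<Omega> - ?U" for j
  proof -
    have "interp ?AT S [(\<E>, i)] [(\<F>, j), (\<E>, j), (\<E>, i)] =
      interp (\<epsilon> l \<star> Ident [\<E>] (l - 2)) S [(\<E>, i)] [(\<F>, j), (\<E>, j), (\<E>, i)]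
        * interp (Ident [\<F>] (l + 2) \<star> \<tau> (l - 2)) S [(\<F>, j), (\<E>, j), (\<E>, i)] [(\<F>, j), (\<E>, j), (\<E>, i)]"
      by (rule interp_mult_single3) (auto simp: interp_horiz dest!: nonzero_entries)
    then show ?thesis
      using S that \<open>S \<subseteq> \<Omega>\<close> by (simp add: interp_horiz entries insert_absorb)
  qed
  have 2: "interp (\<eta> l \<star> Ident [\<E>] (l - 2)) S [(\<F>, j), (\<E>, j), (\<E>, i)] [(\<E>, i)] = 1" if "j \<in> \<Omega> - ?U" for j
    using S that \<open>S \<subseteq> \<Omega>\<close> by (simp add: interp_horiz entries insert_absorb)
  have "interp (?AT * (\<eta> l \<star> Ident [\<E>] (l - 2))) S [(\<E>, i)] [(\<E>, i)]
      = (\<Sum>q\<in>(\<lambda>j. [(\<F>, j), (\<E>, j), (\<E>, i)]) ` (\<Omega> - ?U). interp ?AT S [(\<E>, i)] q * interp (\<eta> l \<star> Ident [\<E>] (l - 2)) S q [(\<E>, i)])"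
    by (rule interp_mult) (use fin in \<open>auto simp: mem_paths_Cons interp_horiz dest!: nonzero_entries\<close>)
  also have "\<dots> = (\<Sum>j\<in>\<Omega> - ?U. euler ?U j / (j - i))"
    by (subst sum.reindex) (auto simp: inj_on_def 1 2 intro!: sum.cong)
  also have "\<dots> = lagrange_sum S (\<Omega> - ?U) 0"
    unfolding lagrange_sum_def
    by (intro sum.cong HOL.refl) (use S fin in \<open>auto simp: euler_def divide_simps\<close>)
  also have "\<dots> = icoeff (quot_fps S (\<Omega> - ?U)) (int (card S) + 1 - int (card (\<Omega> - ?U)))"
    using lagrange_sum_eq [OF fin(2,1), of 0] by simp
  also have "int (card S) + 1 - int (card (\<Omega> - ?U)) = l"
    using card_complement [OF U] S fin by simp
  finally show ?thesis .
qed

lemma curl_right_sound: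
  "interp ((Ident [\<E>] l \<star> \<epsilon>' l) * (\<tau> (l - 2) \<star> Ident [\<F>] l) * (Ident [\<E>] l \<star> \<eta>' l))
    = interp (- dsum2 (- l) (\<lambda>a b. \<xi>pow l b \<star> bub_plus (int a) l))" (is "interp ?f = interp ?g")
proof (rule typed_eqI)
  show "typed [\<E>] [\<E>] l (interp ?f)"
    by (rule typed_interpI) simp_all
  show "typed [\<E>] [\<E>] l (interp ?g)"
    unfolding interp_simps by (intro typed_uminus typed_dsum2 typed_interpI) simp_all
  fix S q p
  assume S: "state l S" "S \<subseteq> \<Omega>" "q \<in> paths S [\<E>]" "p \<in> paths S [\<E>]" "endp S q = endp S p"
  then obtain i where qp: "q = [(\<E>, i)]" "p = [(\<E>, i)]" "i \<in> \<Omega> - S"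
    by (auto simp: mem_paths_Cons)
  \<comment> \<open>The series for the curl is the bubble series divided by a linear factor. The
    geometric series for this factor produces the powers of the dot.\<close>
  have F: "(1 - fps_const i * fps_X) * quot_fps (\<Omega> - S - {i}) S = quot_fps (\<Omega> - S) S"
    using quot_fps_insert_num [of "\<Omega> - S - {i}" i S] qp(3) finite_\<Omega> by (simp add: insert_absorb)
  have "interp ?g S q p = - (\<Sum>a<nat (- l + 1). icoeff (quot_fps (\<Omega> - S) S) (int a) * i ^ nat (- l - int a))"
    using S(1) qp by (simp add: interp_dsum2 interp_horiz \<xi>pow_entry bub_entry mult.commute)
  then show "interp ?f S q p = interp ?g S q p"
    using curl_right_value [OF S(1) qp(3)] icoeff_geometric' [of "quot_fps (\<Omega> - S - {i}) S" "- l" i]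
    unfolding qp F by simp
qed

lemma curl_left_sound:
  "interp ((\<epsilon> l \<star> Ident [\<E>] (l - 2)) * (Ident [\<F>] (l + 2) \<star> \<tau> (l - 2)) * (\<eta> l \<star> Ident [\<E>] (l - 2)))
    = interp (dsum2 l (\<lambda>a b. bub_minus (int a) l \<star> \<xi>pow (l - 2) b))" (is "interp ?f = interp ?g")
proof (rule typed_eqI)
  show "typed [\<E>] [\<E>] (l - 2) (interp ?f)"
    by (rule typed_interpI) simp_all
  show "typed [\<E>] [\<E>] (l - 2) (interp ?g)"
    by (intro typed_dsum2 typed_interpI) simp_all
  fix S q p
  assume S: "state (l - 2) S" "S \<subseteq> \<Omega>" "q \<in> paths S [\<E>]" "p \<in> paths S [\<E>]" "endp S q = endp S p"
  then obtain i where qp: "q = [(\<E>, i)]" "p = [(\<E>, i)]" "i \<in> \<Omega> - S"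
    by (auto simp: mem_paths_Cons)
  let ?U = "insert i S"
  have U: "state l ?U" using S qp by simp
  have F: "(1 - fps_const i * fps_X) * quot_fps S (\<Omega> - ?U) = quot_fps ?U (\<Omega> - ?U)"
    using quot_fps_insert_num [of S i "\<Omega> - ?U"] qp(3) finite_state [OF S(1)] by simp
  have "interp ?g S q p = (\<Sum>a<nat (l + 1). icoeff (quot_fps ?U (\<Omega> - ?U)) (int a) * i ^ nat (l - int a))"
    using S(1) U qp by (simp add: interp_dsum2 interp_horiz \<xi>pow_entry bub_entry)
  then show "interp ?f S q p = interp ?g S q p"
    using curl_left_value [OF S(1) qp(3)] icoeff_geometric' [of "quot_fps S (\<Omega> - ?U)" l i]
    unfolding qp F by simp
qed

end

text \<open>
  The partial fraction identity behind both decompositions: the right-hand side is the residue at infinity, and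
  for \<open>i = i'\<close> the simple pole at \<open>i\<close> contributes the second summand on the left.
\<close>

lemma cauchy_sum:
  fixes A B :: "'a::field set"
  assumes fin: "finite A" "finite B" and disj: "A \<inter> B = {}" and i: "i \<in> B" "i' \<in> B"
    and n: "n = int (card B) - 1 - int (card A)"
  shows "(\<Sum>b\<in>A. (\<Prod>s\<in>B. b - s) / (\<Prod>r\<in>A - {b}. b - r) / ((b - i) * (b - i')))
      + (if i = i' then (\<Prod>s\<in>B - {i}. i - s) / (\<Prod>r\<in>A. i - r) else 0)
    = (\<Sum>a<nat (n + 1). i ^ a * (\<Sum>b<nat (n - int a + 1). icoeff (quot_fps B A) (int b) * i' ^ nat (n - int a - int b)))"
  (is "?L = ?R")
proof -
  \<comment> \<open>\<open>H\<close> is the given series divided by the linear factors of both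
    \<open>i\<close> and \<open>i'\<close>. For different points both leave the numerator; for equal
    points one leaves the numerator and the other enters the denominator.\<close>
  obtain H where H: "quot_fps B A = (1 - fps_const i' * fps_X) * ((1 - fps_const i * fps_X) * H)"
    and L: "?L = icoeff H n"
  proof (cases "i = i'")
    case False
    let ?B = "B - {i} - {i'}"
    have B: "B = insert i' (insert i ?B)" using i by auto
    have prod: "(\<Prod>s\<in>B. b - s) = (b - i) * (b - i') * (\<Prod>s\<in>?B. b - s)" for b
      using prod.remove [of B i "\<lambda>s. b - s"] prod.remove [of "B - {i}" i' "\<lambda>s. b - s"] fin i False
      by (simp add: mult.assoc)
    have "?L = (\<Sum>b\<in>A. (\<Prod>s\<in>B. b - s) / (\<Prod>r\<in>A - {b}. b - r) / ((b - i) * (b - i')))"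
      using False by simp
    also have "\<dots> = lagrange_sum ?B A 0"
      unfolding lagrange_sum_def
    proof (rule sum.cong [OF HOL.refl])
      fix b assume "b \<in> A"
      then have "b - i \<noteq> 0" "b - i' \<noteq> 0" using disj i by auto
      then show "(\<Prod>s\<in>B. b - s) / (\<Prod>r\<in>A - {b}. b - r) / ((b - i) * (b - i'))
          = b ^ 0 * (\<Prod>s\<in>?B. b - s) / (\<Prod>r\<in>A - {b}. b - r)"
        unfolding prod by simp
    qed
    also have "\<dots> = icoeff (quot_fps ?B A) n"
    proof -
      have mem: "i' \<in> B - {i}" using i False by auto
      have "int (card ?B) = int (card B) - 2"
        using card.remove [OF fin(2) i(1)] card.remove [OF finite_Diff [OF fin(2)] mem] by linarith
      then have "int 0 + int (card ?B) + 1 - int (card A) = n" using n by linarith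
      then show ?thesis using lagrange_sum_eq [of A ?B 0] fin by simp
    qed
    finally show thesis
      using that [of "quot_fps ?B A"] quot_fps_insert_num [of ?B i A]
        quot_fps_insert_num [of "insert i ?B" i' A] fin B False by auto
  next
    case True
    let ?B = "B - {i}" and ?A = "insert i A"
    have iA: "i \<notin> A" using i disj by auto
    have prod: "(\<Prod>s\<in>B. b - s) = (b - i) * (\<Prod>s\<in>?B. b - s)" for b
      using fin i by (intro prod.remove) auto
    have prodA: "(\<Prod>r\<in>?A - {b}. b - r) = (b - i) * (\<Prod>r\<in>A - {b}. b - r)" if "b \<in> A" for b
    proof -
      have "?A - {b} = insert i (A - {b})" using that iA by auto
      then show ?thesis using fin iA by simp
    qed
    have quot: "(\<Prod>s\<in>B. b - s) / (\<Prod>r\<in>A - {b}. b - r) / ((b - i) * (b - i))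
          = (\<Prod>s\<in>?B. b - s) / (\<Prod>r\<in>?A - {b}. b - r)" if "b \<in> A" for b
    proof -
      have "b - i \<noteq> 0" using that iA by auto
      then show ?thesis unfolding prod prodA [OF that] by simp
    qed
    have "lagrange_sum ?B ?A 0 = (\<Prod>s\<in>?B. i - s) / (\<Prod>r\<in>A. i - r)
        + (\<Sum>b\<in>A. (\<Prod>s\<in>?B. b - s) / (\<Prod>r\<in>?A - {b}. b - r))"
      using fin iA by (simp add: lagrange_sum_def)
    also have "\<dots> = ?L"
      using True quot by (simp add: add.commute cong: sum.cong)
    finally have "?L = lagrange_sum ?B ?A 0" ..
    also have "\<dots> = icoeff (quot_fps ?B ?A) n"
    proof -
      have "int (card ?B) = int (card B) - 1"
        using card.remove [OF fin(2) i(1)] by linarith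
      then have "int 0 + int (card ?B) + 1 - int (card ?A) = n" using n fin iA by simp
      then show ?thesis using lagrange_sum_eq [of ?A ?B 0] fin by simp
    qed
    finally show thesis
      using that [of "quot_fps ?B ?A"] quot_fps_insert_num [of ?B i A]
        quot_fps_insert_den [of A i ?B] fin i True iA by (auto simp: insert_absorb)
  qed
  have "icoeff H n = (\<Sum>a<nat (n + 1). i ^ a * icoeff ((1 - fps_const i * fps_X) * H) (n - int a))"
    by (rule icoeff_geometric)
  also have "\<dots> = ?R"
    unfolding H icoeff_geometric' [of "(1 - fps_const i * fps_X) * H" _ i'] ..
  finally show ?thesis unfolding L .
qed

context flag_model begin

section \<open>The decompositions of EF and FE\<close>

lemma interp_dsum3:
  "interp (dsum3 n f) S q p = (\<Sum>a<nat (n + 1). \<Sum>b<nat (n - int a + 1). interp (f a b (nat (n - int a - int b))) S q p)"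
  unfolding dsum3_def interp_dsum2 by (intro sum.cong) auto

text \<open>The cap at the bottom forces \<open>j = i\<close> and the cup at the top forces
  \<open>j' = i'\<close>; the loops at bottom and top are independent of each other.\<close>

lemma EF_term_entry:
  assumes S: "state l S" and i: "i \<in> S" "i' \<in> S" and j: "j \<in> \<Omega>" "j \<in> S \<Longrightarrow> j = i" "j' \<in> \<Omega>" "j' \<in> S \<Longrightarrow> j' = i'"
  shows "interp ((\<xi>pow (l - 2) c \<star> Ident [\<F>] l) * \<eta>' l * bub_minus b l * \<epsilon>' l * (\<xi>pow (l - 2) a \<star> Ident [\<F>] l)) S
      [(\<E>, j'), (\<F>, i')] [(\<E>, j), (\<F>, i)]
    = (if i = j \<and> i' = j' then i' ^ c / euler (S - {i'}) i' * icoeff (quot_fps S (\<Omega> - S)) b * i ^ a else 0)"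
proof -
  have Om: "i \<in> \<Omega>" "i' \<in> \<Omega>" using i state_subset [OF S] by auto
  have X: "interp (\<xi>pow (l - 2) n \<star> Ident [\<F>] l) S [(\<E>, x), (\<F>, y)] [(\<E>, x), (\<F>, y)] = x ^ n"
    if "y \<in> S" "x \<in> \<Omega>" "x \<in> S \<Longrightarrow> x = y" for n x y
    using that S state_subset [OF S] by (auto simp: interp_horiz \<xi>pow_entry ident_mat_def)
  let ?q = "[(\<E>, j'), (\<F>, i')]" and ?p = "[(\<E>, j), (\<F>, i)]"
  have 1: "interp (G * (\<xi>pow (l - 2) a \<star> Ident [\<F>] l)) S ?q ?p = interp G S ?q ?p * j ^ a" for G
  proof -
    have "interp (G * (\<xi>pow (l - 2) a \<star> Ident [\<F>] l)) S ?q ?p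
      = interp G S ?q ?p * interp (\<xi>pow (l - 2) a \<star> Ident [\<F>] l) S ?p ?p"
      by (rule interp_mult_single2) (auto simp: interp_horiz dest!: nonzero_entries)
    then show ?thesis using X i j by simp
  qed
  have 2: "interp ((\<xi>pow (l - 2) c \<star> Ident [\<F>] l) * \<eta>' l) S ?q [] = j' ^ c * interp (\<eta>' l) S ?q []"
  proof -
    have "interp ((\<xi>pow (l - 2) c \<star> Ident [\<F>] l) * \<eta>' l) S ?q []
      = interp (\<xi>pow (l - 2) c \<star> Ident [\<F>] l) S ?q ?q * interp (\<eta>' l) S ?q []"
      by (rule interp_mult_single2) (auto simp: interp_horiz dest!: nonzero_entries)
    then show ?thesis using X i j by simp
  qed
  show ?thesis
    unfolding 1 using S i by (simp add: interp_mult_Nil 2 bub_entry gen_entries)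
qed

lemma FE_term_entry:
  assumes S: "state l S" and c: "c \<in> \<Omega> - S" "c' \<in> \<Omega> - S" and d: "d \<in> insert c S" "d' \<in> insert c' S"
  shows "interp ((Ident [\<F>] (l + 2) \<star> \<xi>pow l n) * \<eta> l * bub_plus b l * \<epsilon> l * (Ident [\<F>] (l + 2) \<star> \<xi>pow l m)) S
      [(\<F>, d'), (\<E>, c')] [(\<F>, d), (\<E>, c)]
    = (if d = c \<and> d' = c' then c' ^ n * icoeff (quot_fps (\<Omega> - S) S) b * euler S c * c ^ m else 0)"
proof -
  have Om: "S \<subseteq> \<Omega>" by (rule state_subset [OF S])
  have X: "interp (Ident [\<F>] (l + 2) \<star> \<xi>pow l n) S [(\<F>, x), (\<E>, y)] [(\<F>, x), (\<E>, y)] = y ^ n"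
    if "x \<in> insert y S" "y \<in> \<Omega> - S" for n x y
    using that S Om by (auto simp: interp_horiz \<xi>pow_entry ident_mat_def)
  let ?q = "[(\<F>, d'), (\<E>, c')]" and ?p = "[(\<F>, d), (\<E>, c)]"
  have 1: "interp (G * (Ident [\<F>] (l + 2) \<star> \<xi>pow l m)) S ?q ?p = interp G S ?q ?p * c ^ m" for G
  proof -
    have "interp (G * (Ident [\<F>] (l + 2) \<star> \<xi>pow l m)) S ?q ?p
      = interp G S ?q ?p * interp (Ident [\<F>] (l + 2) \<star> \<xi>pow l m) S ?p ?p"
      by (rule interp_mult_single2) (auto simp: interp_horiz dest!: nonzero_entries)
    then show ?thesis using X c d by simp
  qed
  have 2: "interp ((Ident [\<F>] (l + 2) \<star> \<xi>pow l n) * \<eta> l) S ?q [] = c' ^ n * interp (\<eta> l) S ?q []"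
  proof -
    have "interp ((Ident [\<F>] (l + 2) \<star> \<xi>pow l n) * \<eta> l) S ?q []
      = interp (Ident [\<F>] (l + 2) \<star> \<xi>pow l n) S ?q ?q * interp (\<eta> l) S ?q []"
      by (rule interp_mult_single2) (auto simp: interp_horiz dest!: nonzero_entries)
    then show ?thesis using X c d by simp
  qed
  show ?thesis
    unfolding 1 using S c by (simp add: interp_mult_Nil 2 bub_entry gen_entries)
qed

lemma \<sigma>_weighted [simp]: "weighted m (\<sigma> l) \<longleftrightarrow> m = l" "weighted m (\<sigma>' l) \<longleftrightarrow> m = l"
  by (auto simp: \<sigma>_def \<sigma>'_def)

lemma nonzero_if: "x = (if P then a else 0) \<Longrightarrow> x \<noteq> 0 \<Longrightarrow> P"
  by (cases P) simp_all

lemma \<sigma>_nonzero: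
  assumes "S \<subseteq> \<Omega>" "i \<in> S" "j \<in> \<Omega>" "j \<in> S \<Longrightarrow> j = i" "c \<in> \<Omega> - S" "d \<in> insert c S"
    and "interp (\<sigma> l) S [(\<F>, d), (\<E>, c)] [(\<E>, j), (\<F>, i)] \<noteq> 0"
  shows "j = i \<and> d = c \<or> j = c \<and> d = i"
  using nonzero_if [OF \<sigma>_entry [OF assms(1-3) _ assms(5,6)] assms(7)] assms(4) by blast

lemma \<sigma>'_nonzero:
  assumes "S \<subseteq> \<Omega>" "b \<in> \<Omega> - S" "d \<in> insert b S" "i \<in> S" "j \<in> \<Omega>" "j \<in> S \<Longrightarrow> j = i"
    and "interp (\<sigma>' l) S [(\<E>, j), (\<F>, i)] [(\<F>, d), (\<E>, b)] \<noteq> 0"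
  shows "d = b \<and> j = i \<or> d = i \<and> j = b"
  using nonzero_if [OF \<sigma>'_entry [OF assms(1-5)] assms(7)] assms(6) by blast

lemma decomp_EF_sound:
  "interp (Ident [\<E>, \<F>] l) = interp (- (\<sigma>' l * \<sigma> l)
      + dsum3 (l - 1) (\<lambda>a b c. (\<xi>pow (l - 2) c \<star> Ident [\<F>] l) * \<eta>' l * bub_minus (int b) l
                               * \<epsilon>' l * (\<xi>pow (l - 2) a \<star> Ident [\<F>] l)))" (is "interp ?f = interp (- ?g + ?h)")
proof (rule typed_eqI)
  show "typed [\<E>, \<F>] [\<E>, \<F>] l (interp ?f)" by (rule typed_interpI) simp_all
  show "typed [\<E>, \<F>] [\<E>, \<F>] l (interp (- ?g + ?h))"
    unfolding interp_simps(2,4) by (intro typed_add typed_uminus typed_dsum3 typed_interpI) simp_all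
  fix S q p
  assume S: "state l S" "S \<subseteq> \<Omega>" and paths: "q \<in> paths S [\<E>, \<F>]" "p \<in> paths S [\<E>, \<F>]" and ends: "endp S q = endp S p"
  obtain i j where p: "p = [(\<E>, j), (\<F>, i)]" "i \<in> S" "j \<in> \<Omega>" "j \<in> S \<Longrightarrow> j = i"
    using paths(2) by (auto simp: mem_paths_Cons)
  obtain i' j' where q: "q = [(\<E>, j'), (\<F>, i')]" "i' \<in> S" "j' \<in> \<Omega>" "j' \<in> S \<Longrightarrow> j' = i'"
    using paths(1) by (auto simp: mem_paths_Cons)
  have eq: "insert j' (S - {i'}) = insert j (S - {i})" using ends p q by simp
  have Om: "i \<in> \<Omega>" "i' \<in> \<Omega>" using p q S by auto
  have mid: "\<exists>c d. m = [(\<F>, d), (\<E>, c)] \<and> c \<in> \<Omega> - S \<and> d \<in> insert c S" if "m \<in> paths S [\<F>, \<E>]" for m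
    using that by (auto simp: mem_paths_Cons)
  have h: "interp ?h S q p = (if i = j \<and> i' = j' then 1 / euler (S - {i'}) i' *
      (\<Sum>a<nat (l - 1 + 1). i ^ a * (\<Sum>b<nat (l - 1 - int a + 1). icoeff (quot_fps S (\<Omega> - S)) (int b) * i' ^ nat (l - 1 - int a - int b))) else 0)"
    unfolding interp_dsum3 p(1) q(1) using p(2-) q(2-)
    by (auto simp: EF_term_entry [OF S(1)] sum_distrib_left sum_distrib_right mult_ac intro!: sum.neutral)
  show "interp ?f S q p = interp (- ?g + ?h) S q p"
  proof (cases "i = j")
    \<comment> \<open>The path does not return to \<open>S\<close>, so no cap applies to it. Then
      \<open>p = q\<close>, only one path lies between \<open>\<sigma>\<close> and
      \<open>\<sigma>'\<close>, and minus their product is already 1.\<close>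
    case False
    then have j: "j \<notin> S" using p by auto
    then have "i' = i" "j' = j" using eq p q False by (auto simp: set_eq_iff)
    then have qp: "q = p" using p q by simp
    have "interp ?g S q p = interp (\<sigma>' l) S p [(\<F>, i), (\<E>, j)] * interp (\<sigma> l) S [(\<F>, i), (\<E>, j)] p"
      unfolding qp
    proof (rule interp_mult_single)
      fix m assume "m \<in> paths S (cod_word (\<sigma> l))" and nz: "interp (\<sigma> l) S m p \<noteq> 0"
      then obtain c d where m: "m = [(\<F>, d), (\<E>, c)]" "c \<in> \<Omega> - S" "d \<in> insert c S"
        using mid [of m] by auto
      show "m = [(\<F>, i), (\<E>, j)]"
        using \<sigma>_nonzero [OF S(2) p(2-4) m(2,3) nz [unfolded p(1) m(1)]] False m(1) by auto
    qed simp
    also have "interp (\<sigma> l) S [(\<F>, i), (\<E>, j)] p = 1 / (i - j)"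
      using \<sigma>_entry [OF S(2) p(2-4), of j i l] p j S(1) by simp
    also have "interp (\<sigma>' l) S p [(\<F>, i), (\<E>, j)] = euler (insert j (S - {i})) i / (euler (S - {i}) i * (j - i))"
      using \<sigma>'_entry [OF S(2), of j i i j l] p j S(1) by auto
    also have "euler (insert j (S - {i})) i = euler (S - {i}) i * (i - j)\<^sup>2"
      using p j False S(2) by (intro euler_insert) auto
    also have "euler (S - {i}) i * (i - j)\<^sup>2 / (euler (S - {i}) i * (j - i)) * (1 / (i - j)) = - 1"
    proof -
      have "euler (S - {i}) i \<noteq> 0" using S(2) by (intro euler_nonzero) auto
      then show ?thesis using False by (simp add: divide_simps power2_eq_square)
    qed
    finally show ?thesis
      using h False S(1) paths(2) qp by (simp add: ident_mat_def paths_def)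
  next
    \<comment> \<open>On loops, the middle path between \<open>\<sigma>\<close> and
      \<open>\<sigma>'\<close> is any loop that adds a point outside \<open>S\<close>.
      \<open>cauchy_sum\<close> shows that the bubble terms compensate this sum up to the diagonal
      term.\<close>
    case True
    then have "insert j' (S - {i'}) = S" using eq p by auto
    then have j': "j' = i'" using q by auto
    have fin: "finite S" "finite (\<Omega> - S)" using finite_\<Omega> finite_state [OF S(1)] by auto
    let ?D = "if i = i' then (\<Prod>s\<in>S - {i}. i - s) / (\<Prod>r\<in>\<Omega> - S. i - r) else 0"
    let ?e = "euler (S - {i'}) i'"
    have "?e \<noteq> 0" using S(2) by (intro euler_nonzero) auto
    have "interp ?g S q p = (\<Sum>m\<in>(\<lambda>b. [(\<F>, b), (\<E>, b)]) ` (\<Omega> - S). interp (\<sigma>' l) S q m * interp (\<sigma> l) S m p)"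
    proof (rule interp_mult)
      fix m assume "m \<in> paths S (cod_word (\<sigma> l))" and nz: "interp (\<sigma> l) S m p \<noteq> 0"
      then obtain c d where m: "m = [(\<F>, d), (\<E>, c)]" "c \<in> \<Omega> - S" "d \<in> insert c S"
        using mid [of m] by auto
      show "m \<in> (\<lambda>b. [(\<F>, b), (\<E>, b)]) ` (\<Omega> - S)"
        using \<sigma>_nonzero [OF S(2) p(2-4) m(2,3) nz [unfolded p(1) m(1)]] True p(2) m by auto
    qed (use fin in simp_all)
    also have "\<dots> = (\<Sum>b\<in>\<Omega> - S. euler S b / (?e * (b - i')) * (1 / (b - i)))"
    proof (subst sum.reindex)
      show "inj_on (\<lambda>b. [(\<F>, b), (\<E>, b)]) (\<Omega> - S)" by (auto simp: inj_on_def)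
      show "(\<Sum>b\<in>\<Omega> - S. ((\<lambda>m. interp (\<sigma>' l) S q m * interp (\<sigma> l) S m p) \<circ> (\<lambda>b. [(\<F>, b), (\<E>, b)])) b)
          = (\<Sum>b\<in>\<Omega> - S. euler S b / (?e * (b - i')) * (1 / (b - i)))"
      proof (rule sum.cong [OF HOL.refl])
        fix b assume b: "b \<in> \<Omega> - S"
        have "interp (\<sigma> l) S [(\<F>, b), (\<E>, b)] p = 1 / (b - i)"
          using \<sigma>_entry [OF S(2) p(2-4) b, of b l] True S(1) unfolding p(1) by simp
        moreover have "interp (\<sigma>' l) S q [(\<F>, b), (\<E>, b)] = euler S b / (?e * (b - i'))"
          using \<sigma>'_entry [OF S(2) b _ q(2-4), of b l] j' S(1) q(2) unfolding q(1) by (simp add: insert_absorb)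
        ultimately show "((\<lambda>m. interp (\<sigma>' l) S q m * interp (\<sigma> l) S m p) \<circ> (\<lambda>b. [(\<F>, b), (\<E>, b)])) b
            = euler S b / (?e * (b - i')) * (1 / (b - i))" by simp
      qed
    qed
    also have "\<dots> = 1 / ?e * (\<Sum>b\<in>\<Omega> - S. euler S b / ((b - i) * (b - i')))"
      unfolding sum_distrib_left by (intro sum.cong) (auto simp: mult_ac)
    also have "(\<Sum>b\<in>\<Omega> - S. euler S b / ((b - i) * (b - i')))
        = (\<Sum>b\<in>\<Omega> - S. (\<Prod>s\<in>S. b - s) / (\<Prod>r\<in>\<Omega> - S - {b}. b - r) / ((b - i) * (b - i')))"
      by (simp add: euler_def)
    finally have g: "interp ?g S q p = 1 / ?e * \<dots>" .
    have disj: "(\<Omega> - S) \<inter> S = {}" by auto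
    have alg: "- (k * x) + k * (x + y) = k * y" for k x y :: 'a by (simp add: distrib_left)
    have n: "l - 1 = int (card S) - 1 - int (card (\<Omega> - S))"
      using card_complement [OF S(1)] by simp
    have h0: "interp ?h S q p = 1 / ?e * (\<Sum>a<nat (l - 1 + 1). i ^ a * (\<Sum>b<nat (l - 1 - int a + 1).
        icoeff (quot_fps S (\<Omega> - S)) (int b) * i' ^ nat (l - 1 - int a - int b)))"
      using h True j' by (simp only: simp_thms if_True)
    note h' = h0 [unfolded cauchy_sum [OF fin(2,1) disj p(2) q(2) n, symmetric]]
    have "interp (- ?g + ?h) S q p = 1 / ?e * ?D"
      unfolding interp_simps(2,4) g h' by (rule alg)
    also have "\<dots> = (if i = i' then 1 else 0)"
    proof -
      have "\<Omega> - (S - {i'}) - {i'} = \<Omega> - S" using q(2) by auto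
      then have "?D = (if i = i' then ?e else 0)" by (auto simp: euler_def)
      then show ?thesis using \<open>?e \<noteq> 0\<close> by simp
    qed
    also have "\<dots> = interp ?f S q p"
    proof -
      have "interp ?f S q p = (if q = p then 1 else 0)"
        using S(1) paths(2) by (simp add: ident_mat_def paths_def)
      moreover have "q = p \<longleftrightarrow> i = i'" unfolding p(1) q(1) True j' by auto
      ultimately show ?thesis by simp
    qed
    finally show ?thesis ..
  qed
qed

text \<open>The argument of \<open>decomp_EF_sound\<close> with \<open>S\<close> and its complement
  exchanged.\<close>

lemma decomp_FE_sound:
  "interp (Ident [\<F>, \<E>] l) = interp (- (\<sigma> l * \<sigma>' l)
      + dsum3 (- l - 1) (\<lambda>a b c. (Ident [\<F>] (l + 2) \<star> \<xi>pow l c) * \<eta> l * bub_plus (int b) l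
                                 * \<epsilon> l * (Ident [\<F>] (l + 2) \<star> \<xi>pow l a)))" (is "interp ?f = interp (- ?g + ?h)")
proof (rule typed_eqI)
  show "typed [\<F>, \<E>] [\<F>, \<E>] l (interp ?f)" by (rule typed_interpI) simp_all
  show "typed [\<F>, \<E>] [\<F>, \<E>] l (interp (- ?g + ?h))"
    unfolding interp_simps(2,4) by (intro typed_add typed_uminus typed_dsum3 typed_interpI) simp_all
  fix S q p
  assume S: "state l S" "S \<subseteq> \<Omega>" and paths: "q \<in> paths S [\<F>, \<E>]" "p \<in> paths S [\<F>, \<E>]" and ends: "endp S q = endp S p"
  obtain c d where p: "p = [(\<F>, d), (\<E>, c)]" "c \<in> \<Omega> - S" "d \<in> insert c S"
    using paths(2) by (auto simp: mem_paths_Cons)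
  obtain c' d' where q: "q = [(\<F>, d'), (\<E>, c')]" "c' \<in> \<Omega> - S" "d' \<in> insert c' S"
    using paths(1) by (auto simp: mem_paths_Cons)
  have eq: "insert c' S - {d'} = insert c S - {d}" using ends p q by simp
  have mid: "\<exists>i j. m = [(\<E>, j), (\<F>, i)] \<and> i \<in> S \<and> j \<in> \<Omega> \<and> (j \<in> S \<longrightarrow> j = i)" if "m \<in> paths S [\<E>, \<F>]" for m
    using that by (auto simp: mem_paths_Cons)
  have h: "interp ?h S q p = (if d = c \<and> d' = c' then euler S c *
      (\<Sum>a<nat (- l - 1 + 1). c ^ a * (\<Sum>b<nat (- l - 1 - int a + 1). icoeff (quot_fps (\<Omega> - S) S) (int b) * c' ^ nat (- l - 1 - int a - int b))) else 0)"
    unfolding interp_dsum3 p(1) q(1) using p(2-) q(2-)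
    by (auto simp: FE_term_entry [OF S(1)] sum_distrib_left sum_distrib_right mult_ac intro!: sum.neutral)
  show "interp ?f S q p = interp (- ?g + ?h) S q p"
  proof (cases "d = c")
    case False
    then have d: "d \<in> S" using p by auto
    then have "c' = c" "d' = d" using eq p q False by (auto simp: set_eq_iff)
    then have qp: "q = p" using p q by simp
    have "interp ?g S q p = interp (\<sigma> l) S p [(\<E>, c), (\<F>, d)] * interp (\<sigma>' l) S [(\<E>, c), (\<F>, d)] p"
      unfolding qp
    proof (rule interp_mult_single)
      fix m assume "m \<in> paths S (cod_word (\<sigma>' l))" and nz: "interp (\<sigma>' l) S m p \<noteq> 0"
      then obtain i j where m: "m = [(\<E>, j), (\<F>, i)]" "i \<in> S" "j \<in> \<Omega>" "j \<in> S \<Longrightarrow> j = i"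
        using mid [of m] by auto
      show "m = [(\<E>, c), (\<F>, d)]"
        using \<sigma>'_nonzero [OF S(2) p(2,3) m(2-) nz [unfolded p(1) m(1)]] False m(1) by auto
    qed simp
    also have "interp (\<sigma> l) S p [(\<E>, c), (\<F>, d)] = 1 / (d - c)"
      using \<sigma>_entry [OF S(2) d, of c c d l] p S(1) by auto
    also have "interp (\<sigma>' l) S [(\<E>, c), (\<F>, d)] p = euler (insert c (S - {d})) d / (euler (S - {d}) d * (c - d))"
      using \<sigma>'_entry [OF S(2) p(2,3) d, of c l] p S(1) by auto
    also have "euler (insert c (S - {d})) d = euler (S - {d}) d * (d - c)\<^sup>2"
      using p d False S(2) by (intro euler_insert) auto
    also have "1 / (d - c) * (euler (S - {d}) d * (d - c)\<^sup>2 / (euler (S - {d}) d * (c - d))) = - 1"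
    proof -
      have "euler (S - {d}) d \<noteq> 0" using S(2) by (intro euler_nonzero) auto
      then show ?thesis using False by (simp add: divide_simps power2_eq_square)
    qed
    finally show ?thesis
      using h False S(1) paths(2) qp by (simp add: ident_mat_def paths_def)
  next
    case True
    then have "insert c' S - {d'} = S" using eq p by auto
    then have d': "d' = c'" using q by auto
    have fin: "finite S" "finite (\<Omega> - S)" using finite_\<Omega> finite_state [OF S(1)] by auto
    let ?D = "if c = c' then (\<Prod>s\<in>\<Omega> - S - {c}. c - s) / (\<Prod>r\<in>S. c - r) else 0"
    let ?e = "euler S c"
    have "?e \<noteq> 0" using S(2) p by (intro euler_nonzero) auto
    have "interp ?g S q p = (\<Sum>m\<in>(\<lambda>i. [(\<E>, i), (\<F>, i)]) ` S. interp (\<sigma> l) S q m * interp (\<sigma>' l) S m p)"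
    proof (rule interp_mult)
      fix m assume "m \<in> paths S (cod_word (\<sigma>' l))" and nz: "interp (\<sigma>' l) S m p \<noteq> 0"
      then obtain i j where m: "m = [(\<E>, j), (\<F>, i)]" "i \<in> S" "j \<in> \<Omega>" "j \<in> S \<Longrightarrow> j = i"
        using mid [of m] by auto
      show "m \<in> (\<lambda>i. [(\<E>, i), (\<F>, i)]) ` S"
        using \<sigma>'_nonzero [OF S(2) p(2,3) m(2-) nz [unfolded p(1) m(1)]] True p(2) m by auto
    qed (use fin in simp_all)
    also have "\<dots> = (\<Sum>i\<in>S. 1 / (c' - i) * (?e / (euler (S - {i}) i * (c - i))))"
    proof (subst sum.reindex)
      show "inj_on (\<lambda>i. [(\<E>, i), (\<F>, i)]) S" by (auto simp: inj_on_def)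
      show "(\<Sum>i\<in>S. ((\<lambda>m. interp (\<sigma> l) S q m * interp (\<sigma>' l) S m p) \<circ> (\<lambda>i. [(\<E>, i), (\<F>, i)])) i)
          = (\<Sum>i\<in>S. 1 / (c' - i) * (?e / (euler (S - {i}) i * (c - i))))"
      proof (rule sum.cong [OF HOL.refl])
        fix i assume i: "i \<in> S"
        then have "i \<in> \<Omega>" using S(2) by auto
        have "interp (\<sigma> l) S q [(\<E>, i), (\<F>, i)] = 1 / (c' - i)"
          using \<sigma>_entry [OF S(2) i \<open>i \<in> \<Omega>\<close> HOL.refl q(2,3), of l] d' S(1) unfolding q(1) by simp
        moreover have "interp (\<sigma>' l) S [(\<E>, i), (\<F>, i)] p = ?e / (euler (S - {i}) i * (c - i))"
          using \<sigma>'_entry [OF S(2) p(2,3) i \<open>i \<in> \<Omega>\<close> HOL.refl, of l] True S(1) i unfolding p(1) by (simp add: insert_absorb)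
        ultimately show "((\<lambda>m. interp (\<sigma> l) S q m * interp (\<sigma>' l) S m p) \<circ> (\<lambda>i. [(\<E>, i), (\<F>, i)])) i
            = 1 / (c' - i) * (?e / (euler (S - {i}) i * (c - i)))" by simp
      qed
    qed
    also have "\<dots> = ?e * (\<Sum>b\<in>S. (\<Prod>s\<in>\<Omega> - S. b - s) / (\<Prod>r\<in>S - {b}. b - r) / ((b - c) * (b - c')))"
      unfolding sum_distrib_left
    proof (rule sum.cong [OF HOL.refl])
      fix i assume i: "i \<in> S"
      have "(c - i) * (c' - i) = (i - c) * (i - c')" by (simp add: algebra_simps)
      moreover have "1 / (c' - i) * (?e / (euler (S - {i}) i * (c - i))) = ?e * (1 / euler (S - {i}) i / ((c - i) * (c' - i)))"
        by (simp only: times_divide_times_eq times_divide_eq_right divide_divide_eq_left mult_1 mult_1_right mult_ac)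
      ultimately have "1 / (c' - i) * (?e / (euler (S - {i}) i * (c - i))) = ?e * (1 / euler (S - {i}) i / ((i - c) * (i - c')))"
        by (simp only:)
      then show "1 / (c' - i) * (?e / (euler (S - {i}) i * (c - i))) =
          ?e * ((\<Prod>s\<in>\<Omega> - S. i - s) / (\<Prod>r\<in>S - {i}. i - r) / ((i - c) * (i - c')))"
        unfolding inverse_euler [OF i] .
    qed
    finally have g: "interp ?g S q p = \<dots>" .
    have disj: "S \<inter> (\<Omega> - S) = {}" by auto
    have alg: "- (k * x) + k * (x + y) = k * y" for k x y :: 'a by (simp add: distrib_left)
    have n: "- l - 1 = int (card (\<Omega> - S)) - 1 - int (card S)"
      using card_complement [OF S(1)] by simp
    have h0: "interp ?h S q p = ?e * (\<Sum>a<nat (- l - 1 + 1). c ^ a * (\<Sum>b<nat (- l - 1 - int a + 1).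
        icoeff (quot_fps (\<Omega> - S) S) (int b) * c' ^ nat (- l - 1 - int a - int b)))"
      using h True d' by (simp only: simp_thms if_True)
    note h' = h0 [unfolded cauchy_sum [OF fin(1,2) disj p(2) q(2) n, symmetric]]
    have "interp (- ?g + ?h) S q p = ?e * ?D"
      unfolding interp_simps(2,4) g h' by (rule alg)
    also have "\<dots> = (if c = c' then 1 else 0)"
      using \<open>?e \<noteq> 0\<close> by (auto simp: euler_def)
    also have "\<dots> = interp ?f S q p"
    proof -
      have "interp ?f S q p = (if q = p then 1 else 0)"
        using S(1) paths(2) by (simp add: ident_mat_def paths_def)
      moreover have "q = p \<longleftrightarrow> c = c'" unfolding p(1) q(1) True d' by auto
      ultimately show ?thesis by simp
    qed
    finally show ?thesis ..
  qed
qed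

lemma interp_dec_rel: "f \<approx>\<^sub>d g \<Longrightarrow> interp f = interp g"
  by (induction rule: dec_rel.induct) (rule curl_right_sound curl_left_sound decomp_EF_sound decomp_FE_sound)+

text \<open>Contrapositively, one differing matrix entry shows that two diagrams represent different
  2-morphisms.\<close>

theorem interp_sound: "f \<approx> g \<Longrightarrow> interp f = interp g"
  by (induction rule: eqU.induct)
    (simp_all add: interp_linear_rel interp_cat_rel interp_adj_rel interp_bub_rel interp_nil_rel
      interp_dec_rel interp_simps(3) interp.simps(7))

end

section \<open>Calculus of 2-morphisms\<close>

lemma cls_simps:
  "cls (f + g) = cls f + cls g" "cls (f - g) = cls f - cls g" "cls (- f) = - cls f"
  "cls 0 = 0" "cls (f * g) = cls f * cls g" "cls (Scale c f) = scale c (cls f)"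
  "cls (f \<star> g) = hcomp (cls f) (cls g)"
  by (simp_all add: plus_mor.abs_eq minus_mor.abs_eq uminus_mor.abs_eq zero_mor.abs_eq times_mor.abs_eq
      scale.abs_eq hcomp.abs_eq)

lemma cls_eqI: "f \<approx> g \<Longrightarrow> cls f = cls g"
  by (simp add: mor.abs_eq_iff)

lemma cls_cases: obtains f0 where "f = cls f0"
  using mor.abs_induct [of "\<lambda>f. \<exists>f0. f = cls f0"] by blast

lemma cls_dsum: "cls (dsum f as) = (\<Sum>a\<leftarrow>as. cls (f a))"
  by (induction as) (simp_all add: dsum_def cls_simps)

lemma cls_dsum2: "cls (dsum2 n f) = (\<Sum>a<nat (n + 1). cls (f a (nat (n - int a))))"
proof -
  have "cls (dsum2 n f) = (\<Sum>a\<in>{0..n}. cls (f (nat a) (nat (n - a))))"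
    by (simp add: dsum2_def cls_dsum sum_set_upto_conv_sum_list_int [symmetric])
  also have "\<dots> = (\<Sum>a<nat (n + 1). cls (f a (nat (n - int a))))"
    by (rule sum.reindex_bij_witness [of _ int nat]) auto
  finally show ?thesis .
qed

lemma hcomp_linear:
  "hcomp (f + g) h = hcomp f h + hcomp g h" "hcomp f (g + h) = hcomp f g + hcomp f h"
  "hcomp (scale c f) g = scale c (hcomp f g)" "hcomp f (scale c g) = scale c (hcomp f g)"
  by (transfer; intro eqU.linear_rel linear_rel.intros)+

lemma scale_simps:
  "scale c (f + g) = scale c f + scale c g" "scale (c + d) f = scale c f + scale d f"
  "scale c (scale d f) = scale (c * d) f" "scale 1 f = f"
  "scale c f * g = scale c (f * g)" "f * scale c g = scale c (f * g)"
  by (transfer; intro eqU.linear_rel linear_rel.intros)+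

lemma scale_zero [simp]: "scale 0 f = 0"
  using scale_simps(2) [of 0 0 f] by simp

lemma scale_uminus: "scale (- c) f = - scale c f"
  using scale_simps(2) [of "- c" c f] by (simp add: eq_neg_iff_add_eq_0)

lemma scale_diff: "scale (c - d) f = scale c f - scale d f"
  using scale_simps(2) [of c "- d" f] by (simp add: scale_uminus)

lemma scale_zero_right [simp]: "scale c 0 = 0"
  using scale_simps(1) [of c 0 0] by simp

lemma hcomp_zero [simp]: "hcomp 0 f = 0" "hcomp f 0 = 0"
  using hcomp_linear(1) [of 0 0 f] hcomp_linear(2) [of f 0 0] by simp_all

lemma hcomp_uminus: "hcomp (- f) g = - hcomp f g" "hcomp f (- g) = - hcomp f g"
  using hcomp_linear(1) [of "- f" f g] hcomp_linear(2) [of f "- g" g]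
  by (simp_all add: eq_neg_iff_add_eq_0)

lemma hcomp_diff: "hcomp (f - g) h = hcomp f h - hcomp g h" "hcomp f (g - h) = hcomp f g - hcomp f h"
  using hcomp_linear(1) [of f "- g" h] hcomp_linear(2) [of f g "- h"] by (simp_all add: hcomp_uminus)

lemma hcomp_assoc: "hcomp (hcomp f g) h = hcomp f (hcomp g h)"
  by transfer (intro eqU.cat_rel cat_rel.intros)

abbreviation idm :: "letter list \<Rightarrow> int \<Rightarrow> 'k::field mor" where
  "idm w l \<equiv> cls (Ident w l)"

lemma hcomp_idm: "m = tgt v l \<Longrightarrow> hcomp (idm w m) (idm v l) = idm (w @ v) l"
  using cls_eqI [OF eqU.cat_rel [OF cat_rel.horiz_ident [of w m v l]]] by (simp add: cls_simps)

lemma HOM_Gen: "cls (Gen g l) \<in> HOM (gdom g) (gcod g) l"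
  using cls_eqI [OF eqU.cat_rel [OF cat_rel.gen_dom [of g l]]] cls_eqI [OF eqU.cat_rel [OF cat_rel.gen_cod [of g l]]]
  by (simp add: HOM_def cls_simps)

lemma HOM_idm: "f \<in> HOM v w l \<Longrightarrow> idm w l * f = f" "f \<in> HOM v w l \<Longrightarrow> f * idm v l = f"
  by (simp_all add: HOM_def)

lemma hcomp_idm_Nil:
  assumes "f \<in> HOM v w l"
  shows "m = tgt v l \<Longrightarrow> hcomp (idm [] m) f = f" "hcomp f (idm [] l) = f"
proof -
  obtain f0 where f: "f = cls f0" by (rule cls_cases)
  have "hcomp (idm [] (tgt v l)) (f * idm v l) = f * idm v l"
    "hcomp (f * idm v l) (idm [] l) = f * idm v l"
    unfolding f cls_simps [symmetric]
    by (intro cls_eqI eqU.cat_rel cat_rel.intros)+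
  then show "m = tgt v l \<Longrightarrow> hcomp (idm [] m) f = f" "hcomp f (idm [] l) = f"
    using assms by (simp_all add: HOM_def)
qed

text \<open>The interchange relation of the presentation requires explicit identities between the
  factors; membership in \<open>HOM\<close> allows them to be inserted and removed.\<close>

lemma hcomp_mult:
  assumes "f \<in> HOM w u m" "f' \<in> HOM x w m" "g \<in> HOM v y l" "g' \<in> HOM z v l"
  shows "hcomp f g * hcomp f' g' = hcomp (f * f') (g * g')"
proof -
  obtain f0 f0' g0 g0' where f: "f = cls f0" "f' = cls f0'" "g = cls g0" "g' = cls g0'"
    by (metis cls_cases)
  have "hcomp ((f * idm w m) * (idm w m * f')) ((g * idm v l) * (idm v l * g'))
      = hcomp (f * idm w m) (g * idm v l) * hcomp (idm w m * f') (idm v l * g')"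
    unfolding f cls_simps [symmetric] by (intro cls_eqI eqU.cat_rel cat_rel.intros)
  then show ?thesis using assms by (simp add: HOM_def)
qed

lemma HOM_hcomp:
  assumes f: "f \<in> HOM w u m" and g: "g \<in> HOM v v' l" and m: "m = tgt v l" "m = tgt v' l"
    and words: "x = w @ v" "y = u @ v'"
  shows "hcomp f g \<in> HOM x y l"
proof -
  have "idm (u @ v') l * hcomp f g = hcomp f g"
    using hcomp_mult [OF HOM_ident f HOM_ident g] f g
    by (simp add: hcomp_idm [OF m(2), symmetric] HOM_idm)
  moreover have "hcomp f g * idm (w @ v) l = hcomp f g"
    using hcomp_mult [OF f HOM_ident g HOM_ident] f g
    by (simp add: hcomp_idm [OF m(1), symmetric] HOM_idm)
  ultimately show ?thesis by (simp add: HOM_def words)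
qed

lemma tgt_simps [simp]: "tgt [] l = l" "tgt (\<E> # w) l = tgt w l + 2" "tgt (\<F> # w) l = tgt w l - 2"
  by (simp_all add: tgt_def)

lemmas HOM_gens =
  HOM_Gen [of gXi, simplified] HOM_Gen [of gXi', simplified] HOM_Gen [of gTau, simplified]
  HOM_Gen [of gEta, simplified] HOM_Gen [of gEps, simplified]
  HOM_Gen [of gEta', simplified] HOM_Gen [of gEps', simplified]

lemma HOM_\<xi>pow: "cls (\<xi>pow l n) \<in> HOM [\<E>] [\<E>] l"
  by (induction n) (auto simp: cls_simps intro: HOM_ident HOM_mult HOM_gens)

lemma HOM_real_bub: "cls (real_bub_plus k l) \<in> HOM [] [] l" "cls (real_bub_minus k l) \<in> HOM [] [] l"
  unfolding real_bub_plus_def real_bub_minus_def cls_simps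
  by (rule HOM_mult HOM_gens HOM_hcomp [OF HOM_\<xi>pow HOM_ident] HOM_hcomp [OF HOM_ident HOM_\<xi>pow]; simp?)+

lemma HOM_sum_list: "(\<And>a. a \<in> set as \<Longrightarrow> f a \<in> HOM v w l) \<Longrightarrow> (\<Sum>a\<leftarrow>as. f a) \<in> HOM v w l"
  by (induction as) (auto intro: HOM_zero HOM_add)

lemma HOM_fake_bub_plus: "cls (fake_bub_plus m l) \<in> HOM [] [] l"
proof (induction m rule: less_induct)
  case (less m)
  then show ?case
    by (subst fake_bub_plus.simps)
      (auto simp: cls_simps cls_dsum intro!: HOM_ident HOM_uminus HOM_sum_list HOM_mult HOM_real_bub)
qed

lemma HOM_fake_bub_minus: "cls (fake_bub_minus m l) \<in> HOM [] [] l"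
proof (induction m rule: less_induct)
  case (less m)
  then show ?case
    by (subst fake_bub_minus.simps)
      (auto simp: cls_simps cls_dsum intro!: HOM_ident HOM_uminus HOM_sum_list HOM_mult HOM_real_bub)
qed

lemma HOM_bub: "cls (bub_plus k l) \<in> HOM [] [] l" "cls (bub_minus k l) \<in> HOM [] [] l"
  by (auto simp: bub_plus_def bub_minus_def cls_simps HOM_real_bub HOM_fake_bub_plus HOM_fake_bub_minus HOM_zero)

definition dotEF :: "int \<Rightarrow> nat \<Rightarrow> 'k::field mor" where
  "dotEF l n = cls (\<xi>pow (l - 2) n \<star> Ident [\<F>] l)"

lemma HOM_dotEF: "dotEF l n \<in> HOM [\<E>, \<F>] [\<E>, \<F>] l"
  unfolding dotEF_def cls_simps by (rule HOM_hcomp [OF HOM_\<xi>pow HOM_ident]) simp_all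

lemma dotEF_0: "dotEF l 0 = idm [\<E>, \<F>] l"
  by (simp add: dotEF_def cls_simps hcomp_idm)

lemma dotEF_mult: "dotEF l a * dotEF l b = (dotEF l (a + b) :: 'k::field mor)"
proof -
  have "cls (\<xi>pow m a) * cls (\<xi>pow m b) = (cls (\<xi>pow m (a + b)) :: 'k mor)" for m
    by (induction a) (simp_all add: cls_simps HOM_idm [OF HOM_\<xi>pow] mult.assoc)
  then show ?thesis
    unfolding dotEF_def cls_simps
    by (subst hcomp_mult [OF HOM_\<xi>pow HOM_\<xi>pow HOM_ident HOM_ident])
      (simp add: HOM_idm [OF HOM_ident])
qed

lemma dotEF_1: "hcomp (cls (\<xi> (l - 2))) (idm [\<F>] l) = dotEF l (Suc 0)"
  by (simp add: dotEF_def cls_simps HOM_idm [OF HOM_gens(1)])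

lemma cap_dot_cup: "cls (\<epsilon>' l) * dotEF l a * cls (\<eta>' l) = cls (bub_plus (int a - l + 1) l)"
  by (simp add: bub_plus_def real_bub_plus_def dotEF_def cls_simps)

text \<open>For \<open>c < nat l\<close> these are the projections. Larger \<open>c\<close> are
  allowed because differentiation adds a dot, even to the last projection.\<close>

definition capEF :: "int \<Rightarrow> nat \<Rightarrow> 'k::field mor" where
  "capEF l c = cls (\<epsilon>' l) * dotEF l c"

lemma cls_proj: "cls (proj l i) = (if i < nat l then capEF l i else cls (\<sigma> l))"
  by (simp add: proj_def capEF_def dotEF_def cls_simps)

lemma cls_incl:
  "i < nat l \<Longrightarrow> cls (incl l i) = (\<Sum>a<nat (l - int i). dotEF l a * cls (\<eta>' l) * cls (bub_minus (l - 1 - int i - int a) l))"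
  by (auto simp: incl_def cls_dsum2 dotEF_def cls_simps intro!: sum.cong)

lemma HOM_capEF: "capEF l c \<in> HOM [\<E>, \<F>] [] l"
  unfolding capEF_def by (rule HOM_mult [OF HOM_gens(7) HOM_dotEF])

section \<open>Duality of dotted caps and inclusions\<close>

lemma bub_zero: "k < 0 \<Longrightarrow> cls (bub_plus k l) = 0" "k < 0 \<Longrightarrow> cls (bub_minus k l) = 0"
  using cls_eqI [OF eqU.bub_rel [OF bub_rel.bub_plus_neg]] cls_eqI [OF eqU.bub_rel [OF bub_rel.bub_minus_neg]]
  by (simp_all add: cls_simps)

lemma grassmannian:
  "(\<Sum>a<nat (m + 1). cls (bub_plus (int a) l) * cls (bub_minus (m - int a) l)) = (if m = 0 then idm [] l else 0)"
proof -
  have "(\<Sum>a<nat (m + 1). cls (bub_plus (int a) l) * cls (bub_minus (m - int a) l))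
      = cls (dsum2 m (\<lambda>a b. bub_plus (int a) l * bub_minus (int b) l))"
    unfolding cls_dsum2 cls_simps by (intro sum.cong) auto
  also have "\<dots> = cls (if m = 0 then Ident [] l else 0)"
    by (rule cls_eqI [OF eqU.bub_rel [OF bub_rel.inf_grass]])
  finally show ?thesis by (simp only: cls_simps if_distrib [of cls])
qed

text \<open>Closing the strand gives products of bubbles of total index \<open>c - d\<close>. The
  summands whose clockwise bubble has negative index vanish, and the rest is the infinite
  Grassmannian sum.\<close>

lemma cap_incl:
  assumes "c < nat l" "d < nat l"
  shows "capEF l c * cls (incl l d) = (if c = d then idm [] l else (0 :: 'k::field mor))"
proof -
  let ?g = "\<lambda>i. cls (bub_plus i l) * cls (bub_minus (int c - int d - i) l) :: 'k mor"
  have "capEF l c * cls (incl l d) = (\<Sum>a<nat (l - int d). ?g (int c + int a - l + 1))"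
    unfolding cls_incl [OF assms(2)] capEF_def sum_distrib_left
  proof (intro sum.cong HOL.refl)
    fix a
    have "cls (\<epsilon>' l) * dotEF l c * (dotEF l a * cls (\<eta>' l) * cls (bub_minus (l - 1 - int d - int a) l))
        = cls (\<epsilon>' l) * dotEF l (c + a) * cls (\<eta>' l) * cls (bub_minus (l - 1 - int d - int a) l)"
      by (simp add: dotEF_mult [symmetric] mult.assoc)
    moreover have "l - 1 - int d - int a = int c - int d - (int c + int a - l + 1)" "int (c + a) - l + 1 = int c + int a - l + 1"
      by simp_all
    ultimately show "cls (\<epsilon>' l) * dotEF l c * (dotEF l a * cls (\<eta>' l) * cls (bub_minus (l - 1 - int d - int a) l))
        = ?g (int c + int a - l + 1)"
      by (simp only: cap_dot_cup)
  qed
  also have "\<dots> = (\<Sum>a\<in>{nat (l - 1 - int c)..<nat (l - int d)}. ?g (int c + int a - l + 1))"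
    by (rule sum.mono_neutral_right) (auto simp: bub_zero)
  also have "\<dots> = (\<Sum>i<nat (int c - int d + 1). ?g (int i))"
    by (rule sum.reindex_bij_witness [of _ "\<lambda>i. nat (int i + l - 1 - int c)" "\<lambda>a. nat (int c + int a - l + 1)"])
      (use assms in auto)
  also have "\<dots> = (if int c - int d = 0 then idm [] l else 0)"
    by (rule grassmannian)
  finally show ?thesis by simp
qed

lemma dot_crossing:
  "cls (\<tau> l) * hcomp (cls (\<xi> (l + 2))) (idm [\<E>] l) - hcomp (idm [\<E>] (l + 2)) (cls (\<xi> l)) * cls (\<tau> l) = idm [\<E>, \<E>] l"
  "hcomp (cls (\<xi> (l + 2))) (idm [\<E>] l) * cls (\<tau> l) - cls (\<tau> l) * hcomp (idm [\<E>] (l + 2)) (cls (\<xi> l)) = idm [\<E>, \<E>] l"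
  unfolding cls_simps [symmetric] by (intro cls_eqI eqU.nil_rel nil_rel.intros)+

lemma curl_right_zero:
  assumes "l > 0"
  shows "hcomp (idm [\<E>] l) (cls (\<epsilon>' l)) * hcomp (cls (\<tau> (l - 2))) (idm [\<F>] l)
           * hcomp (idm [\<E>] l) (cls (\<eta>' l)) = 0"
proof -
  have "cls ((Ident [\<E>] l \<star> \<epsilon>' l) * (\<tau> (l - 2) \<star> Ident [\<F>] l) * (Ident [\<E>] l \<star> \<eta>' l))
      = cls (- dsum2 (- l) (\<lambda>a b. \<xi>pow l b \<star> bub_plus (int a) l))"
    by (rule cls_eqI [OF eqU.dec_rel [OF dec_rel.curl_right]])
  also have "\<dots> = 0"
    using assms by (simp only: cls_simps cls_dsum2) simp
  finally show ?thesis by (simp add: cls_simps)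
qed

section \<open>Sideways crossings on four strands and dotted curls\<close>

definition flank :: "int \<Rightarrow> 'k::field mor \<Rightarrow> 'k mor" where
  "flank l f = hcomp (idm [\<F>] (l + 2)) (hcomp f (idm [\<F>] l))"

lemma HOM_flank: "f \<in> HOM [\<E>, \<E>] [\<E>, \<E>] (l - 2) \<Longrightarrow> flank l f \<in> HOM [\<F>, \<E>, \<E>, \<F>] [\<F>, \<E>, \<E>, \<F>] l"
  unfolding flank_def by (rule HOM_hcomp [OF HOM_ident HOM_hcomp [OF _ HOM_ident]]) simp_all

lemma flank_mult:
  assumes "f \<in> HOM [\<E>, \<E>] [\<E>, \<E>] (l - 2)" "g \<in> HOM [\<E>, \<E>] [\<E>, \<E>] (l - 2)"
  shows "flank l (f * g) = flank l f * flank l g"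
proof -
  have *: "hcomp h (idm [\<F>] l) \<in> HOM [\<E>, \<E>, \<F>] [\<E>, \<E>, \<F>] l" if "h \<in> HOM [\<E>, \<E>] [\<E>, \<E>] (l - 2)" for h :: "'k::field mor"
    using that by (rule HOM_hcomp [OF _ HOM_ident]) simp_all
  show ?thesis
    unfolding flank_def hcomp_mult [OF HOM_ident HOM_ident * [OF assms(1)] * [OF assms(2)]]
      hcomp_mult [OF assms(1,2) HOM_ident HOM_ident]
    by (simp add: HOM_idm [OF HOM_ident])
qed

lemma flank_linear:
  "flank l (f + g) = flank l f + flank l g" "flank l (f - g) = flank l f - flank l g"
  "flank l (scale c f) = scale c (flank l f)"
  by (simp_all add: flank_def hcomp_linear hcomp_diff)

text \<open>The layers of \<open>\<sigma>\<close> and \<open>\<sigma>'\<close> on the word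
  \<open>[\<F>, \<E>, \<E>, \<F>]\<close>; unprimed caps and cups are on the right, primed ones on
  the left. A dot on the left \<open>\<E>\<close> is \<open>flank l (dotL l)\<close>, one on the
  right \<open>\<E>\<close> is \<open>dots4 l (Suc 0)\<close>.\<close>

definition "cap4 l = hcomp (idm [\<F>, \<E>] l) (cls (\<epsilon>' l))"
definition "cup4 l = hcomp (idm [\<F>, \<E>] l) (cls (\<eta>' l))"
definition "cap4' l = hcomp (cls (\<epsilon> l)) (idm [\<E>, \<F>] l)"
definition "cup4' l = hcomp (cls (\<eta> l)) (idm [\<E>, \<F>] l)"
definition "cross4 l = flank l (cls (\<tau> (l - 2)))"
definition "dotL l = hcomp (cls (\<xi> l)) (idm [\<E>] (l - 2))"
definition "dotR l = hcomp (idm [\<E>] l) (cls (\<xi> (l - 2)))"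
definition "dotFE l = hcomp (idm [\<F>] (l + 2)) (cls (\<xi> l))"
definition "dots4 l n = hcomp (idm [\<F>, \<E>] l) (dotEF l n)"

lemma HOM_dotL: "dotL l \<in> HOM [\<E>, \<E>] [\<E>, \<E>] (l - 2)"
  unfolding dotL_def by (rule HOM_hcomp [OF HOM_gens(1) HOM_ident]) simp_all

lemma HOM_dotR: "dotR l \<in> HOM [\<E>, \<E>] [\<E>, \<E>] (l - 2)"
  unfolding dotR_def by (rule HOM_hcomp [OF HOM_ident HOM_gens(1)]) simp_all

lemma HOM_dotFE: "dotFE l \<in> HOM [\<F>, \<E>] [\<F>, \<E>] l"
  unfolding dotFE_def by (rule HOM_hcomp [OF HOM_ident HOM_gens(1)]) simp_all

lemma HOM_cap4: "cap4 l \<in> HOM [\<F>, \<E>, \<E>, \<F>] [\<F>, \<E>] l"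
  unfolding cap4_def by (rule HOM_hcomp [OF HOM_ident HOM_gens(7)]) simp_all

lemma HOM_cup4: "cup4 l \<in> HOM [\<F>, \<E>] [\<F>, \<E>, \<E>, \<F>] l"
  unfolding cup4_def by (rule HOM_hcomp [OF HOM_ident HOM_gens(6)]) simp_all

lemma HOM_cap4': "cap4' l \<in> HOM [\<F>, \<E>, \<E>, \<F>] [\<E>, \<F>] l"
  unfolding cap4'_def by (rule HOM_hcomp [OF HOM_gens(5) HOM_ident]) simp_all

lemma HOM_cup4': "cup4' l \<in> HOM [\<E>, \<F>] [\<F>, \<E>, \<E>, \<F>] l"
  unfolding cup4'_def by (rule HOM_hcomp [OF HOM_gens(4) HOM_ident]) simp_all

lemma HOM_cross4: "cross4 l \<in> HOM [\<F>, \<E>, \<E>, \<F>] [\<F>, \<E>, \<E>, \<F>] l"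
  unfolding cross4_def by (rule HOM_flank [OF HOM_gens(3)])

lemma HOM_dots4: "dots4 l n \<in> HOM [\<F>, \<E>, \<E>, \<F>] [\<F>, \<E>, \<E>, \<F>] l"
  unfolding dots4_def by (rule HOM_hcomp [OF HOM_ident HOM_dotEF]) simp_all

lemma cls_\<sigma>: "cls (\<sigma> l) = cap4 l * cross4 l * cup4' l"
  by (simp add: \<sigma>_def cls_simps cap4_def cross4_def cup4'_def flank_def)

lemma cls_\<sigma>': "cls (\<sigma>' l) = cap4' l * cross4 l * cup4 l"
  by (simp add: \<sigma>'_def cls_simps cap4'_def cross4_def cup4_def flank_def)

lemma flank_dotL: "flank l (dotL l) = hcomp (dotFE l) (idm [\<E>, \<F>] l)"
  by (simp add: flank_def dotL_def dotFE_def hcomp_assoc hcomp_idm)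

lemma flank_dotR: "flank l (dotR l) = dots4 l (Suc 0)"
proof -
  have "flank l (dotR l) = hcomp (hcomp (idm [\<F>] (l + 2)) (idm [\<E>] l)) (dotEF l (Suc 0))"
    by (simp add: flank_def dotR_def hcomp_assoc dotEF_1)
  then show ?thesis by (simp add: hcomp_idm dots4_def)
qed

lemma flank_ident: "flank l (idm [\<E>, \<E>] (l - 2)) = idm [\<F>, \<E>, \<E>, \<F>] l"
  by (simp add: flank_def hcomp_idm)

lemma dots4_mult: "dots4 l a * dots4 l b = dots4 l (a + b)"
  unfolding dots4_def hcomp_mult [OF HOM_ident HOM_ident HOM_dotEF HOM_dotEF]
  by (simp add: HOM_idm [OF HOM_ident] dotEF_mult)

lemma cross4_dot:
  "cross4 l * flank l (dotL l) = dots4 l (Suc 0) * cross4 l + idm [\<F>, \<E>, \<E>, \<F>] l"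
  "flank l (dotL l) * cross4 l = cross4 l * dots4 l (Suc 0) + idm [\<F>, \<E>, \<E>, \<F>] l"
proof -
  have "cls (\<tau> (l - 2)) * dotL l - dotR l * cls (\<tau> (l - 2)) = idm [\<E>, \<E>] (l - 2)"
    "dotL l * cls (\<tau> (l - 2)) - cls (\<tau> (l - 2)) * dotR l = idm [\<E>, \<E>] (l - 2)"
    using dot_crossing [of "l - 2"] by (simp_all add: dotL_def dotR_def)
  from this [THEN arg_cong [of _ _ "flank l"]]
  show "cross4 l * flank l (dotL l) = dots4 l (Suc 0) * cross4 l + idm [\<F>, \<E>, \<E>, \<F>] l"
    "flank l (dotL l) * cross4 l = cross4 l * dots4 l (Suc 0) + idm [\<F>, \<E>, \<E>, \<F>] l"
    by (simp_all add: flank_linear flank_mult HOM_dotL HOM_dotR HOM_gens flank_dotR flank_ident cross4_def diff_eq_eq add.commute)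
qed

text \<open>The dot lies on a strand that the cap does not touch, so it passes by the interchange
  law.\<close>

lemma cap4_dotL: "cap4 l * flank l (dotL l) = dotFE l * cap4 l"
proof -
  have "cap4 l * flank l (dotL l) = hcomp (dotFE l) (cls (\<epsilon>' l))"
    unfolding cap4_def flank_dotL hcomp_mult [OF HOM_ident HOM_dotFE HOM_gens(7) HOM_ident]
    by (simp add: HOM_idm [OF HOM_dotFE] HOM_idm [OF HOM_gens(7)])
  also have "\<dots> = hcomp (dotFE l) (idm [] l) * cap4 l"
    unfolding cap4_def hcomp_mult [OF HOM_dotFE HOM_ident HOM_ident HOM_gens(7)]
    by (simp add: HOM_idm [OF HOM_dotFE] HOM_idm [OF HOM_gens(7)])
  finally show ?thesis by (simp add: hcomp_idm_Nil [OF HOM_dotFE])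
qed

lemma dotL_cup4: "flank l (dotL l) * cup4 l = cup4 l * dotFE l"
proof -
  have "flank l (dotL l) * cup4 l = hcomp (dotFE l) (cls (\<eta>' l))"
    unfolding cup4_def flank_dotL hcomp_mult [OF HOM_dotFE HOM_ident HOM_ident HOM_gens(6)]
    by (simp add: HOM_idm [OF HOM_dotFE] HOM_idm [OF HOM_gens(6)])
  also have "\<dots> = cup4 l * hcomp (dotFE l) (idm [] l)"
    unfolding cup4_def hcomp_mult [OF HOM_ident HOM_dotFE HOM_gens(6) HOM_ident]
    by (simp add: HOM_idm [OF HOM_dotFE] HOM_idm [OF HOM_gens(6)])
  finally show ?thesis by (simp add: hcomp_idm_Nil [OF HOM_dotFE])
qed

lemma cap4_dots4: "cap4 l * dots4 l c = hcomp (idm [\<F>, \<E>] l) (capEF l c)"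
  unfolding cap4_def dots4_def hcomp_mult [OF HOM_ident HOM_ident HOM_gens(7) HOM_dotEF]
  by (simp add: HOM_idm [OF HOM_ident] capEF_def)

text \<open>Without a crossing, cap and cup close to a bubble of index \<open>c - l + 1\<close>,
  which is negative here.\<close>

lemma cap4_dots4_cup4:
  assumes "int c < l - 1"
  shows "cap4 l * dots4 l c * cup4 l = 0"
proof -
  have "cap4 l * dots4 l c * cup4 l = hcomp (idm [\<F>, \<E>] l) (capEF l c * cls (\<eta>' l))"
    unfolding cap4_dots4 unfolding cup4_def hcomp_mult [OF HOM_ident HOM_ident HOM_capEF HOM_gens(6)]
    by (simp add: HOM_idm [OF HOM_ident])
  then show ?thesis using assms by (simp add: capEF_def cap_dot_cup bub_zero)
qed

text \<open>Splitting off the \<open>\<F>\<close>-strand on the left leaves a curl, which is 0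
  because its sum of bubbles is empty for \<open>l > 0\<close>.\<close>

lemma cap4_cross4_cup4:
  assumes "l > 0"
  shows "cap4 l * cross4 l * cup4 l = (0 :: 'k::field mor)"
proof -
  have E: "hcomp (idm [\<E>] l) (cls (\<epsilon>' l)) \<in> HOM [\<E>, \<E>, \<F>] [\<E>] l"
    by (rule HOM_hcomp [OF HOM_ident HOM_gens(7)]) simp_all
  have T: "hcomp (cls (\<tau> (l - 2))) (idm [\<F>] l) \<in> HOM [\<E>, \<E>, \<F>] [\<E>, \<E>, \<F>] l"
    by (rule HOM_hcomp [OF HOM_gens(3) HOM_ident]) simp_all
  have N: "hcomp (idm [\<E>] l) (cls (\<eta>' l)) \<in> HOM [\<E>] [\<E>, \<E>, \<F>] l"
    by (rule HOM_hcomp [OF HOM_ident HOM_gens(6)]) simp_all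
  have FE: "idm [\<F>, \<E>] l = hcomp (idm [\<F>] (l + 2)) (idm [\<E>] l)"
    by (simp add: hcomp_idm)
  have "cap4 l * cross4 l * cup4 l = hcomp (idm [\<F>] (l + 2) :: 'k mor)
      (hcomp (idm [\<E>] l) (cls (\<epsilon>' l)) * hcomp (cls (\<tau> (l - 2))) (idm [\<F>] l) * hcomp (idm [\<E>] l) (cls (\<eta>' l)))"
    unfolding cap4_def cup4_def cross4_def flank_def FE hcomp_assoc
      hcomp_mult [OF HOM_ident HOM_ident E T] hcomp_mult [OF HOM_mult [OF HOM_ident HOM_ident] HOM_ident HOM_mult [OF E T] N]
    by (simp add: HOM_idm [OF HOM_ident])
  then show ?thesis by (simp add: curl_right_zero [OF assms])
qed

text \<open>
  A dot is moved through the crossing until it leaves the curl; each step costs a term without crossing, which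
  contains a bubble of negative degree.
\<close>

lemma dotted_curl_zero:
  assumes "int c < l"
  shows "cap4 l * dots4 l c * cross4 l * cup4 l = (0 :: 'k::field mor)"
    "cap4 l * cross4 l * dots4 l c * cup4 l = (0 :: 'k mor)"
  using assms
proof (induction c)
  case 0
  have id4: "dots4 l 0 = (idm [\<F>, \<E>, \<E>, \<F>] l :: 'k mor)" by (simp add: dots4_def dotEF_0 hcomp_idm)
  {
    case 1 then show ?case
      by (simp add: cap4_cross4_cup4 id4 HOM_idm [OF HOM_cap4])
  next
    case 2 then show ?case
      by (simp add: cap4_cross4_cup4 id4 HOM_idm(2) [OF HOM_mult [OF HOM_cap4 HOM_cross4]])
  }
next
  case (Suc c)
  have s: "dots4 l (Suc c) = (dots4 l c * dots4 l (Suc 0) :: 'k mor)" "dots4 l (Suc c) = (dots4 l (Suc 0) * dots4 l c :: 'k mor)"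
    by (simp_all add: dots4_mult)
  have X1: "dots4 l (Suc 0) * cross4 l = (cross4 l * flank l (dotL l) - idm [\<F>, \<E>, \<E>, \<F>] l :: 'k mor)"
    and X2: "cross4 l * dots4 l (Suc 0) = (flank l (dotL l) * cross4 l - idm [\<F>, \<E>, \<E>, \<F>] l :: 'k mor)"
    by (simp_all add: cross4_dot)
  {
    case 1
    have "cap4 l * dots4 l (Suc c) * cross4 l * cup4 l
        = (cap4 l * dots4 l c * (dots4 l (Suc 0) * cross4 l) * cup4 l :: 'k mor)"
      unfolding s(1) by (simp only: mult.assoc)
    also have "\<dots> = cap4 l * dots4 l c * cross4 l * (flank l (dotL l) * cup4 l) - cap4 l * dots4 l c * cup4 l"
      unfolding X1 by (simp add: algebra_simps HOM_idm [OF HOM_cup4])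
    also have "\<dots> = 0"
      unfolding dotL_cup4 using Suc.IH(1) 1 by (simp add: cap4_dots4_cup4 mult.assoc [symmetric])
    finally show ?case .
  next
    case 2
    have "cap4 l * cross4 l * dots4 l (Suc c) * cup4 l
        = (cap4 l * (cross4 l * dots4 l (Suc 0)) * dots4 l c * cup4 l :: 'k mor)"
      unfolding s(2) by (simp only: mult.assoc)
    also have "\<dots> = (cap4 l * flank l (dotL l)) * cross4 l * dots4 l c * cup4 l - cap4 l * dots4 l c * cup4 l"
      unfolding X2 by (simp add: algebra_simps HOM_idm [OF HOM_dots4])
    also have "\<dots> = dotFE l * (cap4 l * cross4 l * dots4 l c * cup4 l)"
      unfolding cap4_dotL using 2 by (simp add: cap4_dots4_cup4 [unfolded mult.assoc] mult.assoc)
    also have "\<dots> = 0" using Suc.IH(2) 2 by simp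
    finally show ?case .
  }
qed

text \<open>The dotted cap and the cap inside \<open>\<sigma>'\<close> act on disjoint strands, so
  they may be exchanged. Then the right-hand strands close up to a dotted curl.\<close>

lemma cap_\<sigma>'_zero:
  assumes "int c < l"
  shows "capEF l c * cls (\<sigma>' l) = (0 :: 'k::field mor)"
proof -
  have "capEF l c * cap4' l = (hcomp (cls (\<epsilon> l)) (capEF l c) :: 'k mor)"
  proof -
    have "capEF l c * cap4' l = (hcomp (idm [] l) (capEF l c) * cap4' l :: 'k mor)"
      by (simp add: hcomp_idm_Nil [OF HOM_capEF])
    also have "\<dots> = hcomp (cls (\<epsilon> l)) (capEF l c)"
      unfolding cap4'_def hcomp_mult [OF HOM_ident HOM_gens(5) HOM_capEF HOM_ident]
      by (simp add: HOM_idm [OF HOM_gens(5)] HOM_idm [OF HOM_capEF])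
    finally show ?thesis .
  qed
  also have "\<dots> = cls (\<epsilon> l) * (cap4 l * dots4 l c)"
  proof -
    have "hcomp (cls (\<epsilon> l)) (capEF l c) = (hcomp (cls (\<epsilon> l)) (idm [] l) * hcomp (idm [\<F>, \<E>] l) (capEF l c) :: 'k mor)"
      unfolding hcomp_mult [OF HOM_gens(5) HOM_ident HOM_ident HOM_capEF]
      by (simp add: HOM_idm [OF HOM_gens(5)] HOM_idm [OF HOM_capEF])
    then show ?thesis by (simp add: hcomp_idm_Nil [OF HOM_gens(5)] cap4_dots4)
  qed
  finally have "capEF l c * cap4' l * (cross4 l * cup4 l) = (cls (\<epsilon> l) * (cap4 l * dots4 l c) * (cross4 l * cup4 l) :: 'k mor)"
    by (simp only:)
  then have "capEF l c * cls (\<sigma>' l) = (cls (\<epsilon> l) * (cap4 l * dots4 l c * cross4 l * cup4 l) :: 'k mor)"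
    unfolding cls_\<sigma>' by (simp only: mult.assoc)
  then show ?thesis by (simp add: dotted_curl_zero(1) [OF assms])
qed

text \<open>The same exchange for cups: the one inside \<open>\<sigma>\<close> is moved below the
  dotted cup, which then closes to a dotted curl.\<close>

lemma \<sigma>_cup_zero:
  assumes "int a < l"
  shows "cls (\<sigma> l) * (dotEF l a * cls (\<eta>' l)) = (0 :: 'k::field mor)"
proof -
  have X: "dotEF l a * cls (\<eta>' l) \<in> (HOM [] [\<E>, \<F>] l :: 'k mor set)"
    by (rule HOM_mult [OF HOM_dotEF HOM_gens(6)])
  have "cup4' l * (dotEF l a * cls (\<eta>' l)) = (cup4' l * hcomp (idm [] l) (dotEF l a * cls (\<eta>' l)) :: 'k mor)"
    by (simp add: hcomp_idm_Nil [OF X])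
  also have "\<dots> = hcomp (cls (\<eta> l)) (dotEF l a * cls (\<eta>' l))"
    unfolding cup4'_def hcomp_mult [OF HOM_gens(4) HOM_ident HOM_ident X]
    by (simp add: HOM_idm [OF HOM_gens(4)] HOM_idm [OF X])
  also have "\<dots> = hcomp (idm [\<F>, \<E>] l) (dotEF l a * cls (\<eta>' l)) * hcomp (cls (\<eta> l)) (idm [] l)"
    unfolding hcomp_mult [OF HOM_ident HOM_gens(4) X HOM_ident]
    by (simp add: HOM_idm [OF HOM_gens(4)] HOM_idm [OF X])
  also have "hcomp (idm [\<F>, \<E>] l) (dotEF l a * cls (\<eta>' l)) = (dots4 l a * cup4 l :: 'k mor)"
    unfolding dots4_def cup4_def hcomp_mult [OF HOM_ident HOM_ident HOM_dotEF HOM_gens(6)]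
    by (simp add: HOM_idm [OF HOM_ident])
  finally have "cap4 l * cross4 l * (cup4' l * (dotEF l a * cls (\<eta>' l)))
      = (cap4 l * cross4 l * (dots4 l a * cup4 l * hcomp (cls (\<eta> l)) (idm [] l)) :: 'k mor)"
    by (simp only:)
  then have "cls (\<sigma> l) * (dotEF l a * cls (\<eta>' l))
      = ((cap4 l * cross4 l * dots4 l a * cup4 l) * hcomp (cls (\<eta> l)) (idm [] l) :: 'k mor)"
    unfolding cls_\<sigma> by (simp only: mult.assoc)
  then show ?thesis by (simp add: dotted_curl_zero(2) [OF assms])
qed

text \<open>For \<open>l > 0\<close> the bubble sum in \<open>decomp_FE\<close> is empty.\<close>

lemma \<sigma>_\<sigma>':
  assumes "l > 0"
  shows "cls (\<sigma> l) * cls (\<sigma>' l) = (- idm [\<F>, \<E>] l :: 'k::field mor)"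
proof -
  have "idm [\<F>, \<E>] l = (- (cls (\<sigma> l) * cls (\<sigma>' l)) + 0 :: 'k mor)"
    using assms cls_eqI [OF eqU.dec_rel [OF dec_rel.decomp_FE [of l]]]
    by (simp add: cls_simps dsum3_def cls_dsum2)
  then show ?thesis by simp
qed

lemma proj_incl:
  assumes "l > 0" "i \<le> nat l" "j \<le> nat l"
  shows "cls (proj l i) * cls (incl l j) = (if i = j then idm (if i < nat l then [] else [\<F>, \<E>]) l else (0 :: 'k::field mor))"
proof (cases "j < nat l")
  case j: True
  show ?thesis
  proof (cases "i < nat l")
    case True
    then show ?thesis unfolding cls_proj if_P [OF True] cap_incl [OF True j] by simp
  next
    case False
    have "cls (\<sigma> l) * cls (incl l j) = (\<Sum>a<nat (l - int j).
        (cls (\<sigma> l) * (dotEF l a * cls (\<eta>' l))) * cls (bub_minus (l - 1 - int j - int a) l) :: 'k mor)"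
      unfolding cls_incl [OF j] by (simp add: sum_distrib_left mult.assoc)
    also have "\<dots> = 0"
      by (intro sum.neutral ballI) (simp add: \<sigma>_cup_zero)
    finally show ?thesis using False j by (auto simp: cls_proj)
  qed
next
  case False
  then have incl: "cls (incl l j) = (- cls (\<sigma>' l) :: 'k mor)" by (simp add: incl_def cls_simps)
  show ?thesis
    unfolding incl cls_proj using False assms by (auto simp: cap_\<sigma>'_zero \<sigma>_\<sigma>')
qed

text \<open>The terms of \<open>decomp_EF\<close> are grouped by the number of dots below the
  cap.\<close>

lemma incl_proj_sum:
  assumes "l > 0"
  shows "(\<Sum>i\<le>nat l. cls (incl l i) * cls (proj l i)) = (idm [\<E>, \<F>] l :: 'k::field mor)"
proof -
  have "idm [\<E>, \<F>] l = (- (cls (\<sigma>' l) * cls (\<sigma> l)) :: 'k mor) + cls (dsum3 (l - 1) (\<lambda>a b c. (\<xi>pow (l - 2) c \<star> Ident [\<F>] l) * \<eta>' l * bub_minus (int b) l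
                               * \<epsilon>' l * (\<xi>pow (l - 2) a \<star> Ident [\<F>] l)))"
    using cls_eqI [OF eqU.dec_rel [OF dec_rel.decomp_EF [of l]]] by (simp add: cls_simps)
  also have "cls (dsum3 (l - 1) (\<lambda>a b c. (\<xi>pow (l - 2) c \<star> Ident [\<F>] l) * \<eta>' l * bub_minus (int b) l
                               * \<epsilon>' l * (\<xi>pow (l - 2) a \<star> Ident [\<F>] l)))
      = (\<Sum>i<nat l. cls (incl l i) * capEF l i)"
    unfolding dsum3_def cls_dsum2
  proof (intro sum.cong)
    fix i assume "i \<in> {..<nat l}"
    then have i: "i < nat l" "nat (int (nat (l - 1 - int i)) + 1) = nat (l - int i)" "int (nat (l - 1 - int i)) = l - 1 - int i"
      by auto
    show "(\<Sum>b<nat (int (nat (l - 1 - int i)) + 1). cls ((\<xi>pow (l - 2) (nat (int (nat (l - 1 - int i)) - int b)) \<star> Ident [\<F>] l) * \<eta>' l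
            * bub_minus (int b) l * \<epsilon>' l * (\<xi>pow (l - 2) i \<star> Ident [\<F>] l))) = cls (incl l i) * capEF l i"
      unfolding cls_incl [OF i(1)] i(2,3) sum_distrib_right
      \<comment> \<open>For fixed \<open>i\<close> the bubble index and the number of dots on the
        cup add up to \<open>l - 1 - i\<close>; the two sums are indexed by one and by the
        other.\<close>
      by (rule sum.reindex_bij_witness [of _ "\<lambda>a. nat (l - 1 - int i - int a)" "\<lambda>a. nat (l - 1 - int i - int a)"])
        (auto simp: cls_simps dotEF_def capEF_def mult.assoc)
  qed simp
  also have "(\<Sum>i<nat l. cls (incl l i) * capEF l i) = (\<Sum>i<nat l. cls (incl l i) * cls (proj l i) :: 'k mor)"
    by (intro sum.cong) (simp_all add: cls_proj)
  also have "- (cls (\<sigma>' l) * cls (\<sigma> l)) = (cls (incl l (nat l)) * cls (proj l (nat l)) :: 'k mor)"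
    by (simp add: cls_proj incl_def cls_simps)
  finally have "idm [\<E>, \<F>] l = (\<Sum>i<nat l. cls (incl l i) * cls (proj l i) :: 'k mor) + cls (incl l (nat l)) * cls (proj l (nat l))"
    by (simp add: add.commute)
  then show ?thesis
    unfolding lessThan_Suc_atMost [symmetric] by simp
qed

lemma HOM_\<sigma>: "cls (\<sigma> l) \<in> HOM [\<E>, \<F>] [\<F>, \<E>] l" "cls (\<sigma>' l) \<in> HOM [\<F>, \<E>] [\<E>, \<F>] l"
  unfolding cls_\<sigma> cls_\<sigma>'
  by (rule HOM_mult [OF HOM_mult [OF HOM_cap4 HOM_cross4] HOM_cup4'] HOM_mult [OF HOM_mult [OF HOM_cap4' HOM_cross4] HOM_cup4])+

lemma HOM_proj: "cls (proj l i) \<in> HOM [\<E>, \<F>] (if i < nat l then [] else [\<F>, \<E>]) l"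
  by (simp add: cls_proj HOM_capEF HOM_\<sigma>)

lemma HOM_incl: "cls (incl l i) \<in> (HOM (if i < nat l then [] else [\<F>, \<E>]) [\<E>, \<F>] l :: 'k::field mor set)"
proof (cases "i < nat l")
  case True
  have "dotEF l a * cls (\<eta>' l) * cls (bub_minus k l) \<in> (HOM [] [\<E>, \<F>] l :: 'k mor set)" for a k
    by (rule HOM_mult [OF HOM_mult [OF HOM_dotEF HOM_gens(6)] HOM_bub(2)])
  then show ?thesis using True by (simp add: cls_incl HOM_sum)
qed (simp add: incl_def cls_simps HOM_\<sigma> HOM_uminus)

section \<open>Resolving the crossing, and sliding dots and bubbles through it\<close>

lemma cap4_cup4': "cap4 l * cup4' l = cls (\<eta> l) * cls (\<epsilon>' l)"
proof -
  have "cap4 l * cup4' l = (hcomp (cls (\<eta> l)) (cls (\<epsilon>' l)) :: 'k::field mor)"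
    unfolding cap4_def cup4'_def hcomp_mult [OF HOM_ident HOM_gens(4) HOM_gens(7) HOM_ident]
    by (simp add: HOM_idm [OF HOM_gens(4)] HOM_idm [OF HOM_gens(7)])
  also have "\<dots> = hcomp (cls (\<eta> l)) (idm [] l) * hcomp (idm [] l) (cls (\<epsilon>' l))"
    unfolding hcomp_mult [OF HOM_gens(4) HOM_ident HOM_ident HOM_gens(7)]
    by (simp add: HOM_idm [OF HOM_gens(4)] HOM_idm [OF HOM_gens(7)])
  finally show ?thesis
    by (simp add: hcomp_idm_Nil [OF HOM_gens(4)] hcomp_idm_Nil [OF HOM_gens(7)])
qed

definition "dotF l = hcomp (idm [\<E>] (l - 2)) (cls (\<xi>' l))"

lemma HOM_dotF: "dotF l \<in> HOM [\<E>, \<F>] [\<E>, \<F>] l"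
  unfolding dotF_def by (rule HOM_hcomp [OF HOM_ident HOM_gens(2)]) simp_all

lemma capEF_1: "capEF l (Suc 0) = cls (\<epsilon>' l) * dotF l"
  using cls_eqI [OF eqU.adj_rel [OF adj_rel.cyc_dot1 [of l]]]
  by (simp add: capEF_def dotF_def cls_simps dotEF_1)

text \<open>
  The dot on the outgoing \<open>\<E>\<close>-strand of the cap slides over the cap to the \<open>\<F>\<close>-strand and down to the bottom.
\<close>

lemma dotted_\<sigma>: "cap4 l * dots4 l (Suc 0) * cross4 l * cup4' l = cls (\<sigma> l) * dotF l"
proof -
  let ?Z = "hcomp (idm [\<F>, \<E>] l) (dotF l) :: 'k::field mor"
  have 1: "cap4 l * dots4 l (Suc 0) = cap4 l * ?Z"
    unfolding cap4_dots4 capEF_1 unfolding cap4_def hcomp_mult [OF HOM_ident HOM_ident HOM_gens(7) HOM_dotF]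
    by (simp add: HOM_idm [OF HOM_ident])
  have Z: "?Z = hcomp (idm [\<F>, \<E>, \<E>] (l - 2)) (cls (\<xi>' l))"
    by (simp add: dotF_def hcomp_assoc [symmetric] hcomp_idm)
  have T: "cross4 l = hcomp (hcomp (idm [\<F>] (l + 2)) (cls (\<tau> (l - 2)))) (idm [\<F>] l)"
    by (simp add: cross4_def flank_def hcomp_assoc)
  have FT: "hcomp (idm [\<F>] (l + 2)) (cls (\<tau> (l - 2))) \<in> HOM [\<F>, \<E>, \<E>] [\<F>, \<E>, \<E>] (l - 2)"
    by (rule HOM_hcomp [OF HOM_ident HOM_gens(3)]) simp_all
  have 2: "?Z * cross4 l = cross4 l * ?Z"
    unfolding Z T hcomp_mult [OF HOM_ident FT HOM_gens(2) HOM_ident] hcomp_mult [OF FT HOM_ident HOM_ident HOM_gens(2)]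
    by (simp add: HOM_idm [OF FT] HOM_idm [OF HOM_gens(2)])
  have "?Z * cup4' l = hcomp (cls (\<eta> l)) (dotF l)"
    unfolding cup4'_def hcomp_mult [OF HOM_ident HOM_gens(4) HOM_dotF HOM_ident]
    by (simp add: HOM_idm [OF HOM_gens(4)] HOM_idm [OF HOM_dotF])
  also have "\<dots> = cup4' l * hcomp (idm [] l) (dotF l)"
    unfolding cup4'_def hcomp_mult [OF HOM_gens(4) HOM_ident HOM_ident HOM_dotF]
    by (simp add: HOM_idm [OF HOM_gens(4)] HOM_idm [OF HOM_dotF])
  finally have 3: "?Z * cup4' l = cup4' l * dotF l"
    by (simp add: hcomp_idm_Nil [OF HOM_dotF])
  have "cap4 l * dots4 l (Suc 0) * cross4 l * cup4' l = cap4 l * (?Z * cross4 l) * cup4' l"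
    unfolding 1 by (simp only: mult.assoc)
  also have "\<dots> = cap4 l * cross4 l * (?Z * cup4' l)"
    unfolding 2 by (simp only: mult.assoc)
  also have "\<dots> = cls (\<sigma> l) * dotF l"
    unfolding 3 cls_\<sigma> by (simp only: mult.assoc)
  finally show ?thesis .
qed

definition "bubR l = hcomp (idm [\<F>, \<E>] l) (cls (bub_plus 1 l))"
definition "bubL l = hcomp (cls (bub_plus 1 l)) (idm [\<F>, \<E>] l)"

text \<open>The bubble is to the left of all strands, so it passes by interchange alone.\<close>

lemma \<sigma>_bubble: "cls (\<sigma> l) * hcomp (cls (bub_plus 1 l)) (idm [\<E>, \<F>] l) = bubL l * cls (\<sigma> l)"
proof -
  have "cls (\<sigma> l) * hcomp (cls (bub_plus 1 l)) (idm [\<E>, \<F>] l)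
      = (hcomp (idm [] l) (cls (\<sigma> l)) * hcomp (cls (bub_plus 1 l)) (idm [\<E>, \<F>] l) :: 'k::field mor)"
    by (simp add: hcomp_idm_Nil [OF HOM_\<sigma>(1)])
  also have "\<dots> = hcomp (cls (bub_plus 1 l)) (cls (\<sigma> l))"
    unfolding hcomp_mult [OF HOM_ident HOM_bub(1) HOM_\<sigma>(1) HOM_ident]
    by (simp add: HOM_idm [OF HOM_\<sigma>(1)] HOM_idm [OF HOM_bub(1)])
  also have "\<dots> = bubL l * hcomp (idm [] l) (cls (\<sigma> l))"
    unfolding bubL_def hcomp_mult [OF HOM_bub(1) HOM_ident HOM_ident HOM_\<sigma>(1)]
    by (simp add: HOM_idm [OF HOM_\<sigma>(1)] HOM_idm [OF HOM_bub(1)])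
  finally show ?thesis by (simp add: hcomp_idm_Nil [OF HOM_\<sigma>(1)])
qed

section \<open>The differential and the filtration\<close>

locale U_differential =
  fixes p :: nat and P :: "'k::field params" and D :: "'k mor \<Rightarrow> 'k mor"
  assumes D: "p_differential p P D"
begin

lemma D_add: "D (f + g) = D f + D g"
  and D_scale: "D (scale c f) = scale c (D f)"
  and D_mult: "D (f * g) = D f * g + f * D g"
  and D_hcomp: "D (hcomp f g) = hcomp (D f) g + hcomp f (D g)"
  and D_HOM: "f \<in> HOM v w l \<Longrightarrow> D f \<in> HOM v w l"
  using D by (simp_all add: p_differential_def image_subset_iff)

lemma D_zero [simp]: "D 0 = 0"
  using D_add [of 0 0] by simp

lemma D_idm [simp]: "D (idm w l) = 0"
  using D_mult [of "idm w l" "idm w l"] HOM_idm [OF D_HOM [OF HOM_ident]]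
  by (simp add: HOM_idm [OF HOM_ident])

lemma D_dotEF_1: "D (dotEF l (Suc 0)) = dotEF l 2"
proof -
  have "D (cls (\<xi> (l - 2))) = cls (\<xi> (l - 2)) * cls (\<xi> (l - 2))"
    using D by (simp add: p_differential_def cls_simps)
  then have "D (dotEF l (Suc 0)) = hcomp (cls (\<xi> (l - 2)) * cls (\<xi> (l - 2))) (idm [\<F>] l * idm [\<F>] l)"
    unfolding dotEF_1 [symmetric] by (simp add: D_hcomp HOM_idm [OF HOM_ident])
  also have "\<dots> = dotEF l (Suc 0) * dotEF l (Suc 0)"
    unfolding dotEF_1 [symmetric] hcomp_mult [OF HOM_gens(1) HOM_gens(1) HOM_ident HOM_ident] ..
  finally show ?thesis by (simp add: dotEF_mult numeral_2_eq_2)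
qed

lemma D_dotEF: "D (dotEF l n) = scale (of_nat n) (dotEF l (Suc n))"
proof (induction n)
  case (Suc n)
  have "dotEF l (Suc n) = dotEF l (Suc 0) * (dotEF l n :: 'k mor)"
    by (simp add: dotEF_mult)
  then show ?case
    by (simp only: D_mult D_dotEF_1 Suc) (simp add: dotEF_mult scale_simps)
qed (simp add: dotEF_0)

lemma D_cap: "D (cls (\<epsilon>' l)) = scale (px P (l - 2)) (capEF l (Suc 0)) + scale (py P (l - 2)) (cls (bub_plus 1 l) * cls (\<epsilon>' l))"
  using D by (simp add: p_differential_def cls_simps dotEF_1 capEF_def)

lemma D_capEF:
  "D (capEF l c) = scale (px P (l - 2) + of_nat c) (capEF l (Suc c)) + scale (py P (l - 2)) (cls (bub_plus 1 l) * capEF l c)"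
proof -
  have "capEF l (Suc 0) * dotEF l c = (capEF l (Suc c) :: 'k mor)"
    by (simp add: capEF_def mult.assoc dotEF_mult)
  moreover have "D (capEF l c) = D (cls (\<epsilon>' l)) * dotEF l c + scale (of_nat c) (capEF l (Suc c))"
    by (simp add: capEF_def D_mult D_dotEF scale_simps)
  ultimately show ?thesis
    by (simp add: D_cap distrib_right scale_simps mult.assoc) (simp add: capEF_def)
qed

lemma D_cap4: "D (cap4 l) = scale (px P (l - 2)) (cap4 l * dots4 l (Suc 0)) + scale (py P (l - 2)) (bubR l * cap4 l)"
proof -
  have "bubR l * cap4 l = (hcomp (idm [\<F>, \<E>] l) (cls (bub_plus 1 l) * cls (\<epsilon>' l)) :: 'k mor)"
    unfolding bubR_def cap4_def hcomp_mult [OF HOM_ident HOM_ident HOM_bub(1) HOM_gens(7)]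
    by (simp add: HOM_idm [OF HOM_ident])
  then show ?thesis
    unfolding cap4_dots4 by (simp add: cap4_def D_hcomp D_cap hcomp_linear)
qed

lemma D_cross4:
  "D (cross4 l) = scale (pa P (l - 2)) (idm [\<F>, \<E>, \<E>, \<F>] l)
     - scale (1 + pa P (l - 2)) (flank l (dotL l) * cross4 l)
     + scale (pa P (l - 2) - 1) (dots4 l (Suc 0) * cross4 l)"
proof -
  have "D (cls (\<tau> (l - 2))) = scale (pa P (l - 2)) (idm [\<E>, \<E>] (l - 2))
     - scale (1 + pa P (l - 2)) (dotL l * cls (\<tau> (l - 2)))
     + scale (pa P (l - 2) - 1) (dotR l * cls (\<tau> (l - 2)))"
    using D by (simp add: p_differential_def cls_simps dotL_def dotR_def)
  moreover have "D (cross4 l) = flank l (D (cls (\<tau> (l - 2))))"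
    by (simp add: cross4_def flank_def D_hcomp)
  ultimately show ?thesis
    by (simp add: flank_linear flank_mult HOM_dotL HOM_dotR HOM_gens flank_ident flank_dotR [symmetric] cross4_def)
qed

lemma D_cup4':
  "D (cup4' l) = - scale (px P l + 2 * py P l) (flank l (dotL l) * cup4' l)
     - scale (py P l) (cup4' l * hcomp (cls (bub_plus 1 l)) (idm [\<E>, \<F>] l))"
proof -
  have "D (cls (\<eta> l)) = - scale (px P l + 2 * py P l) (dotFE l * cls (\<eta> l)) - scale (py P l) (cls (\<eta> l) * cls (bub_plus 1 l))"
    using D by (simp add: p_differential_def cls_simps dotFE_def)
  moreover have "flank l (dotL l) * cup4' l = (hcomp (dotFE l * cls (\<eta> l)) (idm [\<E>, \<F>] l) :: 'k mor)"
    unfolding flank_dotL cup4'_def hcomp_mult [OF HOM_dotFE HOM_gens(4) HOM_ident HOM_ident]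
    by (simp add: HOM_idm [OF HOM_ident])
  moreover have "cup4' l * hcomp (cls (bub_plus 1 l)) (idm [\<E>, \<F>] l) = (hcomp (cls (\<eta> l) * cls (bub_plus 1 l)) (idm [\<E>, \<F>] l) :: 'k mor)"
    unfolding cup4'_def hcomp_mult [OF HOM_gens(4) HOM_bub(1) HOM_ident HOM_ident]
    by (simp add: HOM_idm [OF HOM_ident])
  ultimately show ?thesis
    by (simp add: cup4'_def D_hcomp hcomp_diff hcomp_uminus hcomp_linear)
qed

text \<open>A dot on the left \<open>\<E>\<close>-strand above the crossing leaves through the top,
  one on the right \<open>\<E>\<close>-strand through the cap (\<open>dotted_\<sigma>\<close>). The
  dot produced by the cup is below the crossing; moving it up to the right strand costs an uncrossed
  term. Together with the uncrossed term in the derivative of \<open>\<tau>\<close>, it makes up the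
  multiple of \<open>\<eta> \<epsilon>'\<close>.\<close>

lemma D_\<sigma>:
  "D (cls (\<sigma> l)) =
     scale (px P (l - 2) + pa P (l - 2) - 1 - px P l - 2 * py P l) (cls (\<sigma> l) * dotF l)
     - scale (1 + pa P (l - 2)) (dotFE l * cls (\<sigma> l))
     + scale (pa P (l - 2) - px P l - 2 * py P l) (cls (\<eta> l) * cls (\<epsilon>' l))
     + scale (py P (l - 2)) (bubR l * cls (\<sigma> l))
     - scale (py P l) (bubL l * cls (\<sigma> l))"
proof -
  let ?a = "pa P (l - 2)" and ?x = "px P (l - 2)" and ?z = "px P l + 2 * py P l"
  let ?A = "cap4 l :: 'k mor" and ?T = "cross4 l :: 'k mor" and ?B = "cup4' l :: 'k mor"
  let ?L = "flank l (dotL l) :: 'k mor" and ?R = "dots4 l (Suc 0) :: 'k mor"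
  let ?b = "hcomp (cls (bub_plus 1 l)) (idm [\<E>, \<F>] l) :: 'k mor"
  have "D (cls (\<sigma> l)) = D ?A * ?T * ?B + ?A * D ?T * ?B + ?A * ?T * D ?B"
    unfolding cls_\<sigma> D_mult by (simp only: distrib_right)
  also have "D ?A * ?T * ?B = scale ?x (?A * ?R * ?T * ?B) + scale (py P (l - 2)) (bubR l * cls (\<sigma> l))"
    by (simp add: D_cap4 cls_\<sigma> distrib_right scale_simps mult.assoc)
  also have "?A * D ?T * ?B = scale ?a (?A * ?B) - scale (1 + ?a) (?A * ?L * ?T * ?B) + scale (?a - 1) (?A * ?R * ?T * ?B)"
    by (simp add: D_cross4 distrib_right distrib_left left_diff_distrib right_diff_distrib scale_simps(5,6) HOM_idm [OF HOM_cap4] mult.assoc)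
  also have "?A * ?T * D ?B = - scale ?z (?A * (?T * ?L) * ?B) - scale (py P l) (cls (\<sigma> l) * ?b)"
    by (simp add: D_cup4' cls_\<sigma> right_diff_distrib scale_simps(5,6) mult.assoc)
  also have "?A * (?T * ?L) * ?B = ?A * ?R * ?T * ?B + ?A * ?B"
    unfolding cross4_dot(1) by (simp add: distrib_left distrib_right HOM_idm [OF HOM_cup4'] mult.assoc)
  also have "?A * ?L * ?T * ?B = dotFE l * cls (\<sigma> l)"
    unfolding cap4_dotL cls_\<sigma> by (simp only: mult.assoc)
  finally show ?thesis
    unfolding dotted_\<sigma> cap4_cup4' \<sigma>_bubble
    by (simp add: scale_simps(1,2) scale_diff algebra_simps)
qed

text \<open>The factors to the left of \<open>\<sigma>\<close> are recovered from
  \<open>\<sigma> \<sigma>' = - 1\<close>, and the term with \<open>\<eta> \<epsilon>'\<close>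
  disappears because the undotted cap annihilates \<open>\<sigma>'\<close>. Only the dot on the
  \<open>\<F>\<close>-strand stays between the two crossings.\<close>

lemma D_\<sigma>_\<sigma>':
  assumes "l > 0"
  shows "D (cls (\<sigma> l)) * cls (\<sigma>' l) =
     scale (px P (l - 2) + pa P (l - 2) - 1 - px P l - 2 * py P l) (cls (\<sigma> l) * dotF l * cls (\<sigma>' l))
     + scale (1 + pa P (l - 2)) (dotFE l)
     - scale (py P (l - 2)) (bubR l) + scale (py P l) (bubL l)"
proof -
  have s: "f * cls (\<sigma> l) * cls (\<sigma>' l) = - f" if "f \<in> HOM v [\<F>, \<E>] l" "v = [\<F>, \<E>]" for f :: "'k mor" and v
    using that by (simp add: mult.assoc \<sigma>_\<sigma>' [OF assms] HOM_idm)
  have R: "bubR l \<in> (HOM [\<F>, \<E>] [\<F>, \<E>] l :: 'k mor set)"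
    unfolding bubR_def by (rule HOM_hcomp [OF HOM_ident HOM_bub(1)]) simp_all
  have L: "bubL l \<in> (HOM [\<F>, \<E>] [\<F>, \<E>] l :: 'k mor set)"
    unfolding bubL_def by (rule HOM_hcomp [OF HOM_bub(1) HOM_ident]) simp_all
  have "cls (\<eta> l) * cls (\<epsilon>' l) * cls (\<sigma>' l) = (cls (\<eta> l) * (capEF l 0 * cls (\<sigma>' l)) :: 'k mor)"
    by (simp add: capEF_def dotEF_0 HOM_idm [OF HOM_gens(7)] mult.assoc)
  then have 0: "cls (\<eta> l) * cls (\<epsilon>' l) * cls (\<sigma>' l) = (0 :: 'k mor)"
    using assms by (simp add: cap_\<sigma>'_zero)
  have scale_neg: "scale c (- f) = - scale c f" for c and f :: "'k mor"
    using scale_simps(1) [of c "- f" f] by (simp add: eq_neg_iff_add_eq_0)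
  show ?thesis
    unfolding D_\<sigma> by (simp add: distrib_right left_diff_distrib scale_simps(5) s [OF R] s [OF L] s [OF HOM_dotFE] 0 scale_neg)
qed

end

section \<open>Matrix units in the endomorphism ring\<close>

lemma entry_mult:
  assumes "finite J" "k \<in> J"
  shows "entry j k f \<otimes>\<^bsub>End_ring J X l\<^esub> entry k' m g = (if k = k' then entry j m (f * g) else \<zero>\<^bsub>End_ring J X l\<^esub>)"
proof -
  have "(\<Sum>i\<in>J. (if a = j \<and> i = k then f else 0) * (if i = k' \<and> b = m then g else 0))
      = (if k = k' \<and> a = j \<and> b = m then f * g else 0)" for a b
  proof -
    have "(\<Sum>i\<in>J. (if a = j \<and> i = k then f else 0) * (if i = k' \<and> b = m then g else 0))
        = (\<Sum>i\<in>J. if i = k then (if k = k' \<and> a = j \<and> b = m then f * g else 0) else 0)"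
      by (intro sum.cong) auto
    then show ?thesis using assms by simp
  qed
  then show ?thesis by (auto simp: End_ring_def entry_def fun_eq_iff)
qed

lemma entry_carrier:
  "j \<in> J \<Longrightarrow> k \<in> J \<Longrightarrow> f \<in> HOM (X k) (X j) l \<Longrightarrow> entry j k f \<in> carrier (End_ring J X l)"
  by (auto simp: End_ring_def entry_def HOM_zero)

lemma entry_zero: "entry j k 0 = \<zero>\<^bsub>End_ring J X l\<^esub>"
  by (auto simp: End_ring_def entry_def fun_eq_iff)

lemma finsum_entry:
  assumes "finite J" "j \<in> J" "k \<in> J" "finite I" "\<And>i. i \<in> I \<Longrightarrow> f i \<in> HOM (X k) (X j) l"
  shows "(\<Oplus>\<^bsub>End_ring J X l\<^esub>i\<in>I. entry j k (f i)) = entry j k (\<Sum>i\<in>I. f i :: 'k::field mor)"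
proof -
  interpret R: ring "End_ring J X l :: ('a \<Rightarrow> 'a \<Rightarrow> 'k mor) ring"
    by (rule ring_End_ring [OF assms(1)])
  from assms(4,5) show ?thesis
  proof (induction I rule: finite_induct)
    case empty
    then show ?case by (simp add: entry_zero [of _ _ J X l])
  next
    case (insert i I)
    have "(\<Oplus>\<^bsub>End_ring J X l\<^esub>i\<in>insert i I. entry j k (f i))
        = entry j k (f i) \<oplus>\<^bsub>End_ring J X l\<^esub> (\<Oplus>\<^bsub>End_ring J X l\<^esub>i\<in>I. entry j k (f i))"
      using insert assms(2,3) by (intro R.finsum_insert) (auto intro!: entry_carrier)
    then show ?case
      using insert by (simp add: End_ring_def entry_def fun_eq_iff)
  qed
qed

lemma finite_summands: "finite (summands l)"
  by (simp add: summands_def)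

lemma EFsum_summands: "EFsum \<in> summands l"
  by (simp add: summands_def)

lemma piece_summands: "piece l i \<in> summands l"
  by (simp add: summands_def piece_def)

lemma piece_eq: "i \<le> nat l \<Longrightarrow> j \<le> nat l \<Longrightarrow> piece l i = piece l j \<longleftrightarrow> i = j"
  by (auto simp: piece_def)

lemma summand_word_piece: "summand_word (piece l i) = (if i < nat l then [] else [\<F>, \<E>])"
  by (simp add: piece_def)

context U_differential
begin

lemma D_entry: "(\<lambda>a b. D (entry j k f a b)) = entry j k (D f)"
  by (auto simp: entry_def fun_eq_iff)

lemma D_proj_incl:
  assumes "l > 0" "i \<le> nat l" "j \<le> nat l"
  shows "D (cls (proj l i)) * cls (incl l j) = - (cls (proj l i) * D (cls (incl l j)))"
proof -
  have "D (cls (proj l i) * cls (incl l j)) = 0"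
    unfolding proj_incl [OF assms] by simp
  then show ?thesis by (simp add: D_mult eq_neg_iff_add_eq_0)
qed

lemma yields_fcD:
  assumes "l > 0" "yields_fc D l" "i \<le> nat l"
  shows "D (cls (proj l i)) * cls (incl l i) = 0"
proof -
  let ?R = "End_ring (summands l) summand_word l :: (summand \<Rightarrow> summand \<Rightarrow> 'k mor) ring"
  have "entry (piece l i) EFsum (cls (proj l i)) \<otimes>\<^bsub>?R\<^esub> entry EFsum (piece l i) (D (cls (incl l i))) = \<zero>\<^bsub>?R\<^esub>"
    using assms(2,3) unfolding yields_fc_def fc_filtration_def D_entry by auto
  then have "entry (piece l i) (piece l i) (cls (proj l i) * D (cls (incl l i))) = \<zero>\<^bsub>?R\<^esub>"
    by (simp add: entry_mult finite_summands EFsum_summands)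
  then have "entry (piece l i) (piece l i) (cls (proj l i) * D (cls (incl l i))) (piece l i) (piece l i) = 0"
    by (simp add: End_ring_def)
  then have "cls (proj l i) * D (cls (incl l i)) = 0"
    by (simp add: entry_def)
  then show ?thesis using D_proj_incl [OF assms(1,3,3)] by simp
qed

text \<open>The order is that of \<open>rank\<close>. If the derivative of a projection factors
  through one earlier projection \<open>k\<close>, then orthogonality kills its product with the
  inclusion \<open>i\<close>. Moreover, the element required to lie in \<open>F_less\<close> is a
  left multiple of the \<open>k\<close>-th idempotent, so one nonzero coefficient suffices.\<close>

lemma yields_fcI:
  fixes rank :: "nat \<Rightarrow> nat"
  assumes l: "l > 0" and rank: "inj_on rank {0..nat l}"
    and step: "\<And>i. i \<le> nat l \<Longrightarrow> D (cls (proj l i)) = 0 \<or>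
      (\<exists>k\<le>nat l. rank k < rank i \<and> D (cls (proj l i)) = D (cls (proj l i)) * cls (incl l k) * cls (proj l k))"
  shows "yields_fc D l"
proof -
  let ?R = "End_ring (summands l) summand_word l :: (summand \<Rightarrow> summand \<Rightarrow> 'k mor) ring"
  let ?u = "\<lambda>i. entry EFsum (piece l i) (cls (incl l i)) :: summand \<Rightarrow> summand \<Rightarrow> 'k mor"
  let ?v = "\<lambda>i. entry (piece l i) EFsum (cls (proj l i)) :: summand \<Rightarrow> summand \<Rightarrow> 'k mor"
  define ord where "ord = {(i, j). i \<le> nat l \<and> j \<le> nat l \<and> rank i \<le> rank j}"
  interpret R: ring ?R by (rule ring_End_ring [OF finite_summands])
  note J = finite_summands [of l] EFsum_summands [of l] piece_summands [of l]
  note mult = entry_mult [OF J(1) J(2)] entry_mult [OF J(1) J(3)]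
  note zero = entry_zero [of _ _ "summands l" summand_word l]
  have pi: "cls (proj l i) * cls (incl l i) = idm (summand_word (piece l i)) l" if "i \<le> nat l" for i
    unfolding proj_incl [OF l that that] summand_word_piece by simp
  have pj: "cls (proj l i) * cls (incl l j) = (0 :: 'k mor)" if "i \<le> nat l" "j \<le> nat l" "i \<noteq> j" for i j
    unfolding proj_incl [OF l that(1,2)] using that(3) by simp
  have inc: "cls (incl l i) \<in> HOM (summand_word (piece l i)) [\<E>, \<F>] l"
    and prj: "cls (proj l i) \<in> HOM [\<E>, \<F>] (summand_word (piece l i)) l" for i
    unfolding summand_word_piece by (rule HOM_incl HOM_proj)+
  have u: "?u i \<in> carrier ?R" and v: "?v i \<in> carrier ?R" for i
    using inc prj J by (auto intro!: entry_carrier)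
  have "linear_order_on {0..nat l} ord"
    using rank unfolding ord_def
    by (auto simp: linear_order_on_def partial_order_on_def preorder_on_def refl_on_def trans_on_def trans_def
        antisym_def total_on_def inj_on_def)
  moreover have "?v i \<otimes>\<^bsub>?R\<^esub> entry EFsum (piece l i) (D (cls (incl l i))) = \<zero>\<^bsub>?R\<^esub>" if i: "i \<le> nat l" for i
  proof -
    from step [OF i] have "D (cls (proj l i)) * cls (incl l i) = 0"
    proof (elim disjE exE conjE)
      fix k assume k: "k \<le> nat l" "rank k < rank i"
        and eq: "D (cls (proj l i)) = D (cls (proj l i)) * cls (incl l k) * cls (proj l k)"
      have "cls (proj l k) * cls (incl l i) = (0 :: 'k mor)"
        using k i unfolding proj_incl [OF l k(1) i] by auto
      then show ?thesis by (subst eq) (simp add: mult.assoc)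
    qed simp
    then have "cls (proj l i) * D (cls (incl l i)) = 0"
      using D_proj_incl [OF l i i] by simp
    then show ?thesis by (simp add: mult zero)
  qed
  moreover have "?u i \<otimes>\<^bsub>?R\<^esub> entry (piece l i) EFsum (D (cls (proj l i))) \<in> F_less ?R {0..nat l} ?u ?v ord i"
    if i: "i \<le> nat l" for i
  proof -
    let ?x = "entry EFsum EFsum (cls (incl l i) * D (cls (proj l i)))"
    let ?A = "{k \<in> {0..nat l}. (k, i) \<in> ord \<and> k \<noteq> i}"
    have x: "?x \<in> carrier ?R"
      using HOM_mult [OF inc D_HOM [OF prj]] J by (intro entry_carrier) auto
    have "?x \<in> F_less ?R {0..nat l} ?u ?v ord i"
    proof (cases "D (cls (proj l i)) = 0")
      case True
      then have "?x = (\<Oplus>\<^bsub>?R\<^esub>k\<in>?A. \<zero>\<^bsub>?R\<^esub> \<otimes>\<^bsub>?R\<^esub> (?u k \<otimes>\<^bsub>?R\<^esub> ?v k))"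
        using u v by (simp add: zero R.finsum_zero)
      then show ?thesis unfolding F_less_def by (auto intro!: exI [of _ "\<lambda>_. \<zero>\<^bsub>?R\<^esub>"])
    next
      case False
      then obtain k where k: "k \<le> nat l" "rank k < rank i"
        and eq: "D (cls (proj l i)) = D (cls (proj l i)) * cls (incl l k) * cls (proj l k)"
        using step [OF i] by blast
      have kA: "k \<in> ?A" using k i by (auto simp: ord_def)
      have "?x = ?x \<otimes>\<^bsub>?R\<^esub> (?u k \<otimes>\<^bsub>?R\<^esub> ?v k)"
        by (simp add: mult) (subst eq, simp add: mult.assoc)
      also have "\<dots> = (\<Oplus>\<^bsub>?R\<^esub>m\<in>?A. if k = m then ?x \<otimes>\<^bsub>?R\<^esub> (?u m \<otimes>\<^bsub>?R\<^esub> ?v m) else \<zero>\<^bsub>?R\<^esub>)"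
        using kA x u v by (intro R.finsum_singleton [symmetric]) auto
      also have "\<dots> = (\<Oplus>\<^bsub>?R\<^esub>m\<in>?A. (if m = k then ?x else \<zero>\<^bsub>?R\<^esub>) \<otimes>\<^bsub>?R\<^esub> (?u m \<otimes>\<^bsub>?R\<^esub> ?v m))"
        using x u v by (intro R.finsum_cong') auto
      finally show ?thesis
        unfolding F_less_def using x by (intro CollectI exI [of _ "\<lambda>m. if m = k then ?x else \<zero>\<^bsub>?R\<^esub>"]) auto
    qed
    then show ?thesis by (simp add: mult)
  qed
  moreover have "entry EFsum EFsum (idm [\<E>, \<F>] l) = (\<Oplus>\<^bsub>?R\<^esub>i\<in>{0..nat l}. ?u i \<otimes>\<^bsub>?R\<^esub> ?v i)"
  proof -
    have "(\<Oplus>\<^bsub>?R\<^esub>i\<in>{0..nat l}. entry EFsum EFsum (cls (incl l i) * cls (proj l i)))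
        = entry EFsum EFsum (\<Sum>i\<in>{0..nat l}. cls (incl l i) * cls (proj l i))"
      using J HOM_mult [OF inc prj] by (intro finsum_entry) auto
    then show ?thesis
      by (simp add: mult atLeast0AtMost incl_proj_sum [OF l])
  qed
  ultimately show ?thesis
    unfolding yields_fc_def fc_filtration_def D_entry
    using u v
    by (auto simp: mult pi pj piece_eq HOM_idm [OF inc] HOM_idm [OF prj] D_entry zero mult.assoc)
qed

end

section \<open>Nondegeneracy and the main result\<close>

lemma icoeff_quot_fps_0: "icoeff (quot_fps B A) 0 = 1"
  by (simp add: icoeff_def)

lemma icoeff_quot_fps_1:
  assumes "finite A" "finite B"
  shows "icoeff (quot_fps B A) 1 = \<Sum>A - \<Sum>B"
  using assms(2)
proof (induction B rule: finite_induct)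
  case empty
  from assms(1) show ?case
  proof (induction A rule: finite_induct)
    case empty
    then show ?case by (simp add: quot_fps_def icoeff_def)
  next
    case (insert a A)
    have "icoeff (quot_fps {} A) 1 = icoeff (quot_fps {} (insert a A)) 1 - a"
      using icoeff_linear_mult [of a "quot_fps {} (insert a A)" 1]
      unfolding quot_fps_insert_den [OF insert.hyps] by (simp add: icoeff_quot_fps_0)
    then show ?case
      using insert by simp
  qed
next
  case (insert b B)
  then show ?case
    unfolding quot_fps_insert_num [OF insert.hyps] icoeff_linear_mult
    by (simp add: icoeff_quot_fps_0)
qed

context flag_model
begin

section \<open>Linear independence of dots and bubbles, as seen by the model\<close>

lemma interp_cls_eq: "cls f = cls g \<Longrightarrow> interp f = interp g"
  by (rule interp_sound) (simp add: mor.abs_eq_iff)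

lemma \<phi>_eq_0: "\<phi> c = 0 \<Longrightarrow> c = 0"
  using \<phi>_mult [of c "inverse c"] \<phi>_1 by (cases "c = 0") auto

lemma state_minus: "i \<in> \<Omega> \<Longrightarrow> l = int (card \<Omega>) - 2 \<Longrightarrow> state l (\<Omega> - {i})"
proof -
  assume i: "i \<in> \<Omega>" and l: "l = int (card \<Omega>) - 2"
  have "int (card (\<Omega> - {i})) = int (card \<Omega>) - 1"
    using card.remove [OF finite_\<Omega> i] by linarith
  then show ?thesis unfolding state_def l by auto
qed

lemma bub_1_entry:
  assumes "i \<in> \<Omega>" "l = int (card \<Omega>) - 2"
  shows "interp (bub_plus 1 l) (\<Omega> - {i}) [] [] = \<Sum>\<Omega> - 2 * i"
proof -
  have "\<Omega> - (\<Omega> - {i}) = {i}" using assms(1) by auto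
  moreover have "\<Sum>(\<Omega> - {i}) = \<Sum>\<Omega> - i"
    using finite_\<Omega> assms(1) by (simp add: sum_diff1)
  ultimately show ?thesis
    using finite_\<Omega> unfolding bub_entry(1) [OF state_minus [OF assms]] by (simp add: icoeff_quot_fps_1)
qed

text \<open>If a nonzero multiple of the bubble vanished, every point \<open>i\<close> would satisfy
  \<open>\<Sum>\<Omega> = 2 * i\<close>. Two different points then give \<open>2 = 0\<close>, and so
  \<open>\<Sum>\<Omega> = 0\<close>. The argument covers characteristic 2.\<close>

lemma scale_bub_1:
  fixes c :: 'k
  assumes l: "l = int (card \<Omega>) - 2" and "l > 0" "\<Sum>\<Omega> \<noteq> 0"
    and "scale c (cls (bub_plus 1 l)) = 0"
  shows "c = 0"
proof (rule ccontr)
  assume "c \<noteq> 0"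
  have "interp (Scale c (bub_plus 1 l)) = interp 0"
    using assms(4) by (intro interp_cls_eq) (simp add: cls_simps)
  then have *: "\<phi> c * interp (bub_plus 1 l) S [] [] = 0" for S
    by (auto simp: fun_eq_iff)
  have eq: "\<Sum>\<Omega> = 2 * i" if "i \<in> \<Omega>" for i
    using * [of "\<Omega> - {i}"] \<phi>_eq_0 [of c] \<open>c \<noteq> 0\<close> bub_1_entry [OF that l] by auto
  have "\<not> card \<Omega> \<le> 1" using assms by auto
  then obtain i j where ij: "i \<in> \<Omega>" "j \<in> \<Omega>" "i \<noteq> j"
    using finite_\<Omega> by (auto simp: card_le_Suc0_iff_eq)
  have "2 * i = 2 * j" using eq [OF ij(1)] eq [OF ij(2)] by metis
  then have "(2 :: 'a) = 0" using ij(3) by auto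
  then show False using eq [OF ij(1)] assms(3) by simp
qed

text \<open>As \<open>j \<noteq> i\<close>, only the middle path with the two steps interchanged
  contributes; there the dot has the value \<open>j\<close>, and the crossings contribute
  \<open>-1\<close>.\<close>

lemma \<sigma>_dot_\<sigma>'_entry:
  assumes S: "state l S" and i: "i \<in> \<Omega> - S" and j: "j \<in> S"
  shows "interp (\<sigma> l * (Ident [\<E>] (l - 2) \<star> \<xi>' l) * \<sigma>' l) S [(\<F>, j), (\<E>, i)] [(\<F>, j), (\<E>, i)] = - j"
proof -
  let ?Z = "Ident [\<E>] (l - 2) \<star> \<xi>' l" and ?p = "[(\<F>, j), (\<E>, i)]" and ?q = "[(\<E>, i), (\<F>, j)]"
  have Om: "S \<subseteq> \<Omega>" by (rule state_subset [OF S])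
  have ij: "i \<noteq> j" "j \<in> \<Omega>" "j \<in> insert i S" "i \<in> \<Omega>" "i \<in> S \<Longrightarrow> i = j" using i j Om by auto
  have "interp (\<sigma> l * ?Z * \<sigma>' l) S ?p ?p = interp (\<sigma> l * ?Z) S ?p ?q * interp (\<sigma>' l) S ?q ?p"
  proof (rule interp_mult_single)
    fix m assume "m \<in> paths S (cod_word (\<sigma>' l))" and nz: "interp (\<sigma>' l) S m ?p \<noteq> 0"
    then obtain x y where m: "m = [(\<E>, y), (\<F>, x)]" "x \<in> S" "y \<in> \<Omega>" "y \<in> S \<Longrightarrow> y = x"
      by (auto simp: mem_paths_Cons)
    show "m = ?q"
      using \<sigma>'_nonzero [OF Om i ij(3) m(2-) nz [unfolded m(1)]] ij(1) m(1) by auto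
  qed simp
  also have "interp (\<sigma> l * ?Z) S ?p ?q = interp (\<sigma> l) S ?p ?q * interp ?Z S ?q ?q"
    by (rule interp_mult_single2) (auto simp: interp_horiz dest!: nonzero_entries)
  also have "interp ?Z S ?q ?q = j"
    using S i j ij Om by (simp add: interp_horiz entries)
  also have "interp (\<sigma> l) S ?p ?q = 1 / (j - i)"
    using \<sigma>_entry [OF Om j ij(4,5) i ij(3), of l] S ij by simp
  also have "interp (\<sigma>' l) S ?q ?p = euler (insert i (S - {j})) j / (euler (S - {j}) j * (i - j))"
    using \<sigma>'_entry [OF Om i ij(3) j ij(4,5), of l] S ij by simp
  also have "euler (insert i (S - {j})) j = euler (S - {j}) j * (j - i)\<^sup>2"
    using i ij Om by (intro euler_insert) auto
  also have "1 / (j - i) * j * (euler (S - {j}) j * (j - i)\<^sup>2 / (euler (S - {j}) j * (i - j))) = - j"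
  proof -
    have "euler (S - {j}) j \<noteq> 0" using Om by (intro euler_nonzero) auto
    moreover define u where "u = j - i"
    moreover have "i - j = - u" "u \<noteq> 0" using ij by (auto simp: u_def)
    ultimately show ?thesis
      unfolding u_def [symmetric] \<open>i - j = - u\<close> by (simp add: power2_eq_square)
  qed
  finally show ?thesis .
qed

text \<open>
  Read off at the path that adds \<open>i\<close> to \<open>\<Omega> - {i}\<close> and then removes some \<open>j \<noteq> i\<close>: there \<open>\<sigma> \<sigma>'\<close> is \<open>-1\<close>, the dots are \<open>i\<close> and
  \<open>j\<close>, and the bubbles are \<open>\<Sum>\<Omega> - 2 i\<close> and \<open>\<Sum>\<Omega> - 2 j\<close>.
\<close>

lemma \<sigma>_condition:
  fixes \<alpha> a y y' :: 'k
  assumes l: "l = int (card \<Omega>) - 2" and "l > 0" "\<Sum>\<Omega> \<noteq> 0"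
    and eq: "scale \<alpha> (cls (\<sigma> l) * dotF l * cls (\<sigma>' l)) + scale a (dotFE l) - scale y (bubR l) + scale y' (bubL l) = 0"
  shows "\<alpha> = - 2 * y' \<and> a = - 2 * y \<and> y' = y"
proof -
  define f where "f = Scale \<alpha> (\<sigma> l * (Ident [\<E>] (l - 2) \<star> \<xi>' l) * \<sigma>' l) + Scale a (Ident [\<F>] (l + 2) \<star> \<xi> l)
      - Scale y (Ident [\<F>, \<E>] l \<star> bub_plus 1 l) + Scale y' (bub_plus 1 l \<star> Ident [\<F>, \<E>] l)"
  have "cls f = cls 0"
    using eq by (simp add: f_def cls_simps dotF_def dotFE_def bubR_def bubL_def)
  then have f0: "interp f = interp 0" by (rule interp_cls_eq)
  define s where "s = \<Sum>\<Omega>"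
  have main: "- \<phi> \<alpha> * j + \<phi> a * i - \<phi> y * (s - 2 * i) + \<phi> y' * (s - 2 * j) = 0"
    if ij: "i \<in> \<Omega>" "j \<in> \<Omega>" "i \<noteq> j" for i j
  proof -
    let ?S = "\<Omega> - {i}" and ?p = "[(\<F>, j), (\<E>, i)]"
    have S: "state l ?S" using state_minus [OF ij(1) l] .
    have S': "insert i (\<Omega> - {i}) - {j} = \<Omega> - {j}" using ij by auto
    have "interp (\<sigma> l * (Ident [\<E>] (l - 2) \<star> \<xi>' l) * \<sigma>' l) ?S ?p ?p = - j"
      by (rule \<sigma>_dot_\<sigma>'_entry [OF S]) (use ij in auto)
    moreover have "interp (Ident [\<F>] (l + 2) \<star> \<xi> l) ?S ?p ?p = i"
      using S ij by (simp add: interp_horiz entries insert_absorb)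
    moreover have "interp (Ident [\<F>, \<E>] l \<star> bub_plus 1 l) ?S ?p ?p = s - 2 * i"
      using S ij bub_1_entry [OF ij(1) l] by (simp add: interp_horiz entries s_def insert_absorb)
    moreover have "interp (bub_plus 1 l \<star> Ident [\<F>, \<E>] l) ?S ?p ?p = s - 2 * j"
      using S ij bub_1_entry [OF ij(2) l] by (simp add: interp_horiz entries s_def S' insert_absorb)
    moreover have "interp f ?S ?p ?p = 0" using f0 by simp
    ultimately show ?thesis by (simp add: f_def)
  qed
  \<comment> \<open>There are at least three points because \<open>l > 0\<close>, so that either
    label can be varied while the other is fixed.\<close>
  have three: "\<exists>j\<in>\<Omega>. j \<noteq> x \<and> j \<noteq> z" for x z
  proof (rule ccontr)
    assume "\<not> ?thesis"
    then have "\<Omega> \<subseteq> {x, z}" by auto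
    then have "card \<Omega> \<le> card {x, z}" by (intro card_mono) auto
    also have "\<dots> \<le> 2" by (simp add: card_insert_if)
    finally show False using l \<open>l > 0\<close> by simp
  qed
  obtain i where i: "i \<in> \<Omega>" using three by blast
  obtain j where j: "j \<in> \<Omega>" "j \<noteq> i" using three by blast
  obtain k where k: "k \<in> \<Omega>" "k \<noteq> i" "k \<noteq> j" using three by blast
  let ?E = "\<lambda>i j. - \<phi> \<alpha> * j + \<phi> a * i - \<phi> y * (s - 2 * i) + \<phi> y' * (s - 2 * j)"
  \<comment> \<open>Two values of \<open>j\<close> for the same \<open>i\<close> isolate the
    coefficient of \<open>j\<close>; then the roles are exchanged.\<close>
  have "(\<phi> \<alpha> + 2 * \<phi> y') * (k - j) = ?E i j - ?E i k" by (simp add: algebra_simps)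
  also have "\<dots> = 0" using main [OF i j(1)] main [OF i k(1)] j k by simp
  finally have 1: "\<phi> \<alpha> = - 2 * \<phi> y'" using k by (simp add: eq_neg_iff_add_eq_0)
  have "(\<phi> a + 2 * \<phi> y) * (i - j) = ?E i k - ?E j k" by (simp add: algebra_simps)
  also have "\<dots> = 0" using main [OF i k(1)] main [OF j(1) k(1)] k by simp
  finally have 2: "\<phi> a = - 2 * \<phi> y" using j by (simp add: eq_neg_iff_add_eq_0)
  \<comment> \<open>With the coefficients of both labels gone, only a multiple of the sum of all
    points is left.\<close>
  have "(\<phi> y' - \<phi> y) * s = ?E i j" by (simp add: 1 2 algebra_simps)
  also have "\<dots> = 0" using main [OF i j(1)] j by simp
  finally have 3: "\<phi> y' = \<phi> y" using assms(3) by (simp add: s_def)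
  have two: "\<phi> (2 * c) = 2 * \<phi> c" for c
    by (simp only: mult_2 \<phi>_add)
  have "\<phi> (\<alpha> + 2 * y') = 0" "\<phi> (a + 2 * y) = 0" "\<phi> (y' + - y) = 0"
    unfolding \<phi>_add two \<phi>_uminus using 1 2 3 by simp_all
  then have "\<alpha> + 2 * y' = 0" "a + 2 * y = 0" "y' + - y = 0"
    by (blast dest: \<phi>_eq_0)+
  then show ?thesis by (simp add: eq_neg_iff_add_eq_0)
qed

end

definition poly_fract :: "'k::field poly \<Rightarrow> 'k poly fract" where
  "poly_fract f = Fract f 1"

lemma poly_fract_simps:
  "poly_fract (f + g) = poly_fract f + poly_fract g" "poly_fract (f * g) = poly_fract f * poly_fract g"
  "poly_fract 1 = 1" "poly_fract 0 = 0" "poly_fract f = poly_fract g \<longleftrightarrow> f = g"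
  by (simp_all add: poly_fract_def One_fract_def Zero_fract_def eq_fract)

lemma poly_fract_sum: "poly_fract (sum f A) = (\<Sum>i\<in>A. poly_fract (f i))"
  by (induction A rule: infinite_finite_induct) (simp_all add: poly_fract_simps)

text \<open>
  The powers of the variable in \<open>k(X)\<close> serve as the elements \<open>t\<^sub>i\<close>, since \<open>k\<close> may be finite.
\<close>

lemma exists_flag_model:
  assumes "n > 0"
  obtains \<Omega> :: "'k::field poly fract set" and \<phi> :: "'k \<Rightarrow> 'k poly fract"
    where "flag_model \<Omega> \<phi>" "card \<Omega> = n" "\<Sum>\<Omega> \<noteq> 0"
proof -
  let ?f = "\<lambda>i::nat. poly_fract (monom (1 :: 'k) i)"
  have inj: "inj_on ?f {..<n}"
    by (auto simp: inj_on_def poly_fract_simps monom_eq_iff')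
  \<comment> \<open>Only the power with exponent 0 has a constant term, so the sum of the points is
    nonzero in every characteristic.\<close>
  have "coeff (\<Sum>i<n. monom (1 :: 'k) i) 0 = 1"
    using assms by (simp add: coeff_sum)
  then have "(\<Sum>i<n. monom (1 :: 'k) i) \<noteq> 0" by auto
  then have "\<Sum>(?f ` {..<n}) \<noteq> 0"
    using poly_fract_simps(5) [of "\<Sum>i<n. monom (1 :: 'k) i" 0]
    by (simp add: sum.reindex [OF inj] poly_fract_sum [symmetric] poly_fract_simps)
  moreover have "flag_model (?f ` {..<n}) (\<lambda>c. poly_fract [:c:])"
    by unfold_locales (simp_all add: poly_fract_simps [symmetric] one_pCons mult.commute)
  moreover have "card (?f ` {..<n}) = n" using card_image [OF inj] by simp
  ultimately show thesis using that by blast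
qed

context U_differential
begin

text \<open>The indices tested are \<open>0\<close>, \<open>l - 1\<close> and \<open>l\<close>. For
  an index below \<open>l - 1\<close>, pairing with the inclusion kills the next dotted cap and
  leaves the multiple of the bubble. For \<open>l - 1\<close> the next dotted cap is outside the
  dual family and closes to a bubble itself, so its coefficient is added. The index 0 is of the
  first kind only if \<open>l \<ge> 2\<close>.\<close>

lemma yields_fc_conditions:
  assumes "l > 0" "yields_fc D l"
  shows "l \<ge> 2 \<Longrightarrow> py P (l - 2) = 0"
    and "px P (l - 2) + of_int l - 1 + py P (l - 2) = 0"
    and "px P (l - 2) + pa P (l - 2) - 1 - px P l - 2 * py P l = - 2 * py P l"
    and "1 + pa P (l - 2) = - 2 * py P (l - 2)"
    and "py P l = py P (l - 2)"
proof -
  obtain \<Omega> :: "'k poly fract set" and \<phi> :: "'k \<Rightarrow> 'k poly fract"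
    where model: "flag_model \<Omega> \<phi>" and card: "card \<Omega> = nat l + 2" and sum: "\<Sum>\<Omega> \<noteq> 0"
    by (rule exists_flag_model [of "nat l + 2"]) simp_all
  have N: "l = int (card \<Omega>) - 2" using card assms(1) by simp
  note bub = flag_model.scale_bub_1 [OF model N assms(1) sum]
  note D0 = yields_fcD [OF assms]
  have b: "cls (bub_plus 1 l) * idm [] l = (cls (bub_plus 1 l) :: 'k mor)"
    by (rule HOM_idm(2) [OF HOM_bub(1)])
  show "py P (l - 2) = 0" if "l \<ge> 2"
  proof (rule bub)
    have lt: "0 < nat l" "1 < nat l" using that by auto
    have "D (capEF l 0) * cls (incl l 0) = 0"
      using D0 [of 0] lt by (simp add: cls_proj)
    then show "scale (py P (l - 2)) (cls (bub_plus 1 l)) = 0"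
      unfolding D_capEF
      using lt by (simp add: distrib_right scale_simps(5) mult.assoc cap_incl b)
  qed
  show "px P (l - 2) + of_int l - 1 + py P (l - 2) = 0"
  proof (rule bub)
    \<comment> \<open>For this index the inclusion is the plain cup: its sum has one term, without
      dots and with \<open>bub_minus 0 l\<close>.\<close>
    obtain c where "nat l = Suc c" using assms(1) by (cases "nat l") auto
    then have lt: "c < nat l" and c: "int c = l - 1" "nat (l - int c) = Suc 0" by auto
    have "cls (incl l c) = cls (\<eta>' l) * (cls (bub_minus 0 l) :: 'k mor)"
      unfolding cls_incl [OF lt] c by (simp add: dotEF_0 HOM_idm [OF HOM_gens(6)])
    also have "cls (bub_minus 0 l) = (idm [] l :: 'k mor)"
      by (rule cls_eqI [OF eqU.bub_rel [OF bub_rel.bub_minus_0]])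
    finally have incl: "cls (incl l c) = (cls (\<eta>' l) :: 'k mor)"
      by (simp add: HOM_idm [OF HOM_gens(6)])
    have "capEF l (Suc c) * cls (\<eta>' l) = (cls (bub_plus 1 l) :: 'k mor)"
      using c by (simp add: capEF_def cap_dot_cup)
    moreover have "capEF l c * cls (\<eta>' l) = (idm [] l :: 'k mor)"
      unfolding incl [symmetric] by (simp add: cap_incl lt)
    moreover have "D (capEF l c) * cls (\<eta>' l) = 0"
      using D0 [of c] lt by (simp add: cls_proj incl)
    ultimately have "scale (px P (l - 2) + of_nat c) (cls (bub_plus 1 l)) + scale (py P (l - 2)) (cls (bub_plus 1 l)) = (0 :: 'k mor)"
      unfolding D_capEF by (simp add: distrib_right scale_simps(5) mult.assoc b)
    moreover have "of_nat c = (of_int l - 1 :: 'k)"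
      using c by (metis of_int_1 of_int_diff of_int_of_nat_eq)
    ultimately show "scale (px P (l - 2) + of_int l - 1 + py P (l - 2)) (cls (bub_plus 1 l)) = 0"
      by (simp add: scale_simps(2) [symmetric] algebra_simps)
  qed
  have "D (cls (\<sigma> l)) * cls (\<sigma>' l) = 0"
    using D0 [of "nat l"] by (simp add: cls_proj incl_def cls_simps)
  note * = flag_model.\<sigma>_condition [OF model N assms(1) sum this [unfolded D_\<sigma>_\<sigma>' [OF assms(1)]]]
  show "px P (l - 2) + pa P (l - 2) - 1 - px P l - 2 * py P l = - 2 * py P l"
    "1 + pa P (l - 2) = - 2 * py P (l - 2)" "py P l = py P (l - 2)"
    using * by auto
qed

lemma yields_fc_params_minus1:
  assumes P: "P = params_minus1" and l: "l > 0"
  shows "yields_fc D l"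
proof (rule yields_fcI [OF l])
  define rank where "rank i = (if i < nat l then nat l - 1 - i else nat l)" for i
  show "inj_on rank {0..nat l}"
    by (auto simp: inj_on_def rank_def split: if_splits)
  fix i assume i: "i \<le> nat l"
  show "D (cls (proj l i)) = 0 \<or>
      (\<exists>k\<le>nat l. rank k < rank i \<and> D (cls (proj l i)) = D (cls (proj l i)) * cls (incl l k) * cls (proj l k))"
  proof (cases "i < nat l")
    case True
    have D: "D (cls (proj l i)) = scale (of_nat i + 1 - of_int l) (capEF l (Suc i))"
      using True by (simp add: cls_proj D_capEF P params_minus1_def algebra_simps)
    show ?thesis
    proof (cases "Suc i < nat l")
      case True
      have "capEF l (Suc i) * cls (incl l (Suc i)) * capEF l (Suc i) = (capEF l (Suc i) :: 'k mor)"
        by (simp add: cap_incl True HOM_idm [OF HOM_capEF])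
      then show ?thesis
        using True unfolding D by (intro disjI2 exI [of _ "Suc i"]) (simp add: rank_def scale_simps cls_proj)
    next
      case False
      \<comment> \<open>The last dotted cap must have derivative 0, since the next one would not be
        among the projections; the coefficient vanishes exactly here.\<close>
      then have "int i + 1 - l = 0" using \<open>i < nat l\<close> by simp
      then have "of_nat i + 1 - of_int l = (0 :: 'k)"
        by (metis of_int_0 of_int_1 of_int_add of_int_diff of_int_of_nat_eq)
      then show ?thesis unfolding D by simp
    qed
  next
    case False
    then have iL: "i = nat l" using i by simp
    have D: "D (cls (proj l i)) = scale (of_int l) (cls (\<eta> l) * capEF l 0)"
      by (simp add: cls_proj False D_\<sigma> P params_minus1_def capEF_def dotEF_0 HOM_idm [OF HOM_gens(7)])
    have "capEF l 0 * cls (incl l 0) * capEF l 0 = (capEF l 0 :: 'k mor)"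
      using l by (simp add: cap_incl HOM_idm [OF HOM_capEF])
    then have "cls (\<eta> l) * capEF l 0 * cls (incl l 0) * capEF l 0 = (cls (\<eta> l) * capEF l 0 :: 'k mor)"
      by (simp add: mult.assoc)
    then show ?thesis
      using l unfolding D by (intro disjI2 exI [of _ 0]) (simp add: rank_def iL scale_simps cls_proj)
  qed
qed

end

text \<open>For given \<open>l\<close> the data only involve parameters at \<open>l - 2\<close> and
  \<open>l\<close>; for \<open>l > 0\<close> these are the weights \<open>m \<ge> -1\<close>, which
  explains the range in the uniqueness statement. The last clause records what one single
  \<open>l \<ge> 2\<close> determines.\<close>

theorem proposition5p12:
  fixes p :: nat and P :: "'k::field params" and D :: "'k mor \<Rightarrow> 'k mor"
  assumes "p > 0" and "CHAR('k) = p"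
    and "admissible P" and "p_differential p P D"
  shows "(P = params_minus1 \<longrightarrow> (\<forall>l>0. yields_fc D l)) \<and>
         ((\<forall>l>0. yields_fc D l) \<longrightarrow>
            (\<forall>m\<ge>-1. px P m = px params_minus1 m \<and> pxb P m = pxb params_minus1 m \<and>
                     py P m = py params_minus1 m \<and> pyb P m = pyb params_minus1 m \<and>
                     pa P m = pa params_minus1 m \<and> pab P m = pab params_minus1 m)) \<and>
         (\<forall>l\<ge>2. yields_fc D l \<longrightarrow>
            (\<forall>m\<in>{l - 2, l}. px P m = px params_minus1 m \<and> pxb P m = pxb params_minus1 m \<and>
                            py P m = py params_minus1 m \<and> pyb P m = pyb params_minus1 m) \<and>
            pa P (l - 2) = pa params_minus1 (l - 2) \<and> pab P (l - 2) = pab params_minus1 (l - 2))"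
proof -
  interpret U_differential p P D
    using assms(4) by unfold_locales
  have x: "px P m + pxb P m = - of_int m" and y: "py P m + pyb P m = -1"
    and a: "pa P m - pab P m = px P (m + 2) - px P m - 2 * py P m" for m
    using assms(3) by (auto simp: admissible_def)
  have xb: "pxb P m = 1 \<longleftrightarrow> px P m = -1 - of_int m" for m
  proof -
    have "px P m = - of_int m - pxb P m" using x [of m] by (simp add: eq_diff_eq)
    moreover have "-1 - of_int m = - of_int m - (1 :: 'k)" by simp
    ultimately show ?thesis by simp
  qed
  have yb: "pyb P m = -1 \<longleftrightarrow> py P m = 0" for m
  proof -
    have "pyb P m = -1 - py P m" using y [of m] by (simp add: eq_diff_eq add.commute)
    then show ?thesis by simp
  qed
  \<comment> \<open>The vanishing of \<open>py P (l - 2)\<close> is a premise because for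
    \<open>l = 1\<close> it is obtained from other weights.\<close>
  have main: "px P (l - 2) = -1 - of_int (l - 2) \<and> px P l = -1 - of_int l \<and> pa P (l - 2) = -1 \<and> pab P (l - 2) = 1"
    if "l > 0" "yields_fc D l" "py P (l - 2) = 0" for l
  proof -
    note c = yields_fc_conditions [OF that(1,2)]
    have 1: "px P (l - 2) = 1 - of_int l" using c(2) that(3) by (simp add: algebra_simps eq_neg_iff_add_eq_0)
    moreover have 2: "pa P (l - 2) = -1" using c(4) that(3) by (simp add: eq_neg_iff_add_eq_0 add.commute)
    moreover have 3: "px P l = -1 - of_int l"
    proof -
      have "px P l = px P (l - 2) + pa P (l - 2) - 1" using c(3) by (simp add: algebra_simps)
      then show ?thesis unfolding 1 2 by simp
    qed
    \<comment> \<open>The difference of the two values of \<open>px\<close> is \<open>-2\<close>, so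
      admissibility gives \<open>pab\<close> as \<open>pa + 2\<close> at this weight.\<close>
    moreover have "pab P (l - 2) = 1" using a [of "l - 2"] that(3) 1 2 3 by (simp add: algebra_simps)
    ultimately show ?thesis by simp
  qed
  have two: "py P (l - 2) = 0 \<and> py P l = 0" if "l \<ge> 2" "yields_fc D l" for l
    using yields_fc_conditions(1,5) [of l] that by simp
  have "\<forall>l\<ge>2. yields_fc D l \<longrightarrow>
            (\<forall>m\<in>{l - 2, l}. px P m = px params_minus1 m \<and> pxb P m = pxb params_minus1 m \<and>
                            py P m = py params_minus1 m \<and> pyb P m = pyb params_minus1 m) \<and>
            pa P (l - 2) = pa params_minus1 (l - 2) \<and> pab P (l - 2) = pab params_minus1 (l - 2)"
    using main two by (simp add: params_minus1_def xb yb)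
  moreover have "px P m = px params_minus1 m \<and> pxb P m = pxb params_minus1 m \<and>
                     py P m = py params_minus1 m \<and> pyb P m = pyb params_minus1 m \<and>
                     pa P m = pa params_minus1 m \<and> pab P m = pab params_minus1 m"
    if fc: "\<forall>l>0. yields_fc D l" and m: "m \<ge> -1" for m
  proof -
    have "py P m = 0"
    proof (cases "m = -1")
      \<comment> \<open>The weight \<open>-1\<close> occurs only for \<open>l = 1\<close>, which
        gives just \<open>py P (-1) = py P 1\<close>; that \<open>py P 1\<close> vanishes comes from
        \<open>l = 3\<close>.\<close>
      case True
      have "py P (1 - 2) = py P 1" using yields_fc_conditions(5) [of 1] fc by simp
      moreover have "py P 1 = 0" using two [of 3] fc by simp
      ultimately show ?thesis using True by simp
    qed (use two [of "m + 2"] fc m in auto)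
    then show ?thesis
      using main [of "m + 2"] fc m by (simp add: params_minus1_def xb yb)
  qed
  ultimately show ?thesis
    using yields_fc_params_minus1 by blast
qed

end
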